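(* Let $\alpha\ge 2$. There exists $\epsilon>0$ such that for any solution $\psi(t)$, $t\in[0,T_{\max})$, of the Hill's type lunar problem with $E(\psi)<E^*+\epsilon^2$ that starts inside the $2\epsilon$ ball of the ground states, $d_Q(\psi(0))<2\epsilon$: either $\psi$ stays inside this ball, i.e. $d_Q(\psi(t))<2\epsilon$ for all $t\in[0,T_{\max})$, or $\psi$ is ejected out of the ball, i.e. it has an exit time $t_e=\sup\{t: d_Q(\psi(s))<2\epsilon\ \forall s\in[0,t)\}<T_{\max}$. Moreover, in the latter case, if at the exit time $W(\psi(t_e))<0$, then the solution collides with the origin in finite time, i.e. $T_{\max}<\infty$ and $(x(t),y(t))\to(0,0)$ as $t\to T_{\max}$.
   Context: Hill's type lunar problem: $\ddot x-2\dot y=-V_x$, $\ddot y+2\dot x=-V_y$, with $V(x,y)=-\frac{\alpha+2}{2}x^2-\frac{\alpha+2}{r^\alpha}$, $r=\sqrt{x^2+y^2}$, on $(x,y)\neq(0,0)$. In symplectic coordinates $\psi=(x,y,p_x,p_y)$ with $p_x=\dot x-y$, $p_y=\dot y+x$, it reads $\dot\psi=J\nabla E(\psi)$, where $J=\begin{pmatrix}0&I\\-I&0\end{pmatrix}$ and $E(\psi)=\frac12[(p_x+y)^2+(p_y-x)^2]+V(x,y)$ is the conserved energy. $[0,T_{\max})$ is the maximal forward interval of existence. $W=-xV_x-yV_y=(\alpha+2)(x^2-\alpha r^{-\alpha})$. The ground states are the equilibria $\pm\tilde Q=\pm(q_0,0,0,q_0)$, $q_0=\alpha^{1/(\alpha+2)}$,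 and $E^*=E(\pm\tilde Q)=-\frac12(\alpha+2)^2\alpha^{-\alpha/(\alpha+2)}$. Distance function $d_Q$. Let $\Omega(\xi,\eta)=J\xi\cdot\eta$ and $A=J\nabla^2E(\tilde Q)$ $(=J\nabla^2E(-\tilde Q))$. The eigenvalues of $A$ are $\pm k$ and $\pm i\omega$ with $k,\omega>0$. Let $\xi_\pm$ be eigenvectors for $\pm k$ normalized by $\Omega(\xi_+,\xi_-)=1$ and $|\xi_+|=|\xi_-|$, and let $E^c$ be the real invariant plane of $A$ for $\pm i\omega$. For $\sigma\in\{+1,-1\}$ write $\psi=\sigma(\tilde Q+X)$ and $X=\lambda_+\xi_++\lambda_-\xi_-+\gamma$ with $\gamma\in E^c$. Set $|X|_E^2=\frac k2(\lambda_+^2+\lambda_-^2)+\frac12\Omega(\gamma,A\gamma)$ (a norm squared) and $C(\psi)=E(\psi)-E(\tilde Q)+\frac k2(\lambda_++\lambda_-)^2-|X|_E^2$ (which is $O(|X|^3)$). Fix a small constant $\delta_E>0$ such that $|C(\psi)|\le|X|_E^2/10$ whenever $|X|_E\le4\delta_E$, small enough that the neighbourhoods of $\tilde Q$ and $-\tilde Q$ involved are disjoint. Let $\chi:\mathbb R\to[0,1]$ be smooth with $\chi(s)=1$ for $|s|\le1$ and $\chi(s)=0$ for $|s|\ge2$. Define $d_\sigma(\psi)=\sqrt{|X|_E^2+\chi(|X|_E/2\delta_E)\,C(\psi)}$ and $d_Q(\psi)=\min(d_+(\psi),d_-(\psi))$. *)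

theory Defs
  imports "HOL-Analysis.Analysis"
begin

section \<open>The Hamiltonian system\<close>

text \<open>Phase points are \<open>\<psi> = (x, y, p\<^sub>x, p\<^sub>y)\<close>, with components \<open>\<psi>$1, \<dots>, \<psi>$4\<close>.\<close>

definition phase_space :: "(real^4) set" where
  "phase_space = {\<psi>. (\<psi>$1, \<psi>$2) \<noteq> (0, 0)}"

definition V :: "real \<Rightarrow> real \<Rightarrow> real \<Rightarrow> real" where
  "V \<alpha> x y = - (\<alpha> + 2) / 2 * x\<^sup>2 - (\<alpha> + 2) / (sqrt (x\<^sup>2 + y\<^sup>2)) powr \<alpha>"

definition energy :: "real \<Rightarrow> real^4 \<Rightarrow> real" where
  "energy \<alpha> \<psi> = 1/2 * ((\<psi>$3 + \<psi>$2)\<^sup>2 + (\<psi>$4 - \<psi>$1)\<^sup>2) + V \<alpha> (\<psi>$1) (\<psi>$2)"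

definition W :: "real \<Rightarrow> real^4 \<Rightarrow> real" where
  "W \<alpha> \<psi> = - \<psi>$1 * deriv (\<lambda>x. V \<alpha> x (\<psi>$2)) (\<psi>$1) - \<psi>$2 * deriv (\<lambda>y. V \<alpha> (\<psi>$1) y) (\<psi>$2)"

definition J :: "real^4^4" where
  "J = vector [vector [ 0,  0, 1, 0],
               vector [ 0,  0, 0, 1],
               vector [-1,  0, 0, 0],
               vector [ 0, -1, 0, 0]]"

definition grad :: "('a::real_inner \<Rightarrow> real) \<Rightarrow> 'a \<Rightarrow> 'a" where
  "grad f p = (THE D. GDERIV f p :> D)"

definition hess :: "(real^'n \<Rightarrow> real) \<Rightarrow> real^'n \<Rightarrow> real^'n^'n" where
  "hess f p = jacobian (grad f) (at p)"

text \<open>A solution on \<open>[0, T)\<close> with \<open>0 < T \<le> \<infinity>\<close>; values outside \<open>[0, T)\<close> are irrelevant.\<close>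

definition solution_on :: "real \<Rightarrow> (real \<Rightarrow> real^4) \<Rightarrow> ereal \<Rightarrow> bool" where
  "solution_on \<alpha> \<psi> T \<longleftrightarrow> 0 < T \<and>
     (\<forall>t. 0 \<le> t \<and> ereal t < T \<longrightarrow>
        \<psi> t \<in> phase_space \<and>
        (\<psi> has_vector_derivative J *v grad (energy \<alpha>) (\<psi> t)) (at t within {s. 0 \<le> s \<and> ereal s < T}))"

definition maximal_solution :: "real \<Rightarrow> (real \<Rightarrow> real^4) \<Rightarrow> ereal \<Rightarrow> bool" where
  "maximal_solution \<alpha> \<psi> T \<longleftrightarrow> solution_on \<alpha> \<psi> T \<and>
     \<not> (\<exists>\<phi> T'. T < T' \<and> solution_on \<alpha> \<phi> T' \<and> (\<forall>t. 0 \<le> t \<and> ereal t < T \<longrightarrow> \<phi> t = \<psi> t))"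


section \<open>Ground states and the linearization\<close>

definition q0 :: "real \<Rightarrow> real" where
  "q0 \<alpha> = \<alpha> powr (1 / (\<alpha> + 2))"

definition ground :: "real \<Rightarrow> real^4" where
  "ground \<alpha> = vector [q0 \<alpha>, 0, 0, q0 \<alpha>]"

definition E_star :: "real \<Rightarrow> real" where
  "E_star \<alpha> = energy \<alpha> (ground \<alpha>)"

definition Omega :: "real^4 \<Rightarrow> real^4 \<Rightarrow> real" where
  "Omega \<xi> \<eta> = (J *v \<xi>) \<bullet> \<eta>"

definition lin :: "real \<Rightarrow> real^4^4" where
  "lin \<alpha> = J ** hess (energy \<alpha>) (ground \<alpha>)"

definition eigenspace :: "real^'n^'n \<Rightarrow> complex \<Rightarrow> (complex^'n) set" where
  "eigenspace M z = {w. map_matrix complex_of_real M *v w = z *s w}"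

definition eigenvalues :: "real^'n^'n \<Rightarrow> complex set" where
  "eigenvalues M = {z. \<exists>w \<in> eigenspace M z. w \<noteq> 0}"

text \<open>The real invariant plane: the real vectors in the sum of the eigenspaces for \<open>\<plusminus>i\<omega>\<close>.\<close>

definition center_space :: "real \<Rightarrow> real \<Rightarrow> (real^4) set" where
  "center_space \<alpha> \<omega> =
     {v. \<exists>w\<^sub>1 \<in> eigenspace (lin \<alpha>) (\<i> * complex_of_real \<omega>).
         \<exists>w\<^sub>2 \<in> eigenspace (lin \<alpha>) (- \<i> * complex_of_real \<omega>).
           (\<chi> i. complex_of_real (v $ i)) = w\<^sub>1 + w\<^sub>2}"

definition eigen_frame :: "real \<Rightarrow> real \<Rightarrow> real \<Rightarrow> real^4 \<Rightarrow> real^4 \<Rightarrow> bool" where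
  "eigen_frame \<alpha> k \<omega> \<xi>p \<xi>m \<longleftrightarrow>
     0 < k \<and> 0 < \<omega> \<and>
     eigenvalues (lin \<alpha>) = {complex_of_real k, - complex_of_real k,
                            \<i> * complex_of_real \<omega>, - \<i> * complex_of_real \<omega>} \<and>
     \<xi>p \<noteq> 0 \<and> lin \<alpha> *v \<xi>p = k *\<^sub>R \<xi>p \<and>
     \<xi>m \<noteq> 0 \<and> lin \<alpha> *v \<xi>m = (- k) *\<^sub>R \<xi>m \<and>
     Omega \<xi>p \<xi>m = 1 \<and> norm \<xi>p = norm \<xi>m"


section \<open>The distance function\<close>

text \<open>The components \<open>(\<lambda>\<^sub>+, \<lambda>\<^sub>-, \<gamma>)\<close> of a displacement \<open>X = \<lambda>\<^sub>+ \<xi>\<^sub>+ + \<lambda>\<^sub>- \<xi>\<^sub>- + \<gamma>\<close>.\<close>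

definition components ::
  "real \<Rightarrow> real \<Rightarrow> real^4 \<Rightarrow> real^4 \<Rightarrow> real^4 \<Rightarrow> real \<times> real \<times> (real^4)" where
  "components \<alpha> \<omega> \<xi>p \<xi>m X =
     (THE (lp, lm, \<gamma>). \<gamma> \<in> center_space \<alpha> \<omega> \<and> X = lp *\<^sub>R \<xi>p + lm *\<^sub>R \<xi>m + \<gamma>)"

definition norm_E ::
  "real \<Rightarrow> real \<Rightarrow> real \<Rightarrow> real^4 \<Rightarrow> real^4 \<Rightarrow> real^4 \<Rightarrow> real" where
  "norm_E \<alpha> k \<omega> \<xi>p \<xi>m X =
     (let (lp, lm, \<gamma>) = components \<alpha> \<omega> \<xi>p \<xi>m X
      in sqrt (k / 2 * (lp\<^sup>2 + lm\<^sup>2) + 1/2 * Omega \<gamma> (lin \<alpha> *v \<gamma>)))"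

text \<open>The displacement \<open>X\<close> with \<open>\<psi> = \<sigma> (Q + X)\<close>, for \<open>\<sigma> \<in> {1, -1}\<close>.\<close>

definition displacement :: "real \<Rightarrow> real \<Rightarrow> real^4 \<Rightarrow> real^4" where
  "displacement \<alpha> \<sigma> \<psi> = \<sigma> *\<^sub>R \<psi> - ground \<alpha>"

definition C_rem ::
  "real \<Rightarrow> real \<Rightarrow> real \<Rightarrow> real^4 \<Rightarrow> real^4 \<Rightarrow> real \<Rightarrow> real^4 \<Rightarrow> real" where
  "C_rem \<alpha> k \<omega> \<xi>p \<xi>m \<sigma> \<psi> =
     (let X = displacement \<alpha> \<sigma> \<psi>; (lp, lm, \<gamma>) = components \<alpha> \<omega> \<xi>p \<xi>m X
      in energy \<alpha> \<psi> - energy \<alpha> (ground \<alpha>) + k / 2 * (lp + lm)\<^sup>2 - (norm_E \<alpha> k \<omega> \<xi>p \<xi>m X)\<^sup>2)"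

text \<open>\<open>C\<close> is only meaningful on the phase space, hence the restriction in the second clause.
  The third clause says that the two closed neighbourhoods on which the cutoff in \<open>d_sigma\<close>
  may be nonzero are disjoint.\<close>

definition admissible_radius ::
  "real \<Rightarrow> real \<Rightarrow> real \<Rightarrow> real^4 \<Rightarrow> real^4 \<Rightarrow> real \<Rightarrow> bool" where
  "admissible_radius \<alpha> k \<omega> \<xi>p \<xi>m \<delta> \<longleftrightarrow>
     0 < \<delta> \<and>
     (\<forall>\<sigma> \<in> {1, -1}. \<forall>\<psi> \<in> phase_space.
        norm_E \<alpha> k \<omega> \<xi>p \<xi>m (displacement \<alpha> \<sigma> \<psi>) \<le> 4 * \<delta> \<longrightarrow>
        \<bar>C_rem \<alpha> k \<omega> \<xi>p \<xi>m \<sigma> \<psi>\<bar> \<le> (norm_E \<alpha> k \<omega> \<xi>p \<xi>m (displacement \<alpha> \<sigma> \<psi>))\<^sup>2 / 10) \<and>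
     {\<psi>. norm_E \<alpha> k \<omega> \<xi>p \<xi>m (displacement \<alpha> 1 \<psi>) \<le> 4 * \<delta>} \<inter>
     {\<psi>. norm_E \<alpha> k \<omega> \<xi>p \<xi>m (displacement \<alpha> (-1) \<psi>) \<le> 4 * \<delta>} = {}"

definition smooth_cutoff :: "(real \<Rightarrow> real) \<Rightarrow> bool" where
  "smooth_cutoff f \<longleftrightarrow>
     (\<forall>n. (deriv ^^ n) f differentiable_on UNIV) \<and>
     range f \<subseteq> {0..1} \<and>
     (\<forall>s. \<bar>s\<bar> \<le> 1 \<longrightarrow> f s = 1) \<and> (\<forall>s. 2 \<le> \<bar>s\<bar> \<longrightarrow> f s = 0)"

definition d_sigma ::
  "real \<Rightarrow> real \<Rightarrow> real \<Rightarrow> real^4 \<Rightarrow> real^4 \<Rightarrow> real \<Rightarrow> (real \<Rightarrow> real) \<Rightarrow> real \<Rightarrow> real^4 \<Rightarrow> real" where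
  "d_sigma \<alpha> k \<omega> \<xi>p \<xi>m \<delta> cutoff \<sigma> \<psi> =
     (let N = norm_E \<alpha> k \<omega> \<xi>p \<xi>m (displacement \<alpha> \<sigma> \<psi>)
      in sqrt (N\<^sup>2 + cutoff (N / (2 * \<delta>)) * C_rem \<alpha> k \<omega> \<xi>p \<xi>m \<sigma> \<psi>))"

definition d_Q ::
  "real \<Rightarrow> real \<Rightarrow> real \<Rightarrow> real^4 \<Rightarrow> real^4 \<Rightarrow> real \<Rightarrow> (real \<Rightarrow> real) \<Rightarrow> real^4 \<Rightarrow> real" where
  "d_Q \<alpha> k \<omega> \<xi>p \<xi>m \<delta> cutoff \<psi> =
     min (d_sigma \<alpha> k \<omega> \<xi>p \<xi>m \<delta> cutoff 1 \<psi>) (d_sigma \<alpha> k \<omega> \<xi>p \<xi>m \<delta> cutoff (-1) \<psi>)"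

text \<open>The supremum of all \<open>t \<in> [0, T]\<close> such that \<open>d (\<psi> s) < \<rho>\<close> for all \<open>s \<in> [0, t)\<close>; it equals
  \<open>T\<close> if \<open>d (\<psi> s) < \<rho>\<close> on all of \<open>[0, T)\<close>.\<close>

definition exit_time :: "(real^4 \<Rightarrow> real) \<Rightarrow> real \<Rightarrow> (real \<Rightarrow> real^4) \<Rightarrow> ereal \<Rightarrow> ereal" where
  "exit_time d \<rho> \<psi> T =
     Sup {t. 0 \<le> t \<and> t \<le> T \<and> (\<forall>s. 0 \<le> s \<and> ereal s < t \<longrightarrow> d (\<psi> s) < \<rho>)}"

end

theory Submission
  imports Defs
begin

text \<open>At an exit time the distance to one of the ground states equals \<open>2\<epsilon>\<close> while the energy exceeds
  \<open>E\<^sup>*\<close> by less than \<open>\<epsilon>\<^sup>2\<close>, so \<open>\<Lambda>\<^sup>2 > 3\<epsilon>\<^sup>2\<close> for the coordinate \<open>\<Lambda> = (k/2)\<^sup>1\<^sup>/\<^sup>2 (\<lambda>\<^sub>+ + \<lambda>\<^sub>-)\<close>, which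
  therefore dominates the displacement \<open>X\<close>; moreover \<open>\<Lambda>\<^sup>2\<close> is not decreasing there. Since
  \<open>\<Lambda>'' = k\<^sup>2 \<Lambda> + o(X)\<close>, \<open>|\<Lambda>|\<close> stays convex and increasing until it reaches a size \<open>\<delta>\<^sub>1\<close> independent of
  \<open>\<epsilon>\<close>. In the energy cone the sign of \<open>\<Lambda>\<close> is the sign of \<open>r - q\<^sub>0\<close> and of \<open>W\<close>, and if \<open>W < 0\<close> then the
  virial \<open>x x' + y y'\<close> has derivative at most \<open>-c |\<Lambda>|\<close> as soon as \<open>|\<Lambda>| \<ge> 7\<epsilon>\<close>. Hence the orbit
  reaches a disc \<open>r\<^sup>2 \<le> s\<^sub>1 < q\<^sub>0\<^sup>2\<close> with \<open>(r\<^sup>2)' < 0\<close>. For \<open>\<alpha> \<ge> 2\<close> and energy close to or below \<open>E\<^sup>*\<close>,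
  \<open>r\<^sup>2\<close> is concave in time on that disc, so it decreases to a collision in finite time; the limit is \<open>0\<close> because an
  orbit that stays in a compact part of the phase space can be continued.\<close>

section \<open>Continuation of solutions\<close>

text \<open>Near a ground state the cut-off is 1 and the distance satisfies d^2 = E - E_star +
  \<Lambda>^2. As E is conserved, \<Lambda>^2 alone governs the distance there: this is where both
  the lower bound at the exit and the monotonicity come from. The frame enters the estimates only
  through k and two numbers g, p with \<Lambda> = g (X_1 + p (X_4 - X_1)) up to sign, so everything
  after the spectral analysis is explicit. The obstacle is that at the exit the virial has size
  O(\<epsilon>) and unknown sign, while its derivative is controlled only once |\<Lambda>| is at
  least 7 \<epsilon>. Instead of estimating times, the proof compares the virial with a multiple of
  |\<Lambda>|: the growth of |\<Lambda>| from O(\<epsilon>) to a fixed size lowers the virial by a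
  fixed amount, which beats the O(\<epsilon>) present at the start. The condition on \<alpha> is
  used as \<alpha>/2 \<ge> 1 in Bernoulli's inequality and as \<alpha> + 2 \<ge> 4 in the numerical
  constants. The negative ground state is treated by the symmetry that sends \<psi> to its
  negative.\<close>

lemma picard_local:
  fixes f :: "'a::euclidean_space \<Rightarrow> 'a" and a :: real
  assumes "0 < \<rho>" and lip: "B-lipschitz_on (cball p \<rho>) f"
  shows "\<exists>h>0. \<exists>y. continuous_on {a..a + h} y \<and>
    (\<forall>t\<in>{a..a + h}. y t \<in> cball p \<rho> \<and> y t = p + integral {a..t} (\<lambda>s. f (y s)))"
proof -
  \<comment> \<open>Composing with the projection to the ball makes the field bounded and globally
    Lipschitz, so the Picard operator is defined for all bounded continuous functions. The fixed
    point turns out to stay in the ball, where \<open>F\<close> agrees with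
    \<open>f\<close>.\<close>
  define F where "F = f \<circ> closest_point (cball p \<rho>)"
  have B: "0 \<le> B" using lip lipschitz_on_nonneg by blast
  have cp: "closest_point (cball p \<rho>) x \<in> cball p \<rho>" for x
    using assms by (intro closest_point_in_set) auto
  have lipF: "norm (F x - F y) \<le> B * norm (x - y)" for x y
  proof -
    have "dist (F x) (F y) \<le> B * dist (closest_point (cball p \<rho>) x) (closest_point (cball p \<rho>) y)"
      unfolding F_def o_def using lip cp by (intro lipschitz_onD)
    also have "\<dots> \<le> B * dist x y"
      using B assms by (intro mult_left_mono closest_point_lipschitz) auto
    finally show ?thesis by (simp add: dist_norm)
  qed
  have contF: "continuous_on UNIV F"
    by (rule lipschitz_on_continuous_on[where L = B]) (auto intro!: lipschitz_onI simp: dist_norm lipF B)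
  define M where "M = norm (f p) + B * \<rho>"
  have boundF: "norm (F x) \<le> M" for x
  proof -
    have "norm (f (closest_point (cball p \<rho>) x) - f p) \<le> B * dist (closest_point (cball p \<rho>) x) p"
      using lipschitz_onD[OF lip cp, of p x] assms by (simp add: dist_norm)
    also have "\<dots> \<le> B * \<rho>"
      using cp[of x] B by (intro mult_left_mono) (auto simp: dist_commute)
    finally have "norm (f (closest_point (cball p \<rho>) x) - f p) \<le> B * \<rho>" .
    then show ?thesis unfolding F_def M_def o_def
      by (smt (verit) norm_triangle_sub)
  qed
  have M: "0 \<le> M" using boundF[of p] norm_ge_zero order_trans by blast
  \<comment> \<open>The first bound keeps the image of the Picard operator in the ball, the second
    makes its contraction factor 1/2.\<close>
  define h where "h = min (\<rho> / (M + 1)) (1 / (2 * (B + 1)))"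
  have h: "0 < h" "h * M \<le> \<rho>" "h * B \<le> 1/2"
  proof -
    show "0 < h" using M B assms by (simp add: h_def)
    have "h * M \<le> h * (M + 1)" using \<open>0 < h\<close> by simp
    also have "\<dots> \<le> \<rho> / (M + 1) * (M + 1)" using M by (intro mult_right_mono) (auto simp: h_def)
    finally show "h * M \<le> \<rho>" using M by simp
    have "h * B \<le> h * (B + 1)" using \<open>0 < h\<close> by simp
    also have "\<dots> \<le> 1 / (2 * (B + 1)) * (B + 1)" using B by (intro mult_right_mono) (auto simp: h_def)
    also have "\<dots> = 1/2" using B by (simp add: field_simps)
    finally show "h * B \<le> 1/2" .
  qed
  \<comment> \<open>Clamping the time turns functions on the interval into bounded continuous
    functions on the whole line, the complete space on which Banach's theorem is applied.\<close>
  define c where "c t = max a (min t (a + h))" for t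
  have c: "c t \<in> {a..a + h}" "continuous_on UNIV c" for t
    using h by (auto simp: c_def intro!: continuous_intros)
  have cid: "c t = t" if "t \<in> {a..a + h}" for t using that by (auto simp: c_def)
  define G where "G y = (\<lambda>t. p + integral {a..c t} (\<lambda>s. F (apply_bcontfun y s)))" for y :: "real \<Rightarrow>\<^sub>C 'a"
  have contFy: "continuous_on S (\<lambda>s. F (apply_bcontfun y s))" for y S
    by (rule continuous_on_compose2[OF contF]) auto
  have Gbound: "norm (G y t - p) \<le> \<rho>" for y t
  proof -
    have "norm (integral {a..c t} (\<lambda>s. F (apply_bcontfun y s))) \<le> M * (c t - a)"
      using c(1)[of t] boundF contFy by (intro integral_bound) auto
    also have "\<dots> \<le> M * h" using c(1)[of t] M by (intro mult_left_mono) auto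
    finally show ?thesis using h by (simp add: G_def mult.commute)
  qed
  have GB: "G y \<in> bcontfun" for y
  proof (rule bcontfun_normI)
    have "continuous_on {a..a + h} (\<lambda>t. integral {a..t} (\<lambda>s. F (apply_bcontfun y s)))"
      by (intro indefinite_integral_continuous_1 integrable_continuous_real contFy)
    then show "continuous_on UNIV (G y)"
      unfolding G_def by (intro continuous_intros continuous_on_compose2[OF _ c(2)]) (use c(1) in auto)
    show "norm (G y t) \<le> norm p + \<rho>" for t
      using Gbound[of y t] by (smt (verit) norm_triangle_sub)
  qed
  define H where "H y = Bcontfun (G y)" for y
  have H: "apply_bcontfun (H y) = G y" for y
    unfolding H_def using GB by (rule Bcontfun_inverse)
  have "dist (H y) (H z) \<le> 1/2 * dist y z" for y z
  proof (rule dist_bound)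
    fix t
    have "G y t - G z t = integral {a..c t} (\<lambda>s. F (apply_bcontfun y s) - F (apply_bcontfun z s))"
      unfolding G_def by (subst integral_diff) (auto intro!: integrable_continuous_real contFy)
    also have "norm \<dots> \<le> (B * dist y z) * (c t - a)"
    proof (rule integral_bound)
      fix s
      have "norm (F (apply_bcontfun y s) - F (apply_bcontfun z s)) \<le> B * dist (apply_bcontfun y s) (apply_bcontfun z s)"
        using lipF by (simp add: dist_norm)
      also have "\<dots> \<le> B * dist y z" using B dist_bounded by (intro mult_left_mono)
      finally show "norm (F (apply_bcontfun y s) - F (apply_bcontfun z s)) \<le> B * dist y z" .
    qed (use c(1)[of t] in \<open>auto intro!: continuous_intros contFy\<close>)
    also have "\<dots> \<le> (B * dist y z) * h" using B c(1)[of t] by (intro mult_left_mono) auto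
    also have "\<dots> = (h * B) * dist y z" by simp
    also have "\<dots> \<le> 1/2 * dist y z" using h by (intro mult_right_mono) auto
    finally show "dist (apply_bcontfun (H y) t) (apply_bcontfun (H z) t) \<le> 1/2 * dist y z"
      by (simp add: H dist_norm)
  qed
  then obtain y where y: "H y = y" using banach_fix_type[where c = "1/2" and f = H] by auto
  have yG: "apply_bcontfun y t = G y t" for t using H[of y] y by simp
  have yball: "apply_bcontfun y t \<in> cball p \<rho>" for t
    using Gbound[of y t] by (simp add: yG dist_norm norm_minus_commute)
  then have "F (apply_bcontfun y t) = f (apply_bcontfun y t)" for t
    by (simp add: F_def closest_point_self del: mem_cball)
  then have "apply_bcontfun y t = p + integral {a..t} (\<lambda>s. f (apply_bcontfun y s))" if "t \<in> {a..a + h}" for t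
    using yG[of t] cid[OF that] by (simp add: G_def)
  with yball have "\<forall>t\<in>{a..a + h}. apply_bcontfun y t \<in> cball p \<rho> \<and>
      apply_bcontfun y t = p + integral {a..t} (\<lambda>s. f (apply_bcontfun y s))" by blast
  with h(1) show ?thesis
    by (intro exI[of _ h] conjI exI[of _ "apply_bcontfun y"] continuous_on_apply_bcontfun)
qed

text \<open>In the compact set the speed is bounded, so the solution is Lipschitz near
  \<open>T\<close> and has a limit p in K. A Picard solution started at p is glued on.\<close>

lemma autonomous_continuation:
  fixes f :: "'a::euclidean_space \<Rightarrow> 'a"
  assumes U: "open U" "continuous_on U f"
    and lip: "\<And>p. p \<in> U \<Longrightarrow> \<exists>\<rho>>0. \<exists>B. B-lipschitz_on (cball p \<rho>) f"
    and T: "0 < T"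
    and z: "\<And>t. 0 \<le> t \<Longrightarrow> t < T \<Longrightarrow> z t \<in> U"
      "\<And>t. 0 \<le> t \<Longrightarrow> t < T \<Longrightarrow> (z has_vector_derivative f (z t)) (at t within {0..<T})"
    and K: "compact K" "K \<subseteq> U" and t1: "0 \<le> t1" "t1 < T" "\<And>t. t1 \<le> t \<Longrightarrow> t < T \<Longrightarrow> z t \<in> K"
  shows "\<exists>T'>T. \<exists>w. (\<forall>t. 0 \<le> t \<and> t < T \<longrightarrow> w t = z t) \<and>
    (\<forall>t. 0 \<le> t \<and> t < T' \<longrightarrow> w t \<in> U \<and> (w has_vector_derivative f (w t)) (at t within {0..<T'}))"
proof -
  have "compact (f ` K)" using U K by (intro compact_continuous_image) (auto intro: continuous_on_subset)
  then obtain M where M: "\<And>x. x \<in> K \<Longrightarrow> norm (f x) \<le> M"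
    by (metis compact_imp_bounded bounded_iff imageI)
  have zlip: "norm (z s - z t) \<le> M * norm (s - t)" if "s \<in> {t1..<T}" "t \<in> {t1..<T}" for s t
  proof (rule differentiable_bound[of "{t1..<T}" z "\<lambda>t h. h *\<^sub>R f (z t)"])
    fix x assume x: "x \<in> {t1..<T}"
    have "(z has_vector_derivative f (z x)) (at x within {t1..<T})"
      using x t1 by (intro has_vector_derivative_within_subset[OF z(2)]) auto
    then show "(z has_derivative (\<lambda>h. h *\<^sub>R f (z x))) (at x within {t1..<T})"
      by (simp add: has_vector_derivative_def)
    show "onorm (\<lambda>h. h *\<^sub>R f (z x)) \<le> M"
      using M[OF t1(3), of x] x by (intro onorm_le) (auto simp: mult.commute[of M] intro: mult_left_mono)
  qed (use that in auto)
  have "uniformly_continuous_on {t1..<T} z"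
    by (rule lipschitz_on_uniformly_continuous[where L = "max M 0"])
      (auto intro!: lipschitz_onI simp: dist_norm intro!: order_trans[OF zlip] mult_right_mono)
  then obtain p where p: "(z \<longlongrightarrow> p) (at T within {t1..<T})"
    using uniformly_continuous_on_extension_at_closure[of "{t1..<T}" z T] t1 by fastforce
  have nbot: "at T within {t1..<T} \<noteq> bot"
    using t1 by (simp add: trivial_limit_within islimpt_Ico)
  have pK: "p \<in> K"
  proof (rule Lim_in_closed_set[OF compact_imp_closed[OF K(1)] _ nbot p])
    show "\<forall>\<^sub>F x in at T within {t1..<T}. z x \<in> K"
      using t1 by (auto simp: eventually_at_filter)
  qed
  obtain \<rho> B where "\<rho> > 0" "B-lipschitz_on (cball p \<rho>) f" using lip pK K by blast
  moreover obtain r where r: "r > 0" "cball p r \<subseteq> U" using U pK K open_contains_cball by blast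
  ultimately have "0 < min \<rho> r" "B-lipschitz_on (cball p (min \<rho> r)) f"
    by (auto intro: lipschitz_on_subset)
  from picard_local[OF this, where a = T] obtain h y where h: "h > 0" and y: "continuous_on {T..T + h} y"
     "\<And>t. t \<in> {T..T + h} \<Longrightarrow> y t \<in> cball p (min \<rho> r)"
     "\<And>t. t \<in> {T..T + h} \<Longrightarrow> y t = p + integral {T..t} (\<lambda>s. f (y s))" by metis
  have yT: "y T = p" using y(3)[of T] h by simp
  define w where "w t = (if t < T then z t else y t)" for t
  have wU: "w t \<in> U" if "0 \<le> t" "t < T + h" for t
  proof (cases "t < T")
    case False
    then have "y t \<in> cball p (min \<rho> r)" using that by (intro y) auto
    then show ?thesis using False r by (auto simp: w_def)
  qed (use that z in \<open>auto simp: w_def\<close>)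
  have wT: "w T = p" by (simp add: w_def yT)
  have contT: "continuous_on {t1..T} w"
    unfolding continuous_on_eq_continuous_within
  proof
    fix t assume t: "t \<in> {t1..T}"
    show "continuous (at t within {t1..T}) w"
    proof (cases "t = T")
      case True
      have "(w \<longlongrightarrow> p) (at T within {t1..<T})"
        using p by (rule Lim_transform_within[where d = 1]) (auto simp: w_def)
      moreover have "at T within {t1..T} = at T within {t1..<T}"
        using t1 by (intro at_within_nhd[of _ UNIV]) auto
      ultimately show ?thesis using True by (simp add: continuous_within wT)
    next
      case False
      then have "t < T" "t1 \<le> t" using t by auto
      have "continuous (at t within {0..<T}) z"
        using z(2)[of t] \<open>t < T\<close> \<open>t1 \<le> t\<close> t1 by (auto intro: has_vector_derivative_continuous)
      then have "continuous (at t within {t1..<T}) z"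
        by (rule continuous_within_subset) (use t1 in auto)
      moreover have "at t within {t1..T} = at t within {t1..<T}"
        using \<open>t < T\<close> by (intro at_within_nhd[of _ "{..<T}"]) auto
      ultimately have "(z \<longlongrightarrow> z t) (at t within {t1..T})" by (simp add: continuous_within)
      then have "(w \<longlongrightarrow> z t) (at t within {t1..T})"
        by (rule Lim_transform_within[where d = "T - t"]) (use \<open>t < T\<close> in \<open>auto simp: w_def dist_real_def\<close>)
      then show ?thesis using \<open>t < T\<close> by (simp add: continuous_within w_def)
    qed
  qed
  have contw: "continuous_on {t1..T + h} w"
  proof -
    have "continuous_on {T..T + h} w"
      using y(1) by (rule continuous_on_eq) (auto simp: w_def)
    moreover have "{t1..T + h} = {t1..T} \<union> {T..T + h}" using t1 h by auto
    ultimately show ?thesis using contT by (metis continuous_on_closed_Un closed_atLeastAtMost)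
  qed
  have contfw: "continuous_on S (\<lambda>s. f (w s))" if "S \<subseteq> {t1..<T + h}" for S
  proof (rule continuous_on_compose2[OF U(2)])
    show "continuous_on S w" using that by (intro continuous_on_subset[OF contw]) auto
    show "w ` S \<subseteq> U" using that wU t1 by fastforce
  qed
  have inteq1: "((\<lambda>s. f (w s)) has_integral (w t - w t1)) {t1..t}" if "t \<in> {t1..T}" for t
  proof (rule fundamental_theorem_of_calculus_interior)
    fix x assume x: "x \<in> {t1<..<t}"
    have "(z has_vector_derivative f (z x)) (at x within {t1<..<t})"
      using x that t1 by (intro has_vector_derivative_within_subset[OF z(2)]) auto
    moreover have "at x within {t1<..<t} = at x" using x by (intro at_within_open) auto
    ultimately have "(z has_vector_derivative f (z x)) (at x)" by simp
    then have "(w has_vector_derivative f (z x)) (at x)"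
      by (rule has_vector_derivative_transform_within_open[where S = "{t1<..<t}"])
        (use x that in \<open>auto simp: w_def\<close>)
    then show "(w has_vector_derivative f (w x)) (at x)" using x that by (simp add: w_def)
  qed (use that contT in \<open>auto intro: continuous_on_subset\<close>)
  \<comment> \<open>Passing to the integral equation avoids matching one-sided derivatives at
    \<open>T\<close>: the integrand is continuous across \<open>T\<close>, so the integral is
    differentiable there.\<close>
  have inteq: "w t = w t1 + integral {t1..t} (\<lambda>s. f (w s))" if "t \<in> {t1..<T + h}" for t
  proof (cases "t \<le> T")
    case True
    then show ?thesis using integral_unique[OF inteq1[of t]] that by simp
  next
    case False
    have "integral {t1..t} (\<lambda>s. f (w s)) = integral {t1..T} (\<lambda>s. f (w s)) + integral {T..t} (\<lambda>s. f (w s))"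
      using Henstock_Kurzweil_Integration.integral_combine[where a = t1 and c = T and b = t and f = "\<lambda>s. f (w s)"] False that t1
      by (force intro!: integrable_continuous_real contfw)
    moreover have "integral {T..t} (\<lambda>s. f (w s)) = integral {T..t} (\<lambda>s. f (y s))"
      by (intro integral_cong) (auto simp: w_def)
    ultimately show ?thesis
      using integral_unique[OF inteq1[of T]] y(3)[of t] False that t1 by (simp add: w_def yT)
  qed
  \<comment> \<open>Membership in \<open>U\<close> is known for times before \<open>T + h\<close>
    only, so the closed interval used for differentiation ends earlier.\<close>
  define h' where "h' = h / 2"
  have h': "0 < h'" "h' < h" using h by (auto simp: h'_def)
  have deriv1: "(w has_vector_derivative f (w t)) (at t within {t1..T + h'})" if "t \<in> {t1..T + h'}" for t
  proof -
    have "((\<lambda>t. w t1 + integral {t1..t} (\<lambda>s. f (w s))) has_vector_derivative f (w t)) (at t within {t1..T + h'})"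
    proof -
      have "((\<lambda>t. integral {t1..t} (\<lambda>s. f (w s))) has_vector_derivative f (w t)) (at t within {t1..T + h'})"
        using h' by (intro integral_has_vector_derivative contfw that) auto
      from has_vector_derivative_add[OF has_vector_derivative_const this] show ?thesis by simp
    qed
    note deriv = this
    have "w s = w t1 + integral {t1..s} (\<lambda>s. f (w s))" if "s \<in> {t1..T + h'}" for s
      using that h' by (intro inteq) auto
    from has_vector_derivative_transform[OF that this deriv] show ?thesis .
  qed
  have "(w has_vector_derivative f (w t)) (at t within {0..<T + h'})" if "0 \<le> t" "t < T + h'" for t
  proof (cases "t < T")
    case True
    have "(z has_vector_derivative f (z t)) (at t within {0..<T})" using that True z by auto
    then have "(w has_vector_derivative f (w t)) (at t within {0..<T})"
      using True that by (intro has_vector_derivative_transform[where g = w and f = z]) (auto simp: w_def)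
    moreover have "at t within {0..<T + h'} = at t within {0..<T}"
      using True h' by (intro at_within_nhd[of _ "{..<T}"]) auto
    ultimately show ?thesis by simp
  next
    case False
    have "(w has_vector_derivative f (w t)) (at t within {t1..T + h'})" using that False t1 by (intro deriv1) auto
    moreover have "at t within {t1..T + h'} = at t within {0..<T + h'}"
      using that False t1 by (intro at_within_nhd[of _ "{t1<..<T + h'}"]) auto
    ultimately show ?thesis by simp
  qed
  then show ?thesis using h' wU
    by (intro exI[of _ "T + h'"] conjI exI[of _ w]) (auto simp: w_def)
qed

section \<open>The vector field and its linearization\<close>

lemma has_derivative_vec_nth [derivative_intros]:
  "(f has_derivative f') F \<Longrightarrow> ((\<lambda>x. f x $ i) has_derivative (\<lambda>h. f' h $ i)) F"
  by (rule bounded_linear.has_derivative[OF bounded_linear_vec_nth])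

lemma vector_4 [simp]:
  "(vector [w, x, y, z] :: 'a::zero^4)$1 = w"
  "(vector [w, x, y, z] :: 'a::zero^4)$2 = x"
  "(vector [w, x, y, z] :: 'a::zero^4)$3 = y"
  "(vector [w, x, y, z] :: 'a::zero^4)$4 = z"
  unfolding vector_def by simp_all

lemma vector_4_axis: "vector [p, q, r, s] =
    (p *\<^sub>R axis 1 1 + q *\<^sub>R axis 2 1 + r *\<^sub>R axis 3 1 + s *\<^sub>R axis 4 1 :: real^4)"
  by (simp add: vec_eq_iff forall_4 axis_def)

lemma has_derivative_vector_4:
  fixes a b c d :: "'a::real_normed_vector \<Rightarrow> real"
  assumes "(a has_derivative a') F" "(b has_derivative b') F" "(c has_derivative c') F" "(d has_derivative d') F"
  shows "((\<lambda>x. vector [a x, b x, c x, d x] :: real^4) has_derivative (\<lambda>h. vector [a' h, b' h, c' h, d' h])) F"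
  unfolding vector_4_axis by (auto intro!: derivative_eq_intros assms)

lemma inner_real4: "(a :: real^4) \<bullet> b = a$1 * b$1 + a$2 * b$2 + a$3 * b$3 + a$4 * b$4"
  by (simp add: inner_vec_def sum_4)

lemma real4_eq_iff: "(a :: 'a^4) = b \<longleftrightarrow> a$1 = b$1 \<and> a$2 = b$2 \<and> a$3 = b$3 \<and> a$4 = b$4"
  by (simp add: vec_eq_iff forall_4)

lemma J_mult: "J *v a = vector [a$3, a$4, - a$1, - a$2]"
  by (simp add: J_def real4_eq_iff matrix_vector_mult_def sum_4)

lemma Omega_eq: "Omega a b = a$3 * b$1 + a$4 * b$2 - a$1 * b$3 - a$2 * b$4"
  by (simp add: Omega_def J_mult inner_real4)

definition sq :: "real^4 \<Rightarrow> real" where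
  "sq \<psi> = (\<psi>$1)\<^sup>2 + (\<psi>$2)\<^sup>2"

text \<open>The attraction coefficient \<open>\<alpha> r\<^sup>-\<^sup>\<alpha>\<^sup>-\<^sup>2\<close>, normalized to be \<open>1\<close> at the ground states, and its
  derivative with respect to \<open>r\<^sup>2 / 2\<close>.\<close>

definition att :: "real \<Rightarrow> real^4 \<Rightarrow> real" where
  "att \<alpha> \<psi> = \<alpha> * sq \<psi> powr (- \<alpha> / 2 - 1)"

definition att' :: "real \<Rightarrow> real^4 \<Rightarrow> real" where
  "att' \<alpha> \<psi> = - \<alpha> * (\<alpha> + 2) * sq \<psi> powr (- \<alpha> / 2 - 2)"

text \<open>Closed form of the gradient of the energy; \<open>grad_energy\<close> identifies it with
  the description by \<open>THE\<close> in \<open>grad\<close>.\<close>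

definition egrad :: "real \<Rightarrow> real^4 \<Rightarrow> real^4" where
  "egrad \<alpha> \<psi> = vector
     [- (\<psi>$4 - \<psi>$1) - (\<alpha> + 2) * \<psi>$1 + (\<alpha> + 2) * (\<psi>$1 * att \<alpha> \<psi>),
      (\<psi>$3 + \<psi>$2) + (\<alpha> + 2) * (\<psi>$2 * att \<alpha> \<psi>),
      \<psi>$3 + \<psi>$2, \<psi>$4 - \<psi>$1]"

lemma phase_space_iff: "\<psi> \<in> phase_space \<longleftrightarrow> 0 < sq \<psi>"
  by (auto simp: phase_space_def sq_def sum_power2_gt_zero_iff)

lemma continuous_on_sq [continuous_intros]: "continuous_on S f \<Longrightarrow> continuous_on S (\<lambda>x. sq (f x))"
  unfolding sq_def by (intro continuous_intros)

lemma open_phase_space: "open phase_space"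
proof -
  have "phase_space = {\<psi>. 0 < sq \<psi>}" by (auto simp: phase_space_iff)
  moreover have "open {\<psi>. 0 < sq \<psi>}" by (intro open_Collect_less continuous_intros)
  ultimately show ?thesis by simp
qed

lemma V_eq: "V \<alpha> x y = - (\<alpha> + 2) / 2 * x\<^sup>2 - (\<alpha> + 2) * (x\<^sup>2 + y\<^sup>2) powr (- \<alpha> / 2)"
  by (simp add: V_def powr_half_sqrt[symmetric] powr_powr powr_minus_divide)

lemma has_derivative_sq [derivative_intros]:
  assumes "(f has_derivative f') (at x within S)"
  shows "((\<lambda>x. sq (f x)) has_derivative (\<lambda>h. 2 * (f x $ 1 * f' h $ 1 + f x $ 2 * f' h $ 2))) (at x within S)"
  unfolding sq_def by (auto intro!: derivative_eq_intros assms simp: fun_eq_iff algebra_simps)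

lemma has_derivative_sq_powr [derivative_intros]:
  assumes "(f has_derivative f') (at x within S)" "f x \<in> phase_space"
  shows "((\<lambda>x. sq (f x) powr p) has_derivative
    (\<lambda>h. 2 * (f x $ 1 * f' h $ 1 + f x $ 2 * f' h $ 2) * (p * sq (f x) powr (p - 1)))) (at x within S)"
  using assms
  by (intro DERIV_compose_FDERIV[OF has_real_derivative_powr] has_derivative_sq) (auto simp: phase_space_iff)

lemma has_derivative_att [derivative_intros]:
  assumes "(f has_derivative f') (at x within S)" "f x \<in> phase_space"
  shows "((\<lambda>x. att \<alpha> (f x)) has_derivative
    (\<lambda>h. att' \<alpha> (f x) * (f x $ 1 * f' h $ 1 + f x $ 2 * f' h $ 2))) (at x within S)"
  unfolding att_def att'_def
  by (auto intro!: derivative_eq_intros assms simp: fun_eq_iff field_simps)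

lemma energy_eq: "energy \<alpha> \<psi> = 1/2 * ((\<psi>$3 + \<psi>$2)\<^sup>2 + (\<psi>$4 - \<psi>$1)\<^sup>2)
    - (\<alpha> + 2) / 2 * (\<psi>$1)\<^sup>2 - (\<alpha> + 2) * sq \<psi> powr (- \<alpha> / 2)"
  by (simp add: energy_def V_eq sq_def field_simps)

lemma has_derivative_energy:
  assumes "\<psi> \<in> phase_space"
  shows "(energy \<alpha> has_derivative (\<lambda>h. h \<bullet> egrad \<alpha> \<psi>)) (at \<psi>)"
  unfolding energy_eq[abs_def]
  by (auto intro!: derivative_eq_intros assms simp: fun_eq_iff inner_real4 egrad_def att_def field_simps)

lemma grad_energy: "\<psi> \<in> phase_space \<Longrightarrow> grad (energy \<alpha>) \<psi> = egrad \<alpha> \<psi>"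
  unfolding grad_def
proof (rule the_equality)
  assume \<psi>: "\<psi> \<in> phase_space"
  show "GDERIV (energy \<alpha>) \<psi> :> egrad \<alpha> \<psi>"
    using has_derivative_energy[OF \<psi>] by (simp add: gderiv_def)
  fix D assume "GDERIV (energy \<alpha>) \<psi> :> D"
  then have "(\<lambda>h. h \<bullet> D) = (\<lambda>h. h \<bullet> egrad \<alpha> \<psi>)"
    using has_derivative_energy[OF \<psi>] has_derivative_unique unfolding gderiv_def by blast
  then show "D = egrad \<alpha> \<psi>" by (metis inner_commute vector_eq_ldot)
qed

lemma W_eq:
  assumes "\<psi> \<in> phase_space"
  shows "W \<alpha> \<psi> = (\<alpha> + 2) * ((\<psi>$1)\<^sup>2 - \<alpha> * sq \<psi> powr (- \<alpha> / 2))"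
proof -
  have pos: "0 < sq \<psi>" using assms by (simp add: phase_space_iff)
  then have pos': "0 < (\<psi>$1)\<^sup>2 + (\<psi>$2)\<^sup>2" by (simp add: sq_def)
  define c where "c = sq \<psi> powr (- \<alpha> / 2 - 1)"
  have "((\<lambda>x. V \<alpha> x (\<psi>$2)) has_real_derivative - (\<alpha> + 2) * \<psi>$1 + \<alpha> * (\<alpha> + 2) * \<psi>$1 * c) (at (\<psi>$1))"
    unfolding V_eq using pos' by (auto intro!: derivative_eq_intros simp: c_def sq_def field_simps)
  then have x: "deriv (\<lambda>x. V \<alpha> x (\<psi>$2)) (\<psi>$1) = - (\<alpha> + 2) * \<psi>$1 + \<alpha> * (\<alpha> + 2) * \<psi>$1 * c"
    by (rule DERIV_imp_deriv)
  have "((\<lambda>y. V \<alpha> (\<psi>$1) y) has_real_derivative \<alpha> * (\<alpha> + 2) * \<psi>$2 * c) (at (\<psi>$2))"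
    unfolding V_eq using pos' by (auto intro!: derivative_eq_intros simp: c_def sq_def field_simps)
  then have y: "deriv (\<lambda>y. V \<alpha> (\<psi>$1) y) (\<psi>$2) = \<alpha> * (\<alpha> + 2) * \<psi>$2 * c"
    by (rule DERIV_imp_deriv)
  have "W \<alpha> \<psi> = (\<alpha> + 2) * ((\<psi>$1)\<^sup>2 - \<alpha> * (sq \<psi> * c))"
    unfolding W_def x y by (simp add: sq_def power2_eq_square algebra_simps)
  then show ?thesis using pos powr_mult_base[of "sq \<psi>" "- \<alpha> / 2 - 1"] by (simp add: c_def)
qed

text \<open>For Q = q0^2 the relation q0^(\<alpha> + 2) = \<alpha> says that \<alpha> Q^(-\<alpha>/2
  - 1) = 1; multiplying or dividing by Q gives the other powers.\<close>

lemma q0: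
  assumes "0 < \<alpha>"
  shows "0 < q0 \<alpha>" "((q0 \<alpha>)\<^sup>2) powr (- \<alpha> / 2) = (q0 \<alpha>)\<^sup>2 / \<alpha>"
    "\<alpha> * ((q0 \<alpha>)\<^sup>2) powr (- \<alpha> / 2 - 1) = 1"
    "\<alpha> * ((q0 \<alpha>)\<^sup>2) powr (- \<alpha> / 2 - 2) = 1 / (q0 \<alpha>)\<^sup>2"
proof -
  show pos: "0 < q0 \<alpha>" using assms by (simp add: q0_def)
  have "q0 \<alpha> powr (\<alpha> + 2) = \<alpha>" using assms by (simp add: q0_def powr_powr)
  moreover have "((q0 \<alpha>)\<^sup>2) powr (- \<alpha> / 2 - 1) = q0 \<alpha> powr (- (\<alpha> + 2))"
    using pos by (simp add: powr_powr flip: powr_numeral)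
  moreover have "q0 \<alpha> powr (- (\<alpha> + 2)) = 1 / \<alpha>"
    using calculation(1) by (simp only: powr_minus_divide)
  ultimately show 1: "\<alpha> * ((q0 \<alpha>)\<^sup>2) powr (- \<alpha> / 2 - 1) = 1"
    using assms by simp
  have "(q0 \<alpha>)\<^sup>2 powr (- \<alpha> / 2) = (q0 \<alpha>)\<^sup>2 * (q0 \<alpha>)\<^sup>2 powr (- \<alpha> / 2 - 1)"
    using pos powr_mult_base[of "(q0 \<alpha>)\<^sup>2" "- \<alpha> / 2 - 1"] by simp
  then show "((q0 \<alpha>)\<^sup>2) powr (- \<alpha> / 2) = (q0 \<alpha>)\<^sup>2 / \<alpha>"
    using 1 assms by (simp add: field_simps)
  have "(q0 \<alpha>)\<^sup>2 powr (- \<alpha> / 2 - 1) = (q0 \<alpha>)\<^sup>2 powr (1 + (- \<alpha> / 2 - 2))"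
    by (rule arg_cong[where f = "\<lambda>e. _ powr e"]) simp
  also have "\<dots> = (q0 \<alpha>)\<^sup>2 * (q0 \<alpha>)\<^sup>2 powr (- \<alpha> / 2 - 2)"
    using pos by (intro powr_mult_base[symmetric]) simp
  finally show "\<alpha> * ((q0 \<alpha>)\<^sup>2) powr (- \<alpha> / 2 - 2) = 1 / (q0 \<alpha>)\<^sup>2"
    using 1 pos by (simp add: field_simps)
qed

section \<open>The ground state and the linearization there\<close>

lemma ground_nth [simp]:
  "ground \<alpha> $ 1 = q0 \<alpha>" "ground \<alpha> $ 2 = 0" "ground \<alpha> $ 3 = 0" "ground \<alpha> $ 4 = q0 \<alpha>"
  by (simp_all add: ground_def)

lemma ground_values:
  assumes "0 < \<alpha>"
  shows "sq (ground \<alpha>) = (q0 \<alpha>)\<^sup>2" "ground \<alpha> \<in> phase_space" "att \<alpha> (ground \<alpha>) = 1"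
    "att' \<alpha> (ground \<alpha>) = - (\<alpha> + 2) / (q0 \<alpha>)\<^sup>2"
    "E_star \<alpha> = - (\<alpha> + 2)\<^sup>2 / 2 * ((q0 \<alpha>)\<^sup>2 / \<alpha>)"
proof -
  note q = q0[OF assms]
  show sq: "sq (ground \<alpha>) = (q0 \<alpha>)\<^sup>2" by (simp add: sq_def)
  then show "ground \<alpha> \<in> phase_space" using q by (simp add: phase_space_iff)
  show "att \<alpha> (ground \<alpha>) = 1" using q by (simp add: att_def sq)
  have "att' \<alpha> (ground \<alpha>) = - (\<alpha> + 2) * (\<alpha> * (q0 \<alpha>)\<^sup>2 powr (- \<alpha> / 2 - 2))"
    by (simp add: att'_def sq algebra_simps)
  then show "att' \<alpha> (ground \<alpha>) = - (\<alpha> + 2) / (q0 \<alpha>)\<^sup>2" using q(4) by simp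
  have "E_star \<alpha> = - (\<alpha> + 2) / 2 * (q0 \<alpha>)\<^sup>2 - (\<alpha> + 2) * ((q0 \<alpha>)\<^sup>2 powr (- \<alpha> / 2))"
    by (simp add: E_star_def energy_def V_eq)
  also have "\<dots> = - (\<alpha> + 2) / 2 * (q0 \<alpha>)\<^sup>2 - (\<alpha> + 2) * ((q0 \<alpha>)\<^sup>2 / \<alpha>)" by (simp only: q(2))
  also have "\<dots> = - (\<alpha> + 2)\<^sup>2 / 2 * ((q0 \<alpha>)\<^sup>2 / \<alpha>)"
    using assms by (simp add: field_simps power2_eq_square)
  finally show "E_star \<alpha> = - (\<alpha> + 2)\<^sup>2 / 2 * ((q0 \<alpha>)\<^sup>2 / \<alpha>)" .
qed

lemma has_derivative_att_ground:
  assumes "0 < \<alpha>"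
  shows "((\<lambda>\<psi>. \<psi>$1 * att \<alpha> \<psi>) has_derivative (\<lambda>h. - (\<alpha> + 1) * h$1)) (at (ground \<alpha>))"
    "((\<lambda>\<psi>. \<psi>$2 * att \<alpha> \<psi>) has_derivative (\<lambda>h. h$2)) (at (ground \<alpha>))"
    "((\<lambda>\<psi>. sq \<psi> * att \<alpha> \<psi>) has_derivative (\<lambda>h. - \<alpha> * q0 \<alpha> * h$1)) (at (ground \<alpha>))"
    "((\<lambda>\<psi>. (\<psi>$4 - \<psi>$1) * att \<alpha> \<psi>) has_derivative (\<lambda>h. h$4 - h$1)) (at (ground \<alpha>))"
proof -
  note g = ground_values[OF assms] q0[OF assms]
  show "((\<lambda>\<psi>. \<psi>$1 * att \<alpha> \<psi>) has_derivative (\<lambda>h. - (\<alpha> + 1) * h$1)) (at (ground \<alpha>))"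
    using g(2) by (auto intro!: derivative_eq_intros simp: g(3,4) fun_eq_iff)
      (use g(6) in \<open>simp add: field_simps power2_eq_square\<close>)
  show "((\<lambda>\<psi>. \<psi>$2 * att \<alpha> \<psi>) has_derivative (\<lambda>h. h$2)) (at (ground \<alpha>))"
    using g(2) by (auto intro!: derivative_eq_intros simp: g(3,4) fun_eq_iff)
  show "((\<lambda>\<psi>. sq \<psi> * att \<alpha> \<psi>) has_derivative (\<lambda>h. - \<alpha> * q0 \<alpha> * h$1)) (at (ground \<alpha>))"
    using g(2) by (auto intro!: derivative_eq_intros simp: g(1,3,4) fun_eq_iff)
      (use g(6) in \<open>simp add: field_simps power2_eq_square\<close>)
  show "((\<lambda>\<psi>. (\<psi>$4 - \<psi>$1) * att \<alpha> \<psi>) has_derivative (\<lambda>h. h$4 - h$1)) (at (ground \<alpha>))"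
    using g(2) by (auto intro!: derivative_eq_intros simp: g(3,4) fun_eq_iff)
qed

lemma has_derivative_egrad_ground:
  assumes "0 < \<alpha>"
  shows "(egrad \<alpha> has_derivative (\<lambda>h. vector
     [- (h$4 - h$1) - (\<alpha> + 2)\<^sup>2 * h$1, (h$3 + h$2) + (\<alpha> + 2) * h$2, h$3 + h$2, h$4 - h$1]))
     (at (ground \<alpha>))"
  unfolding egrad_def
  by (intro has_derivative_vector_4)
    (rule derivative_eq_intros has_derivative_att_ground[OF assms] refl ext
      | simp add: power2_eq_square algebra_simps; fail)+

lemma lin_mult:
  assumes "0 < \<alpha>"
  shows "lin \<alpha> *v X = vector [X$3 + X$2, X$4 - X$1,
    (X$4 - X$1) + (\<alpha> + 2)\<^sup>2 * X$1, - (X$3 + X$2) - (\<alpha> + 2) * X$2]"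
proof -
  let ?D = "\<lambda>h :: real^4. vector
     [- (h$4 - h$1) - (\<alpha> + 2)\<^sup>2 * h$1, (h$3 + h$2) + (\<alpha> + 2) * h$2, h$3 + h$2, h$4 - h$1] :: real^4"
  note g = ground_values[OF assms]
  have D: "(grad (energy \<alpha>) has_derivative ?D) (at (ground \<alpha>))"
    by (rule has_derivative_transform_within_open[OF has_derivative_egrad_ground[OF assms] open_phase_space])
      (use g grad_energy in auto)
  have "hess (energy \<alpha>) (ground \<alpha>) *v X = ?D X"
    unfolding hess_def jacobian_def frechet_derivative_at[OF D, symmetric]
    using matrix_vector_mul(2)[OF bounded_linear.linear[OF has_derivative_bounded_linear[OF D]]] by metis
  then show ?thesis
    unfolding lin_def matrix_vector_mul_assoc[symmetric] by (simp add: J_mult algebra_simps)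
qed

text \<open>\<open>H2\<close> is the quadratic part of the energy at the ground state. For the constants \<open>g, p\<close> of
  \<open>eigen_frame_normal_form\<close> below, \<open>Lam\<close> is \<open>\<plusminus>(k/2)\<^sup>1\<^sup>/\<^sup>2 (\<lambda>\<^sub>+ + \<lambda>\<^sub>-)\<close>.\<close>

definition H2 :: "real \<Rightarrow> real^4 \<Rightarrow> real" where
  "H2 \<alpha> X = ((X$3 + X$2)\<^sup>2 + (X$4 - X$1)\<^sup>2 - (\<alpha> + 2)\<^sup>2 * (X$1)\<^sup>2 + (\<alpha> + 2) * (X$2)\<^sup>2) / 2"

definition Lam :: "real \<Rightarrow> real \<Rightarrow> real^4 \<Rightarrow> real" where
  "Lam g p X = g * (X$1 + p * (X$4 - X$1))"

text \<open>\<open>eigenspace\<close> complexifies the matrix entry by entry, so the real action in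
  \<open>lin_mult\<close> does not suffice and the entries themselves are needed.\<close>

lemma lin_entries:
  assumes "0 < \<alpha>"
  shows "lin \<alpha> = vector [vector [0, 1, 1, 0], vector [-1, 0, 0, 1],
    vector [(\<alpha> + 2)\<^sup>2 - 1, 0, 0, 1], vector [0, - 1 - (\<alpha> + 2), -1, 0]]" (is "_ = ?M")
proof -
  have "lin \<alpha> *v X = ?M *v X" for X
    unfolding lin_mult[OF assms]
    by (simp add: real4_eq_iff matrix_vector_mult_def sum_4 algebra_simps)
  then show ?thesis by (simp add: matrix_eq)
qed

lemma lin_mult_complex:
  assumes "0 < \<alpha>"
  shows "map_matrix complex_of_real (lin \<alpha>) *v w = vector [w$3 + w$2, w$4 - w$1,
    (w$4 - w$1) + (of_real (\<alpha> + 2))\<^sup>2 * w$1, - (w$3 + w$2) - of_real (\<alpha> + 2) * w$2]"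
  by (simp add: lin_entries[OF assms] real4_eq_iff matrix_vector_mult_def sum_4 map_matrix_def algebra_simps)

text \<open>The first two rows express w_3 and w_4 through w_1 and w_2. The other two rows become a
  2 by 2 system for w_1 and w_2, whose determinant is the stated polynomial; z \<noteq> 0 excludes
  w_1 = 0.\<close>

lemma eigenvalue_lin_characteristic:
  assumes "0 < \<alpha>" "z \<in> eigenvalues (lin \<alpha>)" "z \<noteq> 0"
  shows "(z\<^sup>2 - (of_real (\<alpha> + 2))\<^sup>2) * (z\<^sup>2 + of_real (\<alpha> + 2)) + 4 * z\<^sup>2 = 0"
proof -
  define \<beta> where "\<beta> = complex_of_real (\<alpha> + 2)"
  obtain w where w: "w \<noteq> 0" "map_matrix complex_of_real (lin \<alpha>) *v w = z *s w"
    using assms by (auto simp: eigenvalues_def eigenspace_def)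
  have eqs: "w$3 + w$2 = z * w$1" "w$4 - w$1 = z * w$2" "(w$4 - w$1) + \<beta>\<^sup>2 * w$1 = z * w$3"
    "- (w$3 + w$2) - \<beta> * w$2 = z * w$4"
    using w(2) unfolding lin_mult_complex[OF assms(1)] real4_eq_iff vector_4 vector_smult_component \<beta>_def
    by blast+
  have w3: "w$3 = z * w$1 - w$2" and w4: "w$4 = z * w$2 + w$1"
    using eqs(1,2) by (auto simp: algebra_simps)
  have 1: "2 * z * w$2 = (z\<^sup>2 - \<beta>\<^sup>2) * w$1"
    using eqs(3) unfolding w3 w4 by (simp add: algebra_simps power2_eq_square)
  have 2: "- 2 * z * w$1 = (z\<^sup>2 + \<beta>) * w$2"
    using eqs(4) unfolding w3 w4 by algebra
  have "w$1 \<noteq> 0"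
  proof
    assume "w$1 = 0"
    then have "w$2 = 0" using 1 assms by simp
    then show False using w(1) \<open>w$1 = 0\<close> w3 w4 by (simp add: real4_eq_iff)
  qed
  moreover have "((z\<^sup>2 - \<beta>\<^sup>2) * (z\<^sup>2 + \<beta>) + 4 * z\<^sup>2) * w$1 = 0"
    using 1 2 by algebra
  ultimately show ?thesis by (simp add: \<beta>_def)
qed

text \<open>In terms of \<kappa> the equation reads k^2 (\<kappa> + 4) = \<beta>^2 \<kappa>, and
  also \<kappa>^2 = (\<beta>^2 + \<beta> - 4) \<kappa> + 4 \<beta>, so \<kappa> is at least
  \<beta>^2 + \<beta> - 4. The last two relations say that \<open>Lam g p\<close> solves y'' = k^2 y
  along the linearized flow.\<close>

lemma characteristic_bounds:
  fixes \<beta> k :: real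
  assumes \<beta>: "4 \<le> \<beta>" and k: "0 < k" and char: "(k\<^sup>2 - \<beta>\<^sup>2) * (k\<^sup>2 + \<beta>) + 4 * k\<^sup>2 = 0"
  defines "\<kappa> \<equiv> k\<^sup>2 + \<beta>"
  defines "g \<equiv> k * (\<kappa> + 4) / sqrt (\<kappa>\<^sup>2 + 4 * \<beta>)" and "p \<equiv> 2 / (\<kappa> + 4)"
  shows "\<beta> \<le> g" "g \<le> 28 / 25 * \<beta>" "0 < p" "p * \<beta> \<le> 2 / 5"
    "(1 - 2 * p) * \<beta>\<^sup>2 = k\<^sup>2" "2 * (1 - 2 * p) - p * \<beta> = k\<^sup>2 * p"
proof -
  have \<kappa>0: "0 < \<kappa>" "\<beta> \<le> \<kappa>" using assms by (auto simp: \<kappa>_def add_pos_pos)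
  have rel: "k\<^sup>2 * (\<kappa> + 4) = \<beta>\<^sup>2 * \<kappa>" using char by (simp add: \<kappa>_def algebra_simps power2_eq_square)
  have "\<kappa> * \<kappa> = (\<beta>\<^sup>2 + \<beta> - 4) * \<kappa> + 4 * \<beta>"
    using char by (simp add: \<kappa>_def algebra_simps power2_eq_square)
  then have "(\<beta>\<^sup>2 + \<beta> - 4) * \<kappa> \<le> \<kappa> * \<kappa>" using \<beta> by simp
  then have \<kappa>1: "\<beta>\<^sup>2 + \<beta> - 4 \<le> \<kappa>" using \<kappa>0 by simp
  have "4 * \<beta> \<le> \<beta>\<^sup>2" using \<beta> by (simp add: power2_eq_square)
  then have \<kappa>2: "5 * \<beta> \<le> \<kappa> + 4" "16 \<le> \<kappa>" using \<kappa>1 \<beta> by auto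
  show p: "0 < p" using \<kappa>0 by (simp add: p_def)
  show "p * \<beta> \<le> 2 / 5" using \<kappa>0 \<kappa>2 by (simp add: p_def field_simps)
  have p': "1 - 2 * p = \<kappa> / (\<kappa> + 4)" using \<kappa>0 by (simp add: p_def field_simps)
  show "(1 - 2 * p) * \<beta>\<^sup>2 = k\<^sup>2" unfolding p' using rel \<kappa>0 by (simp add: field_simps)
  show "2 * (1 - 2 * p) - p * \<beta> = k\<^sup>2 * p"
  proof -
    have "k\<^sup>2 = \<kappa> - \<beta>" by (simp add: \<kappa>_def)
    then have "2 * (\<kappa> / (\<kappa> + 4)) - 2 / (\<kappa> + 4) * \<beta> = 2 * k\<^sup>2 / (\<kappa> + 4)"
      by (simp add: diff_divide_distrib right_diff_distrib)
    then show ?thesis unfolding p' by (simp add: p_def mult.commute)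
  qed
  have D: "0 < \<kappa>\<^sup>2 + 4 * \<beta>" using \<beta> by (simp add: add_nonneg_pos)
  have "g\<^sup>2 = (k\<^sup>2 * (\<kappa> + 4)) * (\<kappa> + 4) / (\<kappa>\<^sup>2 + 4 * \<beta>)"
    using D by (simp add: g_def power_mult_distrib power_divide power2_eq_square)
  then have g2: "g\<^sup>2 = \<beta>\<^sup>2 * (\<kappa> * (\<kappa> + 4) / (\<kappa>\<^sup>2 + 4 * \<beta>))" by (simp add: rel)
  have g0: "0 \<le> g" using k \<kappa>0 D by (simp add: g_def)
  have "1 \<le> \<kappa> * (\<kappa> + 4) / (\<kappa>\<^sup>2 + 4 * \<beta>)"
    using D \<kappa>0 by (simp add: field_simps power2_eq_square)
  then have "\<beta>\<^sup>2 * 1 \<le> g\<^sup>2" unfolding g2 by (intro mult_left_mono) auto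
  then show "\<beta> \<le> g" using g0 power2_le_imp_le by simp
  \<comment> \<open>The quotient is at most 1 + 4/\<kappa>, hence at most 5/4, and 28/25 is a
    rational upper bound for the square root of 5/4.\<close>
  have "16 * \<kappa> \<le> \<kappa> * \<kappa>" using \<kappa>2 \<kappa>0 by simp
  then have "\<kappa> * (\<kappa> + 4) / (\<kappa>\<^sup>2 + 4 * \<beta>) \<le> (28 / 25)\<^sup>2"
    using D by (simp add: field_simps power2_eq_square) (use \<open>16 * \<kappa> \<le> \<kappa> * \<kappa>\<close> \<kappa>0 \<beta> in linarith)
  then have "g\<^sup>2 \<le> \<beta>\<^sup>2 * (28 / 25)\<^sup>2" unfolding g2 by (intro mult_left_mono) auto
  then have "g\<^sup>2 \<le> (28 / 25 * \<beta>)\<^sup>2"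
    by (simp only: power_mult_distrib mult.commute)
  then show "g \<le> 28 / 25 * \<beta>" by (rule power2_le_imp_le) (use \<beta> in auto)
qed

section \<open>The symplectic form and the spectral decomposition of the linearization\<close>

lemma Omega_linear:
  "Omega (a + b) c = Omega a c + Omega b c" "Omega c (a + b) = Omega c a + Omega c b"
  "Omega (a - b) c = Omega a c - Omega b c" "Omega c (a - b) = Omega c a - Omega c b"
  "Omega (r *\<^sub>R a) c = r * Omega a c" "Omega c (r *\<^sub>R a) = r * Omega c a"
  "Omega (- a) c = - Omega a c" "Omega c (- a) = - Omega c a"
  by (simp_all add: Omega_eq algebra_simps)

lemma Omega_antisym: "Omega a b = - Omega b a"
  by (simp add: Omega_eq algebra_simps)

lemma Omega_self: "Omega a a = 0"
  by (simp add: Omega_eq)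

text \<open>The matrix is \<open>J\<close> times a symmetric Hessian, hence skew for the symplectic
  form. This makes invariant subspaces symplectically orthogonal unless they contain eigenvalues
  with sum zero.\<close>

lemma Omega_lin:
  assumes "0 < \<alpha>"
  shows "Omega (lin \<alpha> *v a) b = - Omega a (lin \<alpha> *v b)"
  by (simp add: Omega_eq lin_mult[OF assms] algebra_simps)

lemma lin_linear:
  "lin \<alpha> *v (a + b) = lin \<alpha> *v a + lin \<alpha> *v b"
  "lin \<alpha> *v (a - b) = lin \<alpha> *v a - lin \<alpha> *v b"
  "lin \<alpha> *v (r *\<^sub>R a) = r *\<^sub>R (lin \<alpha> *v a)"
  "lin \<alpha> *v (- a) = - (lin \<alpha> *v a)"
  using matrix_vector_mult_scaleR[of "lin \<alpha>" "-1" a]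
  by (simp_all add: matrix_vector_right_distrib matrix_vector_mult_diff_distrib matrix_vector_mult_scaleR)

lemma Omega_lin_self:
  assumes "0 < \<alpha>"
  shows "Omega X (lin \<alpha> *v X) = 2 * H2 \<alpha> X"
  by (simp add: Omega_eq lin_mult[OF assms] H2_def algebra_simps power2_eq_square)

text \<open>The real plane is the kernel of A^2 + \<omega>^2. This real description is the one used
  to decompose a displacement.\<close>

lemma center_space_iff:
  assumes "0 < \<alpha>" "\<omega> \<noteq> 0"
  shows "v \<in> center_space \<alpha> \<omega> \<longleftrightarrow> lin \<alpha> *v (lin \<alpha> *v v) = - (\<omega>\<^sup>2) *\<^sub>R v"
proof -
  define cv where "cv v = (\<chi> i. complex_of_real (v $ i))" for v :: "real^4"
  define A where "A w = map_matrix complex_of_real (lin \<alpha>) *v w" for w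
  have A_cv: "A (cv u) = cv (lin \<alpha> *v u)" for u
    by (simp add: A_def cv_def lin_mult_complex[OF assms(1)] lin_mult[OF assms(1)] real4_eq_iff)
  have A_add: "A (a + b) = A a + A b" and A_scale: "A (c *s a) = c *s A a" for a b c
    by (simp_all add: A_def matrix_vector_right_distrib vector_scalar_commute)
  have E: "eigenspace (lin \<alpha>) z = {w. A w = z *s w}" for z by (simp add: eigenspace_def A_def)
  show ?thesis
  proof
    assume "v \<in> center_space \<alpha> \<omega>"
    then obtain a b where ab: "A a = (\<i> * of_real \<omega>) *s a" "A b = (- \<i> * of_real \<omega>) *s b" "cv v = a + b"
      by (auto simp: center_space_def E cv_def)
    have "cv (lin \<alpha> *v (lin \<alpha> *v v)) = A (A (a + b))" by (simp add: A_cv ab(3)[symmetric])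
    also have "\<dots> = (- (of_real \<omega>)\<^sup>2) *s (a + b)"
      unfolding A_add ab(1,2) A_scale by (simp add: real4_eq_iff algebra_simps power2_eq_square)
    finally have *: "cv (lin \<alpha> *v (lin \<alpha> *v v)) = (- (of_real \<omega>)\<^sup>2) *s cv v" by (simp add: ab)
    have "complex_of_real ((lin \<alpha> *v (lin \<alpha> *v v)) $ i) = complex_of_real ((- (\<omega>\<^sup>2) *\<^sub>R v) $ i)" for i
      using arg_cong[OF *, of "\<lambda>w. w $ i"] by (simp add: cv_def)
    then show "lin \<alpha> *v (lin \<alpha> *v v) = - (\<omega>\<^sup>2) *\<^sub>R v" unfolding of_real_eq_iff by (simp add: vec_eq_iff)
  next
    assume v: "lin \<alpha> *v (lin \<alpha> *v v) = - (\<omega>\<^sup>2) *\<^sub>R v"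
    have AA: "A (cv (lin \<alpha> *v v)) = (- (of_real \<omega>)\<^sup>2) *s cv v"
      by (simp add: A_cv v) (simp add: cv_def vec_eq_iff)
    \<comment> \<open>If A^2 v = -\<omega>^2 v, these are the spectral components of v for the
      eigenvalues -s i \<omega>, with s = 1 and s = -1.\<close>
    define b where "b s = (1/2) *s (cv v + (s * \<i> / of_real \<omega>) *s cv (lin \<alpha> *v v))" for s :: complex
    have Ab: "A (b s) = (- s * \<i> * of_real \<omega>) *s b s" if "s\<^sup>2 = 1" for s
    proof -
      have "A (b s) = (1/2) *s (cv (lin \<alpha> *v v) + (s * \<i> / of_real \<omega>) *s ((- (of_real \<omega>)\<^sup>2) *s cv v))"
        by (simp add: b_def A_add A_scale A_cv[of v] AA)
      also have "\<dots> = (- s * \<i> * of_real \<omega>) *s b s"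
        using assms that by (simp add: b_def vec_eq_iff power2_eq_square field_simps)
      finally show ?thesis .
    qed
    have "b (-1) \<in> eigenspace (lin \<alpha>) (\<i> * of_real \<omega>)" "b 1 \<in> eigenspace (lin \<alpha>) (- \<i> * of_real \<omega>)"
      using Ab[of "-1"] Ab[of 1] by (auto simp: E)
    moreover have "cv v = b (-1) + b 1" by (simp add: b_def vec_eq_iff algebra_simps)
    ultimately show "v \<in> center_space \<alpha> \<omega>"
      unfolding center_space_def cv_def[symmetric] by blast
  qed
qed

text \<open>The elimination that gives the characteristic polynomial also determines an eigenvector
  by its first entry; hence real eigenspaces are at most lines.\<close>

lemma lin_eigenvector:
  assumes "0 < \<alpha>" and ev: "lin \<alpha> *v X = \<kappa> *\<^sub>R X"
  defines "e \<equiv> - 2 * \<kappa> / (\<kappa>\<^sup>2 + (\<alpha> + 2))"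
  shows "X = X$1 *\<^sub>R vector [1, e, \<kappa> - e, \<kappa> * e + 1]"
proof -
  have eqs: "X$3 + X$2 = \<kappa> * X$1" "X$4 - X$1 = \<kappa> * X$2" "- (X$3 + X$2) - (\<alpha> + 2) * X$2 = \<kappa> * X$4"
    using ev unfolding lin_mult[OF assms(1)] by (simp_all add: real4_eq_iff)
  have D: "\<kappa>\<^sup>2 + (\<alpha> + 2) \<noteq> 0" using assms by (smt (verit) zero_le_power2)
  have "(\<kappa>\<^sup>2 + (\<alpha> + 2)) * X$2 = - 2 * \<kappa> * X$1"
    using eqs by algebra
  then have "X$2 = e * X$1" using D by (simp add: e_def field_simps)
  then show ?thesis using eqs by (simp add: real4_eq_iff algebra_simps)
qed

lemma lin_eigenvector_multiple:
  assumes "0 < \<alpha>" "lin \<alpha> *v X = \<kappa> *\<^sub>R X" "lin \<alpha> *v Y = \<kappa> *\<^sub>R Y" "Y \<noteq> 0"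
  shows "\<exists>c. X = c *\<^sub>R Y"
proof -
  obtain v where X: "X = X$1 *\<^sub>R v" and Y: "Y = Y$1 *\<^sub>R v"
    using lin_eigenvector[OF assms(1,2)] lin_eigenvector[OF assms(1,3)] by blast
  have "Y$1 \<noteq> 0" using Y assms(4) by (metis scaleR_zero_left)
  then have "(X$1 / Y$1) *\<^sub>R (Y$1 *\<^sub>R v) = X$1 *\<^sub>R v" by simp
  then show ?thesis using X Y by metis
qed

text \<open>k^2 and -\<omega>^2 are the two roots of one quadratic equation in z^2. The last two
  claims are Vieta's formulas, obtained by subtracting the two equations and cancelling k^2 +
  \<omega>^2.\<close>

lemma eigen_frame_characteristic:
  assumes "0 < \<alpha>" "eigen_frame \<alpha> k \<omega> \<xi>p \<xi>m"
  shows "(k\<^sup>2 - (\<alpha> + 2)\<^sup>2) * (k\<^sup>2 + (\<alpha> + 2)) + 4 * k\<^sup>2 = 0"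
    "k\<^sup>2 - \<omega>\<^sup>2 = (\<alpha> + 2)\<^sup>2 - (\<alpha> + 2) - 4" "k\<^sup>2 * \<omega>\<^sup>2 = (\<alpha> + 2) ^ 3"
proof -
  define \<beta> where "\<beta> = \<alpha> + 2"
  have kw: "0 < k" "0 < \<omega>" and ev: "complex_of_real k \<in> eigenvalues (lin \<alpha>)"
    "\<i> * complex_of_real \<omega> \<in> eigenvalues (lin \<alpha>)"
    using assms by (auto simp: eigen_frame_def)
  have "complex_of_real ((k\<^sup>2 - \<beta>\<^sup>2) * (k\<^sup>2 + \<beta>) + 4 * k\<^sup>2) = 0"
    using eigenvalue_lin_characteristic[OF assms(1) ev(1)] kw by (simp add: \<beta>_def)
  then show k: "(k\<^sup>2 - (\<alpha> + 2)\<^sup>2) * (k\<^sup>2 + (\<alpha> + 2)) + 4 * k\<^sup>2 = 0"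
    unfolding of_real_eq_0_iff by (simp add: \<beta>_def)
  have "complex_of_real ((- \<omega>\<^sup>2 - \<beta>\<^sup>2) * (- \<omega>\<^sup>2 + \<beta>) - 4 * \<omega>\<^sup>2) = 0"
    using eigenvalue_lin_characteristic[OF assms(1) ev(2)] kw by (simp add: \<beta>_def power_mult_distrib)
  then have w: "(- \<omega>\<^sup>2 - \<beta>\<^sup>2) * (- \<omega>\<^sup>2 + \<beta>) - 4 * \<omega>\<^sup>2 = 0"
    unfolding of_real_eq_0_iff .
  have "(k\<^sup>2 + \<omega>\<^sup>2) * (k\<^sup>2 - \<omega>\<^sup>2 - (\<beta>\<^sup>2 - \<beta> - 4)) = 0"
    using k w unfolding \<beta>_def[symmetric] by algebra
  moreover have "k\<^sup>2 + \<omega>\<^sup>2 \<noteq> 0" using kw by (simp add: sum_power2_eq_zero_iff)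
  ultimately have "k\<^sup>2 - \<omega>\<^sup>2 - (\<beta>\<^sup>2 - \<beta> - 4) = 0" using mult_eq_0_iff by blast
  then show 1: "k\<^sup>2 - \<omega>\<^sup>2 = (\<alpha> + 2)\<^sup>2 - (\<alpha> + 2) - 4" by (simp add: \<beta>_def)
  then show "k\<^sup>2 * \<omega>\<^sup>2 = (\<alpha> + 2) ^ 3" using k by algebra
qed

text \<open>The plane is symplectically orthogonal to both eigenvectors, and \<Omega>(\<xi>_+,
  \<xi>_-) = 1, so pairing with the eigenvectors reads off the coefficients. The same orthogonality
  removes the mixed terms of the quadratic form.\<close>

lemma eigen_frame_components:
  assumes \<alpha>: "0 < \<alpha>" and frame: "eigen_frame \<alpha> k \<omega> \<xi>p \<xi>m"
  defines "\<gamma> \<equiv> \<lambda>X. X - Omega X \<xi>m *\<^sub>R \<xi>p - Omega \<xi>p X *\<^sub>R \<xi>m"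
  shows "components \<alpha> \<omega> \<xi>p \<xi>m X = (Omega X \<xi>m, Omega \<xi>p X, \<gamma> X)"
    and "Omega X (lin \<alpha> *v X) = - 2 * k * Omega X \<xi>m * Omega \<xi>p X + Omega (\<gamma> X) (lin \<alpha> *v \<gamma> X)"
proof -
  have fr: "0 < k" "0 < \<omega>" "lin \<alpha> *v \<xi>p = k *\<^sub>R \<xi>p" "lin \<alpha> *v \<xi>m = (- k) *\<^sub>R \<xi>m" "Omega \<xi>p \<xi>m = 1"
    "\<xi>p \<noteq> 0" "\<xi>m \<noteq> 0"
    using frame by (auto simp: eigen_frame_def)
  have mp: "Omega \<xi>m \<xi>p = -1" using Omega_antisym[of \<xi>m \<xi>p] fr by simp
  have orth: "Omega (\<gamma> X) \<xi>m = 0" "Omega \<xi>p (\<gamma> X) = 0" "Omega (\<gamma> X) \<xi>p = 0" "Omega \<xi>m (\<gamma> X) = 0" for X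
  proof -
    show 1: "Omega (\<gamma> X) \<xi>m = 0" "Omega \<xi>p (\<gamma> X) = 0"
      by (simp_all add: \<gamma>_def Omega_linear Omega_self fr)
    show "Omega (\<gamma> X) \<xi>p = 0" "Omega \<xi>m (\<gamma> X) = 0"
      using 1 Omega_antisym[of "\<gamma> X" \<xi>p] Omega_antisym[of "\<xi>m" "\<gamma> X"] by auto
  qed
  have kw: "k\<^sup>2 + \<omega>\<^sup>2 \<noteq> 0" using fr by (simp add: sum_power2_eq_zero_iff)
  have center_orth: "Omega c \<xi>p = 0 \<and> Omega c \<xi>m = 0" if "c \<in> center_space \<alpha> \<omega>" for c
  proof -
    have c: "lin \<alpha> *v (lin \<alpha> *v c) = - (\<omega>\<^sup>2) *\<^sub>R c" using that center_space_iff[OF \<alpha>, of \<omega> c] fr by simp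
    have "(k\<^sup>2 + \<omega>\<^sup>2) * Omega c \<xi> = 0" if "lin \<alpha> *v \<xi> = s *\<^sub>R \<xi>" "s\<^sup>2 = k\<^sup>2" for \<xi> s
    proof -
      have "Omega (lin \<alpha> *v (lin \<alpha> *v c)) \<xi> = s\<^sup>2 * Omega c \<xi>"
        by (simp add: Omega_lin[OF \<alpha>] that lin_linear Omega_linear power2_eq_square)
      then have "- \<omega>\<^sup>2 * Omega c \<xi> = k\<^sup>2 * Omega c \<xi>"
        unfolding c that(2) Omega_linear by simp
      then show ?thesis by algebra
    qed
    from this[OF fr(3)] this[OF fr(4)] show ?thesis
      unfolding mult_eq_0_iff power2_minus using kw by blast
  qed
  have center: "\<gamma> X \<in> center_space \<alpha> \<omega>" for X
  proof -
    let ?A = "\<lambda>v. lin \<alpha> *v v"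
    define u where "u = ?A (?A (\<gamma> X)) + \<omega>\<^sup>2 *\<^sub>R \<gamma> X"
    \<comment> \<open>Cayley-Hamilton, (A^2 - k^2) (A^2 + \<omega>^2) = 0. It remains to exclude a
      component of \<open>u\<close> in the hyperbolic directions.\<close>
    have CH: "?A (?A (?A (?A Y))) + (\<omega>\<^sup>2 - k\<^sup>2) *\<^sub>R ?A (?A Y) - (k\<^sup>2 * \<omega>\<^sup>2) *\<^sub>R Y = 0" for Y
    proof -
      have e: "\<omega>\<^sup>2 - k\<^sup>2 = - ((\<alpha> + 2)\<^sup>2 - (\<alpha> + 2) - 4)" "k\<^sup>2 * \<omega>\<^sup>2 = (\<alpha> + 2) ^ 3"
        using eigen_frame_characteristic[OF \<alpha> frame] by auto
      show ?thesis unfolding e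
        by (simp add: lin_mult[OF \<alpha>] real4_eq_iff power2_eq_square power3_eq_cube algebra_simps)
    qed
    have u2: "?A (?A u) = k\<^sup>2 *\<^sub>R u"
      using CH[of "\<gamma> X"] by (simp add: u_def lin_linear algebra_simps)
    have orthu: "Omega u \<xi>m = 0" "Omega u \<xi>p = 0"
      by (simp_all add: u_def Omega_linear Omega_lin[OF \<alpha>] fr lin_linear orth)
    \<comment> \<open>This vector lies on the eigenline of k and is symplectically orthogonal to
      \<open>\<xi>m\<close>, whereas \<open>\<xi>p\<close> is not; so it vanishes. The opposite sign
      is symmetric.\<close>
    have "?A u + k *\<^sub>R u = 0"
    proof -
      let ?p = "?A u + k *\<^sub>R u"
      have ev: "?A ?p = k *\<^sub>R ?p" by (simp add: lin_linear u2 power2_eq_square algebra_simps)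
      obtain c where c: "?p = c *\<^sub>R \<xi>p" using lin_eigenvector_multiple[OF \<alpha> ev fr(3,6)] by blast
      have "Omega ?p \<xi>m = 0" by (simp add: Omega_linear Omega_lin[OF \<alpha>] orthu fr)
      then have "c = 0" unfolding c by (simp add: Omega_linear fr)
      then show ?thesis using c by simp
    qed
    moreover have "?A u - k *\<^sub>R u = 0"
    proof -
      let ?p = "?A u - k *\<^sub>R u"
      have ev: "?A ?p = (- k) *\<^sub>R ?p" by (simp add: lin_linear u2 power2_eq_square algebra_simps)
      obtain c where c: "?p = c *\<^sub>R \<xi>m" using lin_eigenvector_multiple[OF \<alpha> ev fr(4,7)] by blast
      have "Omega ?p \<xi>p = 0" by (simp add: Omega_linear Omega_lin[OF \<alpha>] orthu fr)
      then have "c = 0" unfolding c by (simp add: Omega_linear mp)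
      then show ?thesis using c by simp
    qed
    ultimately have "(2 * k) *\<^sub>R u = 0" by (simp add: algebra_simps flip: scaleR_2)
    then have "u = 0" using fr by simp
    then show ?thesis using \<alpha> fr by (simp add: center_space_iff u_def eq_neg_iff_add_eq_0)
  qed
  show "components \<alpha> \<omega> \<xi>p \<xi>m X = (Omega X \<xi>m, Omega \<xi>p X, \<gamma> X)"
    unfolding components_def
  proof (rule the_equality)
    show "case (Omega X \<xi>m, Omega \<xi>p X, \<gamma> X) of (lp, lm, c) \<Rightarrow> c \<in> center_space \<alpha> \<omega> \<and> X = lp *\<^sub>R \<xi>p + lm *\<^sub>R \<xi>m + c"
      using center by (simp add: \<gamma>_def)
    fix t assume "case t of (lp, lm, c) \<Rightarrow> c \<in> center_space \<alpha> \<omega> \<and> X = lp *\<^sub>R \<xi>p + lm *\<^sub>R \<xi>m + c"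
    then obtain lp lm c where t: "t = (lp, lm, c)" and c: "c \<in> center_space \<alpha> \<omega>"
      and X: "X = lp *\<^sub>R \<xi>p + lm *\<^sub>R \<xi>m + c" by (cases t) auto
    have "Omega \<xi>p c = 0" using center_orth[OF c] Omega_antisym[of \<xi>p c] by simp
    then have "Omega X \<xi>m = lp" "Omega \<xi>p X = lm"
      using center_orth[OF c] by (simp_all add: X Omega_linear Omega_self fr)
    then show "t = (Omega X \<xi>m, Omega \<xi>p X, \<gamma> X)" by (simp add: t \<gamma>_def X)
  qed
  define l m where "l = Omega X \<xi>m" and "m = Omega \<xi>p X"
  have X: "X = l *\<^sub>R \<xi>p + m *\<^sub>R \<xi>m + \<gamma> X" by (simp add: \<gamma>_def l_def m_def)
  have A0: "Omega \<xi>p (lin \<alpha> *v \<gamma> X) = 0" "Omega \<xi>m (lin \<alpha> *v \<gamma> X) = 0"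
    using Omega_lin[OF \<alpha>, of \<xi>p "\<gamma> X"] Omega_lin[OF \<alpha>, of \<xi>m "\<gamma> X"]
    by (simp_all add: fr Omega_linear orth)
  have "Omega X (lin \<alpha> *v X) = Omega (l *\<^sub>R \<xi>p + m *\<^sub>R \<xi>m + \<gamma> X) (lin \<alpha> *v (l *\<^sub>R \<xi>p + m *\<^sub>R \<xi>m + \<gamma> X))"
    using X by simp
  also have "\<dots> = - 2 * k * l * m + Omega (\<gamma> X) (lin \<alpha> *v \<gamma> X)"
    by (simp add: lin_linear Omega_linear Omega_self orth A0 fr mp algebra_simps)
  finally show "Omega X (lin \<alpha> *v X) = - 2 * k * Omega X \<xi>m * Omega \<xi>p X + Omega (\<gamma> X) (lin \<alpha> *v \<gamma> X)"
    by (simp add: l_def m_def)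
qed

text \<open>The two normalizations force equal first entries a for both eigenvectors. Their
  difference then has only a second and a third entry, so \<lambda>_+ + \<lambda>_- depends only on
  X_1 and X_4. The remaining sign of a disappears in the square.\<close>

lemma eigen_frame_unstable_coordinate:
  assumes \<alpha>: "0 < \<alpha>" and frame: "eigen_frame \<alpha> k \<omega> \<xi>p \<xi>m"
  defines "\<kappa> \<equiv> k\<^sup>2 + (\<alpha> + 2)"
  shows "k / 2 * (Omega X \<xi>m + Omega \<xi>p X)\<^sup>2
    = (Lam (k * (\<kappa> + 4) / sqrt (\<kappa>\<^sup>2 + 4 * (\<alpha> + 2))) (2 / (\<kappa> + 4)) X)\<^sup>2"
proof -
  have fr: "0 < k" "0 < \<omega>" "lin \<alpha> *v \<xi>p = k *\<^sub>R \<xi>p" "lin \<alpha> *v \<xi>m = (- k) *\<^sub>R \<xi>m" "Omega \<xi>p \<xi>m = 1"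
    "norm \<xi>p = norm \<xi>m"
    using frame by (auto simp: eigen_frame_def)
  have \<kappa>: "0 < \<kappa>" using \<alpha> by (simp add: \<kappa>_def add_nonneg_pos)
  define \<beta> where "\<beta> = \<alpha> + 2"
  define a b e where "a = \<xi>p$1" and "b = \<xi>m$1" and "e = - 2 * k / \<kappa>"
  have p: "\<xi>p = a *\<^sub>R vector [1, e, k - e, k * e + 1]"
    using lin_eigenvector[OF \<alpha> fr(3)] by (simp add: a_def e_def \<kappa>_def)
  have m: "\<xi>m = b *\<^sub>R vector [1, - e, - (k - e), k * e + 1]"
    using lin_eigenvector[OF \<alpha> fr(4)] by (simp add: b_def e_def \<kappa>_def)
  define c where "c = 2 * (k - e) - 2 * e * (k * e + 1)"
  have abc: "a * b * c = 1"
  proof -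
    have "Omega \<xi>p \<xi>m = a * b * c"
      unfolding p m by (simp add: Omega_eq c_def algebra_simps)
    then show ?thesis using fr(5) by simp
  qed
  have c: "c = 2 * k * (\<kappa>\<^sup>2 + 4 * \<beta>) / \<kappa>\<^sup>2"
  proof -
    have "\<kappa>\<^sup>2 * c = 2 * k * \<kappa>\<^sup>2 - 4 * (e * \<kappa>) * \<kappa> - 2 * k * (e * \<kappa>)\<^sup>2"
      by (simp add: c_def algebra_simps power2_eq_square)
    also have "e * \<kappa> = - 2 * k" using \<kappa> by (simp add: e_def)
    also have "2 * k * \<kappa>\<^sup>2 - 4 * (- 2 * k) * \<kappa> - 2 * k * (- 2 * k)\<^sup>2 = 2 * k * (\<kappa>\<^sup>2 + 4 * \<beta>)"
      by (simp add: \<kappa>_def \<beta>_def algebra_simps power2_eq_square)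
    finally show ?thesis using \<kappa> by (simp add: field_simps)
  qed
  have D: "0 < \<kappa>\<^sup>2 + 4 * \<beta>" using \<alpha> by (simp add: \<beta>_def add_nonneg_pos)
  have cpos: "0 < c" using fr D \<kappa> by (simp add: c)
  have "(norm \<xi>p)\<^sup>2 = (norm \<xi>m)\<^sup>2" using fr by simp
  then have "(a\<^sup>2 - b\<^sup>2) * (1 + e\<^sup>2 + (k - e)\<^sup>2 + (k * e + 1)\<^sup>2) = 0"
    unfolding power2_norm_eq_inner p m inner_real4 by (simp add: algebra_simps power2_eq_square)
  moreover have "0 < 1 + e\<^sup>2 + (k - e)\<^sup>2 + (k * e + 1)\<^sup>2" by (simp add: add_pos_nonneg)
  ultimately have "a\<^sup>2 = b\<^sup>2" by simp
  \<comment> \<open>Equal norms leave the relative sign open; it is fixed by a b c = 1 with c >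
    0.\<close>
  moreover have "a \<noteq> - b"
  proof
    assume "a = - b"
    then have "- (b\<^sup>2 * c) = 1" using abc by (simp add: power2_eq_square)
    moreover have "0 \<le> b\<^sup>2 * c" using cpos by simp
    ultimately show False by simp
  qed
  ultimately have ab: "b = a" by (metis power2_eq_iff)
  have a2: "a\<^sup>2 * (2 * k * (\<kappa>\<^sup>2 + 4 * \<beta>)) = \<kappa>\<^sup>2"
  proof -
    have "c * \<kappa>\<^sup>2 = 2 * k * (\<kappa>\<^sup>2 + 4 * \<beta>)" using \<kappa> by (simp add: c)
    moreover have "a\<^sup>2 * c = 1" using abc by (simp add: ab power2_eq_square)
    ultimately show ?thesis by (metis mult.assoc mult.left_neutral)
  qed
  have "Omega X \<xi>m + Omega \<xi>p X = 2 * a * ((k - 2 * e) * X$1 - e * (X$4 - X$1))"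
    by (simp add: Omega_eq p m ab algebra_simps)
  also have "\<dots> = 2 * a * k / \<kappa> * ((\<kappa> + 4) * X$1 + 2 * (X$4 - X$1))"
    using \<kappa> by (simp add: e_def field_simps)
  finally have sum: "Omega X \<xi>m + Omega \<xi>p X = 2 * a * k / \<kappa> * ((\<kappa> + 4) * X$1 + 2 * (X$4 - X$1))" .
  define Y where "Y = (\<kappa> + 4) * X$1 + 2 * (X$4 - X$1)"
  have "k / 2 * (Omega X \<xi>m + Omega \<xi>p X)\<^sup>2 = (a\<^sup>2 * (2 * k)) * k\<^sup>2 / \<kappa>\<^sup>2 * Y\<^sup>2"
    unfolding sum Y_def[symmetric] by (simp add: power_mult_distrib power_divide power2_eq_square)
  also have "a\<^sup>2 * (2 * k) = \<kappa>\<^sup>2 / (\<kappa>\<^sup>2 + 4 * \<beta>)" using a2 D by (simp add: field_simps)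
  also have "\<kappa>\<^sup>2 / (\<kappa>\<^sup>2 + 4 * \<beta>) * k\<^sup>2 / \<kappa>\<^sup>2 * Y\<^sup>2 = (k * Y / sqrt (\<kappa>\<^sup>2 + 4 * \<beta>))\<^sup>2"
    using \<kappa> D by (simp add: power_divide power_mult_distrib)
  also have "k * Y / sqrt (\<kappa>\<^sup>2 + 4 * \<beta>) = Lam (k * (\<kappa> + 4) / sqrt (\<kappa>\<^sup>2 + 4 * \<beta>)) (2 / (\<kappa> + 4)) X"
  proof -
    have "(\<kappa> + 4) * (X$1 + 2 / (\<kappa> + 4) * (X$4 - X$1)) = Y"
      using \<kappa> by (simp add: Y_def distrib_left)
    then have "k * Y / sqrt (\<kappa>\<^sup>2 + 4 * \<beta>)
        = k * ((\<kappa> + 4) * (X$1 + 2 / (\<kappa> + 4) * (X$4 - X$1))) / sqrt (\<kappa>\<^sup>2 + 4 * \<beta>)" by simp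
    then show ?thesis by (simp only: Lam_def times_divide_eq_left mult.assoc)
  qed
  finally show ?thesis by (simp add: \<beta>_def)
qed

text \<open>Subtracting k/2 (\<lambda>_+ + \<lambda>_-)^2 from |X|_E^2 leaves -k \<lambda>_+
  \<lambda>_- + \<Omega>(\<gamma>, A \<gamma>)/2, which is the quadratic part \<open>H2\<close> of
  the energy. From here on the estimates see the frame only through k, g and p.\<close>

lemma eigen_frame_normal_form:
  assumes \<alpha>: "2 \<le> \<alpha>" and frame: "eigen_frame \<alpha> k \<omega> \<xi>p \<xi>m"
  obtains g p where "\<alpha> + 2 \<le> g" "g \<le> 28 / 25 * (\<alpha> + 2)" "0 < p" "p * (\<alpha> + 2) \<le> 2 / 5"
    "(1 - 2 * p) * (\<alpha> + 2)\<^sup>2 = k\<^sup>2" "2 * (1 - 2 * p) - p * (\<alpha> + 2) = k\<^sup>2 * p"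
    "\<And>X. norm_E \<alpha> k \<omega> \<xi>p \<xi>m X = sqrt (H2 \<alpha> X + (Lam g p X)\<^sup>2)"
    "\<And>\<sigma> \<psi>. C_rem \<alpha> k \<omega> \<xi>p \<xi>m \<sigma> \<psi> = energy \<alpha> \<psi> - E_star \<alpha> + (Lam g p (displacement \<alpha> \<sigma> \<psi>))\<^sup>2
      - (norm_E \<alpha> k \<omega> \<xi>p \<xi>m (displacement \<alpha> \<sigma> \<psi>))\<^sup>2"
proof -
  have \<alpha>0: "0 < \<alpha>" and k: "0 < k" using \<alpha> frame by (auto simp: eigen_frame_def)
  define \<kappa> where "\<kappa> = k\<^sup>2 + (\<alpha> + 2)"
  note comp = eigen_frame_components[OF \<alpha>0 frame]
  note Lam = eigen_frame_unstable_coordinate[OF \<alpha>0 frame, folded \<kappa>_def]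
  note H = Omega_lin_self[OF \<alpha>0]
  show ?thesis
  proof (rule that)
    have "4 \<le> \<alpha> + 2" using \<alpha> by simp
    note b = characteristic_bounds[OF this k eigen_frame_characteristic(1)[OF \<alpha>0 frame], folded \<kappa>_def]
    show "\<alpha> + 2 \<le> k * (\<kappa> + 4) / sqrt (\<kappa>\<^sup>2 + 4 * (\<alpha> + 2))"
      "k * (\<kappa> + 4) / sqrt (\<kappa>\<^sup>2 + 4 * (\<alpha> + 2)) \<le> 28 / 25 * (\<alpha> + 2)"
      "0 < 2 / (\<kappa> + 4)" "2 / (\<kappa> + 4) * (\<alpha> + 2) \<le> 2 / 5"
      "(1 - 2 * (2 / (\<kappa> + 4))) * (\<alpha> + 2)\<^sup>2 = k\<^sup>2"
      "2 * (1 - 2 * (2 / (\<kappa> + 4))) - 2 / (\<kappa> + 4) * (\<alpha> + 2) = k\<^sup>2 * (2 / (\<kappa> + 4))"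
      by (fact b)+
    fix X
    show "norm_E \<alpha> k \<omega> \<xi>p \<xi>m X =
        sqrt (H2 \<alpha> X + (Lam (k * (\<kappa> + 4) / sqrt (\<kappa>\<^sup>2 + 4 * (\<alpha> + 2))) (2 / (\<kappa> + 4)) X)\<^sup>2)"
      unfolding Lam[symmetric] norm_E_def comp(1) using comp(2)[of X] H[of X]
      by (simp add: power2_sum algebra_simps add_divide_distrib diff_divide_distrib)
  next
    fix \<sigma> \<psi>
    show "C_rem \<alpha> k \<omega> \<xi>p \<xi>m \<sigma> \<psi> = energy \<alpha> \<psi> - E_star \<alpha>
      + (Lam (k * (\<kappa> + 4) / sqrt (\<kappa>\<^sup>2 + 4 * (\<alpha> + 2))) (2 / (\<kappa> + 4)) (displacement \<alpha> \<sigma> \<psi>))\<^sup>2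
      - (norm_E \<alpha> k \<omega> \<xi>p \<xi>m (displacement \<alpha> \<sigma> \<psi>))\<^sup>2"
      unfolding Lam[symmetric] C_rem_def comp(1) by (simp add: E_star_def Let_def)
  qed
qed

section \<open>The virial inequality\<close>

text \<open>Weighted Young inequality applied to 1 - b z and 1 with weights 1/b and 1 - 1/b, then
  raised to the power b.\<close>

lemma powr_ge_Bernoulli:
  fixes b z :: real
  assumes "1 \<le> b" "0 \<le> z" "z < 1"
  shows "1 - b * z \<le> (1 - z) powr b"
proof (cases "1 - b * z \<le> 0")
  case False
  then have "(1 - b * z) powr (1 / b) * 1 powr (1 - 1 / b) \<le> 1 / b * (1 - b * z) + (1 - 1 / b) * 1"
    using assms by (intro Youngs_inequality_0) auto
  also have "\<dots> = 1 - z" using assms by (simp add: field_simps)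
  finally have "(1 - b * z) powr (1 / b) \<le> 1 - z" by simp
  then have "((1 - b * z) powr (1 / b)) powr b \<le> (1 - z) powr b"
    using assms by (intro powr_mono2) auto
  then show ?thesis using False assms by (simp add: powr_powr)
qed (use powr_ge_zero order_trans in blast)

lemma powr_minus_ge_Bernoulli:
  fixes b z :: real
  assumes "0 \<le> b" "0 \<le> z" "z < 1"
  shows "1 + b * z \<le> (1 - z) powr (- b)"
proof -
  have "b * ln (1 - z) \<le> b * (- z)"
    using ln_add_one_self_le_self2[of "- z"] assms by (intro mult_left_mono) auto
  then have "exp (b * z) \<le> exp (- b * ln (1 - z))" by simp
  then have "1 + b * z \<le> exp (- b * ln (1 - z))" using exp_ge_add_one_self order_trans by blast
  then show ?thesis using assms by (simp add: powr_def)
qed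

text \<open>In the variables \<open>s = r\<^sup>2\<close> and \<open>U = r\<^sup>-\<^sup>\<alpha>\<close>, with \<open>Q = q\<^sub>0\<^sup>2\<close>, the quantity \<open>P\<close> is the
  squared speed on the energy level \<open>E\<^sup>*\<close>, maximized over the circle \<open>x\<^sup>2 + y\<^sup>2 = s\<close>.\<close>

lemma virial_inequality_critical:
  fixes \<alpha> Q s U :: real
  assumes "2 \<le> \<alpha>" "0 < s" "s < Q" and U: "U = s powr (- \<alpha> / 2)" and Q: "Q powr (- \<alpha> / 2) = Q / \<alpha>"
  defines "P \<equiv> (\<alpha> + 2) * (2 * (U - Q / \<alpha>) - (Q - s))"
  shows "0 \<le> P" "P + 2 * sqrt s * sqrt P + (\<alpha> + 2) * (s - \<alpha> * U) \<le> - 4 * (Q - s)"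
proof -
  define b where "b = \<alpha> / 2"
  have b: "1 \<le> b" "\<alpha> = 2 * b" using assms by (auto simp: b_def)
  define z where "z = 1 - s / Q"
  have z: "0 < z" "z < 1" "s = Q * (1 - z)" using assms by (auto simp: z_def field_simps)
  \<comment> \<open>\<open>H\<close> is normalized to equal z to first order. In these variables P =
    (\<alpha> + 2) Q (H - z), so P measures the convexity of the power.\<close>
  define H where "H = ((1 - z) powr (- b) - 1) / b"
  have "U = Q powr (- \<alpha> / 2) * (1 - z) powr (- b)"
    using z assms by (simp add: U powr_mult b)
  also have "\<dots> = Q / \<alpha> * (1 - z) powr (- b)" by (simp only: Q)
  also have "\<dots> = Q / \<alpha> * (1 + b * H)" using b by (simp add: H_def)
  finally have UH: "U - Q / \<alpha> = Q * H / 2" "\<alpha> * U = Q * (1 + b * H)"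
    using b by (auto simp: field_simps)
  have Hz: "z \<le> H"
    using powr_minus_ge_Bernoulli[of b z] b z by (simp add: H_def field_simps)
  have H0: "0 \<le> H" using Hz z by simp
  have "(1 - z) powr (- b) * (1 - b * z) \<le> (1 - z) powr (- b) * (1 - z) powr b"
    using powr_ge_Bernoulli[of b z] b z by (intro mult_left_mono) auto
  also have "\<dots> = 1" using z by (simp flip: powr_add)
  finally have "(1 + b * H) * (1 - b * z) \<le> 1" using b by (simp add: H_def)
  then have "b * (H * (1 - b * z)) \<le> b * z" by (simp add: algebra_simps)
  then have key0: "H * (1 - b * z) \<le> z" using b by (simp only: mult_le_cancel_left)
  \<comment> \<open>This is the rotational term after squaring: since s P = \<beta> Q^2 (1 - z) (H -
    z), it bounds 2 sqrt(s P) by sqrt \<beta> Q m with the m introduced below. The remaining terms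
    add up to exactly -\<beta> Q m, so the gain \<beta> - sqrt \<beta> \<ge> 2 survives.\<close>
  have key: "(1 - z) * (H - z) \<le> (z + (b - 1) * H / 2)\<^sup>2"
  proof -
    have "(1 - z) * (H - z) \<le> z\<^sup>2 + (b - 1) * z * H"
      using key0 by (simp add: algebra_simps power2_eq_square)
    also have "\<dots> \<le> (z + (b - 1) * H / 2)\<^sup>2"
      using zero_le_power2[of "(b - 1) * H / 2"] by (simp add: power2_sum)
    finally show ?thesis .
  qed
  define \<beta> where "\<beta> = \<alpha> + 2"
  have \<beta>: "4 \<le> \<beta>" using assms by (simp add: \<beta>_def)
  have P: "P = \<beta> * Q * (H - z)"
    unfolding P_def UH(1) by (simp add: \<beta>_def z(3) algebra_simps)
  show P0: "0 \<le> P" using P Hz \<beta> assms by simp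
  define m where "m = 2 * z + (b - 1) * H"
  have m: "2 * z \<le> m" "0 \<le> m" using b H0 z by (auto simp: m_def)
  have "s * P = \<beta> * Q\<^sup>2 * ((1 - z) * (H - z))" by (simp add: P z(3) power2_eq_square)
  also have "\<dots> \<le> \<beta> * Q\<^sup>2 * (m / 2)\<^sup>2"
    using key \<beta> by (intro mult_left_mono) (auto simp: m_def add_divide_distrib)
  finally have "sqrt (s * P) \<le> sqrt (\<beta> * Q\<^sup>2 * (m / 2)\<^sup>2)" by simp
  also have "\<dots> = sqrt \<beta> * (Q * (m / 2))"
    using assms m by (simp add: real_sqrt_mult real_sqrt_abs)
  finally have "2 * sqrt s * sqrt P \<le> sqrt \<beta> * Q * m" by (simp add: real_sqrt_mult)
  moreover have "P + \<beta> * (s - \<alpha> * U) = - (\<beta> * Q * m)"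
    unfolding P UH(2) by (simp add: m_def z(3) algebra_simps)
  ultimately have "P + 2 * sqrt s * sqrt P + \<beta> * (s - \<alpha> * U) \<le> - ((\<beta> - sqrt \<beta>) * (Q * m))"
    by (simp add: algebra_simps)
  also have "\<dots> \<le> - (2 * (Q * (2 * z)))"
  proof -
    have "2 \<le> sqrt \<beta>" using \<beta> by (intro real_le_rsqrt) auto
    then have "2 * 1 \<le> sqrt \<beta> * (sqrt \<beta> - 1)" using \<beta> by (intro mult_mono) auto
    then have "2 \<le> \<beta> - sqrt \<beta>" using \<beta> by (simp add: algebra_simps)
    moreover have "Q * (2 * z) \<le> Q * m" using m assms by (intro mult_left_mono) auto
    ultimately have "2 * (Q * (2 * z)) \<le> (\<beta> - sqrt \<beta>) * (Q * m)"
      using z assms by (intro mult_mono) auto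
    then show ?thesis by simp
  qed
  also have "\<dots> = - 4 * (Q - s)" by (simp add: z(3) algebra_simps)
  finally show "P + 2 * sqrt s * sqrt P + (\<alpha> + 2) * (s - \<alpha> * U) \<le> - 4 * (Q - s)"
    by (simp add: \<beta>_def)
qed

text \<open>The left side is half the second time derivative of r^2. The energy bounds the squared
  speed by 2 \<epsilon>^2 + P after x^2 is replaced by s, Cauchy-Schwarz bounds the rotational term
  x v - y u by sqrt s times the speed, and subadditivity of the root separates \<epsilon> from the
  critical case.\<close>

lemma virial_inequality:
  fixes \<alpha> Q s U x y u v \<epsilon> :: real
  assumes "2 \<le> \<alpha>" "0 < s" "s < Q" and U: "U = s powr (- \<alpha> / 2)" and Q: "Q powr (- \<alpha> / 2) = Q / \<alpha>"
    and s: "s = x\<^sup>2 + y\<^sup>2" and "0 \<le> \<epsilon>"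
    and E: "(u\<^sup>2 + v\<^sup>2) / 2 - (\<alpha> + 2) / 2 * x\<^sup>2 - (\<alpha> + 2) * U \<le> - (\<alpha> + 2)\<^sup>2 / 2 * (Q / \<alpha>) + \<epsilon>\<^sup>2"
  shows "u\<^sup>2 + v\<^sup>2 + 2 * (x * v - y * u) + (\<alpha> + 2) * (x\<^sup>2 - \<alpha> * U)
    \<le> - 4 * (Q - s) + 2 * \<epsilon>\<^sup>2 + 4 * sqrt Q * \<epsilon>"
proof -
  define P where "P = (\<alpha> + 2) * (2 * (U - Q / \<alpha>) - (Q - s))"
  note cr = virial_inequality_critical[OF assms(1-5), folded P_def]
  have Q0: "0 < Q" using assms by simp
  have Q2: "(\<alpha> + 2)\<^sup>2 * (Q / \<alpha>) = (\<alpha> + 2) * (2 * (Q / \<alpha>) + Q)"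
    using assms by (simp add: field_simps power2_eq_square)
  have "u\<^sup>2 + v\<^sup>2 \<le> 2 * \<epsilon>\<^sup>2 + (\<alpha> + 2) * x\<^sup>2 + 2 * (\<alpha> + 2) * U - (\<alpha> + 2) * (2 * (Q / \<alpha>) + Q)"
  proof -
    have "(\<alpha> + 2)\<^sup>2 / 2 * (Q / \<alpha>) = (\<alpha> + 2) * (2 * (Q / \<alpha>) + Q) / 2" using Q2 by simp
    moreover have "(\<alpha> + 2) / 2 * x\<^sup>2 = (\<alpha> + 2) * x\<^sup>2 / 2" by simp
    ultimately show ?thesis using E by argo
  qed
  also have "\<dots> \<le> 2 * \<epsilon>\<^sup>2 + (\<alpha> + 2) * s + 2 * (\<alpha> + 2) * U - (\<alpha> + 2) * (2 * (Q / \<alpha>) + Q)"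
    using s assms by simp
  also have "\<dots> = 2 * \<epsilon>\<^sup>2 + P" by (simp add: P_def algebra_simps)
  finally have uv: "u\<^sup>2 + v\<^sup>2 \<le> 2 * \<epsilon>\<^sup>2 + P" .
  have "(x * v - y * u)\<^sup>2 \<le> s * (u\<^sup>2 + v\<^sup>2)"
    using zero_le_power2[of "x * u + y * v"] by (simp add: s power2_eq_square algebra_simps)
  also have "\<dots> \<le> s * (2 * \<epsilon>\<^sup>2 + P)" using uv assms by (intro mult_left_mono) auto
  finally have "x * v - y * u \<le> sqrt (s * (2 * \<epsilon>\<^sup>2 + P))" by (rule real_le_rsqrt)
  also have "\<dots> = sqrt s * sqrt (2 * \<epsilon>\<^sup>2 + P)" by (simp add: real_sqrt_mult)
  also have "\<dots> \<le> sqrt s * (sqrt (2 * \<epsilon>\<^sup>2) + sqrt P)"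
    using cr assms by (intro mult_left_mono sqrt_add_le_add_sqrt) auto
  also have "\<dots> \<le> 2 * sqrt Q * \<epsilon> + sqrt s * sqrt P"
  proof -
    have "sqrt (2 * \<epsilon>\<^sup>2) \<le> 2 * \<epsilon>"
      using assms by (intro real_le_lsqrt) (auto simp: power_mult_distrib)
    then have "sqrt s * sqrt (2 * \<epsilon>\<^sup>2) \<le> sqrt Q * (2 * \<epsilon>)" using assms by (intro mult_mono) auto
    then show ?thesis by (simp add: algebra_simps)
  qed
  finally have "2 * (x * v - y * u) \<le> 4 * sqrt Q * \<epsilon> + 2 * sqrt s * sqrt P" by simp
  moreover have "(\<alpha> + 2) * (x\<^sup>2 - \<alpha> * U) \<le> (\<alpha> + 2) * (s - \<alpha> * U)"
    using assms by (intro mult_left_mono) auto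
  ultimately show ?thesis using cr(2) uv by simp
qed

section \<open>Ejection from the ground states\<close>

text \<open>\<open>Lam1\<close> and \<open>Lam2\<close> are the first two time derivatives of
  \<open>Lam g p (\<phi> - ground \<alpha>)\<close> along the flow, \<open>virial1\<close> and
  \<open>virial2\<close> those of \<open>sq \<phi> / 2\<close>; see
  \<open>derivatives_along\<close>. As functions of the phase point they can be expanded at the
  ground state.\<close>

definition Lam1 :: "real \<Rightarrow> real \<Rightarrow> real \<Rightarrow> real^4 \<Rightarrow> real" where
  "Lam1 \<alpha> g p \<phi> = g * ((1 - 2 * p) * (\<phi>$3 + \<phi>$2) - p * (\<alpha> + 2) * (\<phi>$2 * att \<alpha> \<phi>))"

definition Lam2 :: "real \<Rightarrow> real \<Rightarrow> real \<Rightarrow> real^4 \<Rightarrow> real" where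
  "Lam2 \<alpha> g p \<phi> = g * ((1 - 2 * p) * (2 * (\<phi>$4 - \<phi>$1) + (\<alpha> + 2) * \<phi>$1 - (\<alpha> + 2) * (\<phi>$1 * att \<alpha> \<phi>))
    - p * (\<alpha> + 2) * ((\<phi>$4 - \<phi>$1) * att \<alpha> \<phi>
      + \<phi>$2 * (att' \<alpha> \<phi> * (\<phi>$1 * (\<phi>$3 + \<phi>$2) + \<phi>$2 * (\<phi>$4 - \<phi>$1)))))"

definition virial1 :: "real^4 \<Rightarrow> real" where
  "virial1 \<phi> = \<phi>$1 * (\<phi>$3 + \<phi>$2) + \<phi>$2 * (\<phi>$4 - \<phi>$1)"

definition virial2 :: "real \<Rightarrow> real^4 \<Rightarrow> real" where
  "virial2 \<alpha> \<phi> = (\<phi>$3 + \<phi>$2)\<^sup>2 + (\<phi>$4 - \<phi>$1)\<^sup>2 + 2 * (\<phi>$1 * (\<phi>$4 - \<phi>$1) - \<phi>$2 * (\<phi>$3 + \<phi>$2))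
    + (\<alpha> + 2) * ((\<phi>$1)\<^sup>2 - sq \<phi> * att \<alpha> \<phi>)"

lemma sq_mult_att: "\<phi> \<in> phase_space \<Longrightarrow> sq \<phi> * att \<alpha> \<phi> = \<alpha> * sq \<phi> powr (- \<alpha> / 2)"
  using powr_mult_base[of "sq \<phi>" "- \<alpha> / 2 - 1"] by (simp add: att_def phase_space_iff)

lemma W_eq': "\<phi> \<in> phase_space \<Longrightarrow> W \<alpha> \<phi> = (\<alpha> + 2) * ((\<phi>$1)\<^sup>2 - sq \<phi> * att \<alpha> \<phi>)"
  by (simp add: W_eq sq_mult_att)

lemma has_real_derivative_along:
  assumes "(\<phi> has_vector_derivative d) (at t)" "(F has_derivative F') (at (\<phi> t))"
  shows "((\<lambda>t. F (\<phi> t)) has_real_derivative F' d) (at t)"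
proof -
  have "((\<lambda>t. F (\<phi> t)) has_derivative (\<lambda>h. F' (h *\<^sub>R d))) (at t)"
    using assms unfolding has_vector_derivative_def by (rule has_derivative_compose)
  moreover have "F' (h *\<^sub>R d) = F' d * h" for h
    using linear_cmul[OF has_derivative_linear[OF assms(2)]] by simp
  ultimately show ?thesis by (simp add: has_field_derivative_def)
qed

lemma derivatives_along:
  assumes \<phi>: "\<phi> t \<in> phase_space" "(\<phi> has_vector_derivative J *v egrad \<alpha> (\<phi> t)) (at t)"
  shows "((\<lambda>t. sq (\<phi> t)) has_real_derivative 2 * virial1 (\<phi> t)) (at t)"
    "((\<lambda>t. virial1 (\<phi> t)) has_real_derivative virial2 \<alpha> (\<phi> t)) (at t)"
    "((\<lambda>t. Lam g p (\<phi> t - ground \<alpha>)) has_real_derivative Lam1 \<alpha> g p (\<phi> t)) (at t)"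
    "((\<lambda>t. Lam1 \<alpha> g p (\<phi> t)) has_real_derivative Lam2 \<alpha> g p (\<phi> t)) (at t)"
proof -
  let ?d = "J *v egrad \<alpha> (\<phi> t)"
  note along = has_real_derivative_along[OF \<phi>(2)]
  have d: "?d$1 = \<phi> t$3 + \<phi> t$2" "?d$2 = \<phi> t$4 - \<phi> t$1"
    "?d$3 = \<phi> t$4 - \<phi> t$1 + (\<alpha> + 2) * \<phi> t$1 - (\<alpha> + 2) * (\<phi> t$1 * att \<alpha> (\<phi> t))"
    "?d$4 = - (\<phi> t$3 + \<phi> t$2) - (\<alpha> + 2) * (\<phi> t$2 * att \<alpha> (\<phi> t))"
    by (simp_all add: J_mult egrad_def)
  have "(sq has_derivative (\<lambda>h. 2 * (\<phi> t $ 1 * h $ 1 + \<phi> t $ 2 * h $ 2))) (at (\<phi> t))"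
    by (auto intro!: derivative_eq_intros)
  from along[OF this] show "((\<lambda>t. sq (\<phi> t)) has_real_derivative 2 * virial1 (\<phi> t)) (at t)"
    by (simp add: d virial1_def)
  have "(virial1 has_derivative (\<lambda>h. \<phi> t$1 * (h$3 + h$2) + h$1 * (\<phi> t$3 + \<phi> t$2)
      + (\<phi> t$2 * (h$4 - h$1) + h$2 * (\<phi> t$4 - \<phi> t$1)))) (at (\<phi> t))"
    unfolding virial1_def by (auto intro!: derivative_eq_intros)
  from along[OF this] show "((\<lambda>t. virial1 (\<phi> t)) has_real_derivative virial2 \<alpha> (\<phi> t)) (at t)"
    by (rule DERIV_cong) (simp add: d virial2_def sq_def power2_eq_square algebra_simps)
  have "((\<lambda>\<psi>. Lam g p (\<psi> - ground \<alpha>)) has_derivative Lam g p) (at (\<phi> t))"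
    unfolding Lam_def by (auto intro!: derivative_eq_intros)
  from along[OF this] show "((\<lambda>t. Lam g p (\<phi> t - ground \<alpha>)) has_real_derivative Lam1 \<alpha> g p (\<phi> t)) (at t)"
    by (rule DERIV_cong) (simp add: d Lam_def Lam1_def algebra_simps)
  have "(Lam1 \<alpha> g p has_derivative (\<lambda>h. g * ((1 - 2 * p) * (h$3 + h$2) - p * (\<alpha> + 2) *
      (\<phi> t$2 * (att' \<alpha> (\<phi> t) * (\<phi> t$1 * h$1 + \<phi> t$2 * h$2)) + h$2 * att \<alpha> (\<phi> t))))) (at (\<phi> t))"
    unfolding Lam1_def using \<phi>(1) by (auto intro!: derivative_eq_intros)
  from along[OF this] show "((\<lambda>t. Lam1 \<alpha> g p (\<phi> t)) has_real_derivative Lam2 \<alpha> g p (\<phi> t)) (at t)"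
    by (rule DERIV_cong) (simp add: d Lam2_def algebra_simps)
qed

lemma has_derivative_ground:
  assumes "0 < \<alpha>"
    and rel: "(1 - 2 * p) * (\<alpha> + 2)\<^sup>2 = k\<^sup>2" "2 * (1 - 2 * p) - p * (\<alpha> + 2) = k\<^sup>2 * p"
  shows "(Lam2 \<alpha> g p has_derivative (\<lambda>h. k\<^sup>2 * Lam g p h)) (at (ground \<alpha>))" (is ?L2)
    "(virial2 \<alpha> has_derivative (\<lambda>h. q0 \<alpha> * (2 * (h$4 - h$1) + (\<alpha> + 2)\<^sup>2 * h$1))) (at (ground \<alpha>))" (is ?V2)
    "((\<lambda>\<phi>. (\<alpha> + 2) * ((\<phi>$1)\<^sup>2 - sq \<phi> * att \<alpha> \<phi>)) has_derivative (\<lambda>h. (\<alpha> + 2)\<^sup>2 * q0 \<alpha> * h$1)) (at (ground \<alpha>))" (is ?W)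
    "\<exists>D. (Lam1 \<alpha> g p has_derivative D) (at (ground \<alpha>))"
    "\<exists>D. (virial1 has_derivative D) (at (ground \<alpha>))"
    "\<exists>D. ((\<lambda>\<phi>. Lam g p (\<phi> - ground \<alpha>)) has_derivative D) (at (ground \<alpha>))"
proof -
  note g = ground_values[OF assms(1)] q0[OF assms(1)]
  note a = has_derivative_att_ground[OF assms(1)]
  \<comment> \<open>Both factors vanish at the ground state, so this term has no linear
    part.\<close>
  have *: "((\<lambda>\<phi>. \<phi>$2 * (att' \<alpha> \<phi> * (\<phi>$1 * (\<phi>$3 + \<phi>$2) + \<phi>$2 * (\<phi>$4 - \<phi>$1)))) has_derivative (\<lambda>h. 0)) (at (ground \<alpha>))"
    unfolding att'_def using g(2) by (auto intro!: derivative_eq_intros simp: fun_eq_iff)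
  have c: "k\<^sup>2 * Lam g p h = g * ((1 - 2 * p) * (2 * (h$4 - h$1) + (\<alpha> + 2) * h$1 - (\<alpha> + 2) * (- (\<alpha> + 1) * h$1))
      - p * (\<alpha> + 2) * ((h$4 - h$1) + 0))" for h
  proof -
    have "k\<^sup>2 * Lam g p h = g * (((1 - 2 * p) * (\<alpha> + 2)\<^sup>2) * h$1 + (2 * (1 - 2 * p) - p * (\<alpha> + 2)) * (h$4 - h$1))"
      unfolding rel by (simp add: Lam_def algebra_simps)
    then show ?thesis by (simp add: algebra_simps power2_eq_square)
  qed
  show ?L2 unfolding Lam2_def c[abs_def]
    by (rule derivative_intros a * | simp; fail)+
  have c: "(\<alpha> + 2)\<^sup>2 * q0 \<alpha> * h$1 = (\<alpha> + 2) * (2 * q0 \<alpha> * h$1 - (- \<alpha> * q0 \<alpha> * h$1))" for h :: "real^4"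
    by (simp add: algebra_simps power2_eq_square)
  have "((\<lambda>\<phi>::real^4. (\<phi>$1)\<^sup>2) has_derivative (\<lambda>h. 2 * q0 \<alpha> * h$1)) (at (ground \<alpha>))"
    by (auto intro!: derivative_eq_intros)
  then show W: ?W unfolding c by (intro derivative_intros a)
  have "((\<lambda>\<phi>::real^4. (\<phi>$3 + \<phi>$2)\<^sup>2 + (\<phi>$4 - \<phi>$1)\<^sup>2 + 2 * (\<phi>$1 * (\<phi>$4 - \<phi>$1) - \<phi>$2 * (\<phi>$3 + \<phi>$2)))
      has_derivative (\<lambda>h. q0 \<alpha> * (2 * (h$4 - h$1)))) (at (ground \<alpha>))"
    by (auto intro!: derivative_eq_intros)
  from has_derivative_add[OF this W] show ?V2
    unfolding virial2_def by (simp add: algebra_simps)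
  show "\<exists>D. (Lam1 \<alpha> g p has_derivative D) (at (ground \<alpha>))"
    unfolding Lam1_def by (rule exI) (rule derivative_intros a)+
  show "\<exists>D. (virial1 has_derivative D) (at (ground \<alpha>))"
    unfolding virial1_def by (rule exI) (rule derivative_intros)+
  show "\<exists>D. ((\<lambda>\<phi>. Lam g p (\<phi> - ground \<alpha>)) has_derivative D) (at (ground \<alpha>))"
    unfolding Lam_def by (rule exI) (rule derivative_intros)+
qed

lemma has_derivative_linear_bound:
  fixes f :: "'a::real_normed_vector \<Rightarrow> real"
  assumes "(f has_derivative D) (at a)" "f a = 0"
  shows "\<exists>M. \<forall>\<^sub>F x in nhds a. \<bar>f x\<bar> \<le> M * norm (x - a)"
proof -
  obtain B where B: "norm (D h) \<le> B * norm h" for h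
    using bounded_linear.bounded[OF has_derivative_bounded_linear[OF assms(1)]] by (metis mult.commute)
  obtain d where d: "d > 0" "\<And>y. norm (y - a) < d \<Longrightarrow> norm (f y - f a - D (y - a)) \<le> 1 * norm (y - a)"
    using assms(1) unfolding has_derivative_at_alt by (metis zero_less_one)
  have "\<bar>f x\<bar> \<le> (B + 1) * norm (x - a)" if "dist x a < d" for x
    using d(2)[of x] B[of "x - a"] that assms(2) by (simp add: dist_norm algebra_simps)
  then show ?thesis using d(1) unfolding eventually_nhds_metric by blast
qed

lemma has_derivative_small_remainder:
  fixes f :: "'a::real_normed_vector \<Rightarrow> real"
  assumes "(f has_derivative D) (at a)" "f a = 0" "0 < c"
  shows "\<forall>\<^sub>F x in nhds a. \<bar>f x - D (x - a)\<bar> \<le> c * norm (x - a)"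
  using assms unfolding has_derivative_at_alt eventually_nhds_metric by (simp add: dist_norm)

section \<open>The energy cone around the unstable coordinate\<close>

lemma unstable_coordinate_quadratic_bound:
  fixes X :: "real^4"
  assumes \<alpha>: "2 \<le> \<alpha>" and g: "\<alpha> + 2 \<le> g" and p: "0 < p" "p * (\<alpha> + 2) \<le> 2 / 5"
  shows "(norm X)\<^sup>2 \<le> 20 * (H2 \<alpha> X + (Lam g p X)\<^sup>2)"
proof -
  define \<beta> where "\<beta> = \<alpha> + 2"
  define x y u v where "x = X$1" and "y = X$2" and "u = X$3 + X$2" and "v = X$4 - X$1"
  define b where "b = \<beta> * x"
  define r where "r = p * \<beta>"
  have r: "0 \<le> r" "r \<le> 2 / 5" and \<beta>: "4 \<le> \<beta>" using assms by (auto simp: r_def \<beta>_def)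
  have "\<beta>\<^sup>2 * (x + p * v)\<^sup>2 \<le> g\<^sup>2 * (x + p * v)\<^sup>2"
    using g \<beta> by (intro mult_right_mono power_mono) (auto simp: \<beta>_def)
  then have "(b + r * v)\<^sup>2 \<le> (Lam g p X)\<^sup>2"
    by (simp add: Lam_def x_def v_def b_def r_def algebra_simps flip: power_mult_distrib)
  moreover have "H2 \<alpha> X = (u\<^sup>2 + v\<^sup>2 - b\<^sup>2 + \<beta> * y\<^sup>2) / 2"
    by (simp add: H2_def u_def v_def b_def x_def y_def \<beta>_def power_mult_distrib)
  \<comment> \<open>\<open>H2\<close> is indefinite only through -b^2/2, and \<Lambda>^2 \<ge> (b +
    r v)^2 contributes b^2. The mixed term costs at most r (b^2 + v^2), and r \<le> 2/5 leaves 1/2 -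
    2/5 = 1/10 of b^2 + v^2.\<close>
  moreover have "r * (b\<^sup>2 + v\<^sup>2) + 2 * r * (b * v) \<ge> 0"
  proof -
    have "0 \<le> r * (b + v)\<^sup>2" using r by simp
    then show ?thesis by (simp add: power2_sum algebra_simps)
  qed
  moreover have "r * (b\<^sup>2 + v\<^sup>2) \<le> 2 / 5 * (b\<^sup>2 + v\<^sup>2)" using r by (intro mult_right_mono) auto
  moreover have "(b + r * v)\<^sup>2 = b\<^sup>2 + 2 * r * (b * v) + (r * v)\<^sup>2" by (simp add: power2_sum algebra_simps)
  moreover have "0 \<le> (r * v)\<^sup>2" by simp
  moreover have "4 * y\<^sup>2 \<le> \<beta> * y\<^sup>2" using \<beta> by (intro mult_right_mono) auto
  ultimately have 1: "u\<^sup>2 / 2 + 2 * y\<^sup>2 + (b\<^sup>2 + v\<^sup>2) / 10 \<le> H2 \<alpha> X + (Lam g p X)\<^sup>2" by argo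
  have "4\<^sup>2 * x\<^sup>2 \<le> b\<^sup>2" unfolding b_def power_mult_distrib using \<beta> by (intro mult_right_mono power_mono) auto
  then have "16 * x\<^sup>2 \<le> b\<^sup>2" by simp
  moreover have "(norm X)\<^sup>2 = x\<^sup>2 + y\<^sup>2 + (u - y)\<^sup>2 + (v + x)\<^sup>2"
    unfolding power2_norm_eq_inner inner_real4 by (simp add: x_def y_def u_def v_def power2_eq_square)
  moreover have "(u - y)\<^sup>2 \<le> 2 * u\<^sup>2 + 2 * y\<^sup>2" "(v + x)\<^sup>2 \<le> 2 * v\<^sup>2 + 2 * x\<^sup>2"
    using zero_le_power2[of "u + y"] zero_le_power2[of "v - x"] by (simp_all add: power2_sum power2_diff)
  moreover have "0 \<le> u\<^sup>2" "0 \<le> x\<^sup>2" "0 \<le> y\<^sup>2" by simp_all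
  moreover have "10 * u\<^sup>2 + 40 * y\<^sup>2 + 2 * b\<^sup>2 + 2 * v\<^sup>2 \<le> 20 * (H2 \<alpha> X + (Lam g p X)\<^sup>2)"
    using mult_left_mono[OF 1, of 20] by (simp add: algebra_simps add_divide_distrib)
  ultimately show ?thesis by linarith
qed

text \<open>If b were nonpositive, then |b| and b + r v would be at most 2/5 |v|, and the hypothesis
  would give v^2 \<le> 4/25 (1 + \<theta>) v^2, impossible for \<theta> < 21/4 unless v = 0. If |v|
  > c b, then b < |v|/c contradicts the second condition on \<theta>.\<close>

lemma cone_estimate:
  fixes b c v r \<theta> :: real
  assumes r: "0 \<le> r" "r \<le> 2 / 5" and pos: "0 < b + r * v"
    and hyp: "v\<^sup>2 \<le> b\<^sup>2 + \<theta> * (b + r * v)\<^sup>2" and c: "0 < c" and \<theta>: "0 \<le> \<theta>" "\<theta> * (1 / c + 2 / 5)\<^sup>2 + 1 / c\<^sup>2 < 1" "\<theta> < 21 / 4"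
  shows "0 < b" "\<bar>v\<bar> \<le> c * b"
proof -
  have "r * \<bar>v\<bar> \<le> 2 / 5 * \<bar>v\<bar>" using r by (intro mult_right_mono) auto
  then have rv: "\<bar>r * v\<bar> \<le> 2 / 5 * \<bar>v\<bar>" using r by (simp add: abs_mult)
  show b: "0 < b"
  proof (rule ccontr)
    assume "\<not> 0 < b"
    then have "b\<^sup>2 \<le> (2 / 5 * \<bar>v\<bar>)\<^sup>2" "(b + r * v)\<^sup>2 \<le> (2 / 5 * \<bar>v\<bar>)\<^sup>2"
      using pos rv by (auto intro!: power2_le_iff_abs_le[THEN iffD2])
    then have "v\<^sup>2 \<le> (2 / 5 * \<bar>v\<bar>)\<^sup>2 + \<theta> * (2 / 5 * \<bar>v\<bar>)\<^sup>2"
      using hyp \<theta> by (smt (verit) mult_left_mono)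
    then have "v\<^sup>2 * (21 / 4 - \<theta>) \<le> 0" by (simp add: power_mult_distrib algebra_simps power2_eq_square)
    then have "v = 0" using \<theta> by (simp add: mult_le_0_iff)
    then show False using pos \<open>\<not> 0 < b\<close> by simp
  qed
  show "\<bar>v\<bar> \<le> c * b"
  proof (rule ccontr)
    assume "\<not> \<bar>v\<bar> \<le> c * b"
    then have bv: "b \<le> \<bar>v\<bar> / c" and v: "0 < \<bar>v\<bar>" using c b by (auto simp: field_simps)
    have "b\<^sup>2 \<le> (\<bar>v\<bar> / c)\<^sup>2" using b bv by (intro power_mono) auto
    moreover have "(b + r * v)\<^sup>2 \<le> (\<bar>v\<bar> / c + 2 / 5 * \<bar>v\<bar>)\<^sup>2"
      using pos bv rv by (intro power_mono) auto
    ultimately have "v\<^sup>2 \<le> (\<bar>v\<bar> / c)\<^sup>2 + \<theta> * (\<bar>v\<bar> / c + 2 / 5 * \<bar>v\<bar>)\<^sup>2"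
      using hyp \<theta> by (smt (verit) mult_left_mono)
    also have "\<dots> = v\<^sup>2 * (\<theta> * (1 / c + 2 / 5)\<^sup>2 + 1 / c\<^sup>2)"
    proof -
      have "\<bar>v\<bar> / c + 2 / 5 * \<bar>v\<bar> = \<bar>v\<bar> * (1 / c + 2 / 5)" by (simp add: algebra_simps)
      then show ?thesis unfolding power_divide by (simp only: power_mult_distrib power2_abs) (simp add: algebra_simps)
    qed
    also have "\<dots> < v\<^sup>2 * 1" using v \<theta> by (intro mult_strict_left_mono) auto
    finally show False by simp
  qed
qed

text \<open>The first claim fixes the sign of the horizontal displacement, hence of the linear part
  of \<open>W\<close>; the second fixes the sign of the linear part of \<open>virial2\<close>. The
  second needs the narrower cone, in which 2 v is dominated by the term in X_1.\<close>

lemma unstable_cone: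
  fixes X :: "real^4"
  assumes \<alpha>: "2 \<le> \<alpha>" and g: "\<alpha> + 2 \<le> g" "g \<le> 28 / 25 * (\<alpha> + 2)"
    and p: "0 < p" "p * (\<alpha> + 2) \<le> 2 / 5" and pos: "0 < Lam g p X"
  shows "H2 \<alpha> X \<le> (Lam g p X)\<^sup>2 / 2 \<Longrightarrow> Lam g p X \<le> 3 * (\<alpha> + 2) * X$1"
    and "H2 \<alpha> X \<le> (Lam g p X)\<^sup>2 / 7 \<Longrightarrow> Lam g p X \<le> 3 * (2 * (X$4 - X$1) + (\<alpha> + 2)\<^sup>2 * X$1)"
proof -
  define \<beta> where "\<beta> = \<alpha> + 2"
  define v where "v = X$4 - X$1"
  define b where "b = \<beta> * X$1"
  define r where "r = p * \<beta>"
  have r: "0 \<le> r" "r \<le> 2 / 5" and \<beta>: "4 \<le> \<beta>" using assms by (auto simp: r_def \<beta>_def)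
  define G where "G = g / \<beta>"
  have G: "1 \<le> G" "G \<le> 28 / 25" using g \<beta> by (auto simp: G_def \<beta>_def field_simps)
  have L: "Lam g p X = G * (b + r * v)" using \<beta> by (simp add: Lam_def G_def b_def r_def v_def field_simps)
  have posb: "0 < b + r * v" using pos G by (simp add: L zero_less_mult_iff)
  have G2: "(Lam g p X)\<^sup>2 \<le> (28 / 25)\<^sup>2 * (b + r * v)\<^sup>2"
    unfolding L power_mult_distrib using G by (intro mult_right_mono power_mono) auto
  have "H2 \<alpha> X = ((X$3 + X$2)\<^sup>2 + v\<^sup>2 - b\<^sup>2 + \<beta> * (X$2)\<^sup>2) / 2"
    by (simp add: H2_def v_def b_def \<beta>_def power_mult_distrib)
  moreover have "0 \<le> (X$3 + X$2)\<^sup>2" "0 \<le> \<beta> * (X$2)\<^sup>2" using \<beta> by simp_all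
  ultimately have H: "v\<^sup>2 \<le> b\<^sup>2 + 2 * H2 \<alpha> X" by argo
  { assume "H2 \<alpha> X \<le> (Lam g p X)\<^sup>2 / 2"
    then have "v\<^sup>2 \<le> b\<^sup>2 + (28 / 25)\<^sup>2 * (b + r * v)\<^sup>2" using H G2 by argo
    from cone_estimate[OF r posb this, of "5/2"] have b: "0 < b" "\<bar>v\<bar> \<le> 5/2 * b"
      by (simp_all add: power2_eq_square)
    have "r * v \<le> 2/5 * (5/2 * b)" using r b by (intro order_trans[OF mult_left_mono[of v "\<bar>v\<bar>"] mult_mono]) auto
    then have "b + r * v \<le> 2 * b" by simp
    then have "G * (b + r * v) \<le> 28/25 * (2 * b)" using G b posb by (intro mult_mono) auto
    then have "Lam g p X \<le> 3 * b" using b by (simp add: L)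
    then show "Lam g p X \<le> 3 * (\<alpha> + 2) * X$1" by (simp only: b_def \<beta>_def mult.assoc) }
  { assume "H2 \<alpha> X \<le> (Lam g p X)\<^sup>2 / 7"
    then have "v\<^sup>2 \<le> b\<^sup>2 + (2 / 7 * (28 / 25)\<^sup>2) * (b + r * v)\<^sup>2" using H G2 by argo
    \<comment> \<open>The slope 3/2 is chosen so that 2 v \<ge> -3 b, which \<beta> b \<ge> 4 b
      compensates with b to spare.\<close>
    from cone_estimate[OF r posb this, of "3/2"] have b: "0 < b" "\<bar>v\<bar> \<le> 3/2 * b"
      by (simp_all add: power2_eq_square)
    have "r * v \<le> 2/5 * (3/2 * b)" using r b by (intro order_trans[OF mult_left_mono[of v "\<bar>v\<bar>"] mult_mono]) auto
    then have "b + r * v \<le> 2 * b" using b by simp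
    then have "G * (b + r * v) \<le> 28/25 * (2 * b)" using G b posb by (intro mult_mono) auto
    then have "Lam g p X \<le> 3 * b" using b by (simp add: L)
    also have "b \<le> 2 * v + \<beta> * b"
    proof -
      have "4 * b \<le> \<beta> * b" using \<beta> b by simp
      then show ?thesis using b by linarith
    qed
    finally show "Lam g p X \<le> 3 * (2 * (X$4 - X$1) + (\<alpha> + 2)\<^sup>2 * X$1)"
      by (simp add: v_def b_def \<beta>_def power2_eq_square mult.assoc) }
qed

lemma first_crossing:
  fixes f :: "real \<Rightarrow> real"
  assumes cont: "continuous_on {a..b} f" and "a \<le> b" "f a < c" "c \<le> f b"
  obtains t where "a < t" "t \<le> b" "f t = c" "\<And>s. a \<le> s \<Longrightarrow> s < t \<Longrightarrow> f s < c"
proof -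
  define S where "S = {s \<in> {a..b}. c \<le> f s}"
  have "closed S"
  proof -
    have "S = {a..b} \<inter> f -` {c..}" by (auto simp: S_def)
    then show ?thesis using continuous_closed_preimage[OF cont, of "{c..}"] by simp
  qed
  moreover have "S \<noteq> {}" "bdd_below S" using assms by (auto simp: S_def)
  ultimately have InfS: "Inf S \<in> S" by (intro closed_contains_Inf)
  have below: "f s < c" if "a \<le> s" "s < Inf S" for s
  proof (rule ccontr)
    assume "\<not> f s < c"
    then have "s \<in> S" using that InfS by (auto simp: S_def)
    then show False using cInf_lower[OF _ \<open>bdd_below S\<close>] that by fastforce
  qed
  have "f (Inf S) = c"
  proof (rule ccontr)
    assume ne: "f (Inf S) \<noteq> c"
    have "\<exists>x\<ge>a. x \<le> Inf S \<and> f x = c"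
      using InfS assms by (intro IVT') (auto simp: S_def intro: continuous_on_subset[OF cont])
    then show False using below ne by (metis less_eq_real_def less_irrefl)
  qed
  then show ?thesis using InfS below assms by (intro that[of "Inf S"]) (auto simp: S_def less_eq_real_def)
qed

text \<open>Solutions on \<open>[a, T)\<close> of constant energy which cannot be extended, in the sense that they
  leave every compact part of the phase space before a finite \<open>T\<close>.\<close>

definition trajectory :: "real \<Rightarrow> (real \<Rightarrow> real^4) \<Rightarrow> real \<Rightarrow> ereal \<Rightarrow> bool" where
  "trajectory \<alpha> \<phi> a T \<longleftrightarrow> ereal a < T \<and>
    (\<forall>t\<ge>a. ereal t < T \<longrightarrow> \<phi> t \<in> phase_space \<and> energy \<alpha> (\<phi> t) = energy \<alpha> (\<phi> a) \<and>
      (\<phi> has_vector_derivative J *v egrad \<alpha> (\<phi> t)) (at t)) \<and>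
    (T < \<infinity> \<longrightarrow> (\<forall>K t1. compact K \<longrightarrow> K \<subseteq> phase_space \<longrightarrow> a \<le> t1 \<longrightarrow> ereal t1 < T \<longrightarrow>
      (\<exists>t\<ge>t1. ereal t < T \<and> \<phi> t \<notin> K)))"

text \<open>All nonlinear terms of the ejection argument are controlled by first order Taylor expansions;
  the second order expansion of the energy is replaced by the bound on \<open>C\<close> in the choice of \<open>\<delta>\<^sub>E\<close>.\<close>

lemma ground_neighbourhood:
  assumes \<alpha>: "2 \<le> \<alpha>"
    and rel: "(1 - 2 * p) * (\<alpha> + 2)\<^sup>2 = k\<^sup>2" "2 * (1 - 2 * p) - p * (\<alpha> + 2) = k\<^sup>2 * p"
    and c: "0 < c" and R: "0 < R"
  obtains \<rho> M where "0 < \<rho>" "0 < M"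
    "\<And>\<phi>. norm (\<phi> - ground \<alpha>) \<le> \<rho> \<Longrightarrow> \<phi> \<in> phase_space"
    "\<And>\<phi>. norm (\<phi> - ground \<alpha>) \<le> \<rho> \<Longrightarrow> H2 \<alpha> (\<phi> - ground \<alpha>) + (Lam g p (\<phi> - ground \<alpha>))\<^sup>2 \<le> R"
    "\<And>\<phi>. norm (\<phi> - ground \<alpha>) \<le> \<rho> \<Longrightarrow> \<bar>Lam2 \<alpha> g p \<phi> - k\<^sup>2 * Lam g p (\<phi> - ground \<alpha>)\<bar> \<le> c * norm (\<phi> - ground \<alpha>)"
    "\<And>\<phi>. norm (\<phi> - ground \<alpha>) \<le> \<rho> \<Longrightarrow> \<bar>virial2 \<alpha> \<phi> - q0 \<alpha> * (2 * ((\<phi> - ground \<alpha>)$4 - (\<phi> - ground \<alpha>)$1)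
      + (\<alpha> + 2)\<^sup>2 * (\<phi> - ground \<alpha>)$1)\<bar> \<le> c * norm (\<phi> - ground \<alpha>)"
    "\<And>\<phi>. norm (\<phi> - ground \<alpha>) \<le> \<rho> \<Longrightarrow> \<bar>W \<alpha> \<phi> - (\<alpha> + 2)\<^sup>2 * q0 \<alpha> * (\<phi> - ground \<alpha>)$1\<bar> \<le> c * norm (\<phi> - ground \<alpha>)"
    "\<And>\<phi>. norm (\<phi> - ground \<alpha>) \<le> \<rho> \<Longrightarrow> \<bar>Lam1 \<alpha> g p \<phi>\<bar> \<le> M * norm (\<phi> - ground \<alpha>)"
    "\<And>\<phi>. norm (\<phi> - ground \<alpha>) \<le> \<rho> \<Longrightarrow> \<bar>virial1 \<phi>\<bar> \<le> M * norm (\<phi> - ground \<alpha>)"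
    "\<And>\<phi>. norm (\<phi> - ground \<alpha>) \<le> \<rho> \<Longrightarrow> \<bar>Lam g p (\<phi> - ground \<alpha>)\<bar> \<le> M * norm (\<phi> - ground \<alpha>)"
proof -
  have \<alpha>0: "0 < \<alpha>" using \<alpha> by simp
  note g = ground_values[OF \<alpha>0]
  note d = has_derivative_ground[OF \<alpha>0 rel]
  have ev1: "\<forall>\<^sub>F \<phi> in nhds (ground \<alpha>). \<phi> \<in> phase_space"
    using g open_phase_space eventually_nhds by blast
  have "open {\<phi>. H2 \<alpha> (\<phi> - ground \<alpha>) + (Lam g p (\<phi> - ground \<alpha>))\<^sup>2 < R}"
    unfolding H2_def Lam_def by (intro open_Collect_less continuous_intros) auto
  moreover have "ground \<alpha> \<in> {\<phi>. H2 \<alpha> (\<phi> - ground \<alpha>) + (Lam g p (\<phi> - ground \<alpha>))\<^sup>2 < R}"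
    using R by (simp add: H2_def Lam_def)
  ultimately have ev2: "\<forall>\<^sub>F \<phi> in nhds (ground \<alpha>). H2 \<alpha> (\<phi> - ground \<alpha>) + (Lam g p (\<phi> - ground \<alpha>))\<^sup>2 < R"
    unfolding eventually_nhds by blast
  have z: "Lam2 \<alpha> g p (ground \<alpha>) = 0" "virial2 \<alpha> (ground \<alpha>) = 0" "Lam1 \<alpha> g p (ground \<alpha>) = 0"
    "virial1 (ground \<alpha>) = 0" "Lam g p (ground \<alpha> - ground \<alpha>) = 0"
    "(\<alpha> + 2) * ((ground \<alpha>$1)\<^sup>2 - sq (ground \<alpha>) * att \<alpha> (ground \<alpha>)) = 0"
    using g by (simp_all add: Lam2_def virial2_def Lam1_def virial1_def Lam_def)
  note ev3 = has_derivative_small_remainder[OF d(1) z(1) c] has_derivative_small_remainder[OF d(2) z(2) c]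
    has_derivative_small_remainder[OF d(3) z(6) c]
  obtain D1 D2 D3 where D: "(Lam1 \<alpha> g p has_derivative D1) (at (ground \<alpha>))"
    "(virial1 has_derivative D2) (at (ground \<alpha>))"
    "((\<lambda>\<phi>. Lam g p (\<phi> - ground \<alpha>)) has_derivative D3) (at (ground \<alpha>))"
    using d(4)[of g] d(5) d(6)[of g] by blast
  obtain M1 M2 M3 where ev4: "\<forall>\<^sub>F x in nhds (ground \<alpha>). \<bar>Lam1 \<alpha> g p x\<bar> \<le> M1 * norm (x - ground \<alpha>)"
    "\<forall>\<^sub>F x in nhds (ground \<alpha>). \<bar>virial1 x\<bar> \<le> M2 * norm (x - ground \<alpha>)"
    "\<forall>\<^sub>F x in nhds (ground \<alpha>). \<bar>Lam g p (x - ground \<alpha>)\<bar> \<le> M3 * norm (x - ground \<alpha>)"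
    using has_derivative_linear_bound[OF D(1) z(3)] has_derivative_linear_bound[OF D(2) z(4)]
      has_derivative_linear_bound[OF D(3) z(5)] by blast
  define M where "M = max 1 (max M1 (max M2 M3))"
  have M: "1 \<le> M" "M1 \<le> M" "M2 \<le> M" "M3 \<le> M" by (auto simp: M_def)
  have le: "x \<le> M * norm y" if "x \<le> m * norm y" "m \<le> M" for x m and y :: "real^4"
    using that by (meson mult_right_mono norm_ge_zero order_trans)
  have "\<forall>\<^sub>F \<phi> in nhds (ground \<alpha>). \<phi> \<in> phase_space \<and>
      H2 \<alpha> (\<phi> - ground \<alpha>) + (Lam g p (\<phi> - ground \<alpha>))\<^sup>2 < R \<and>
      \<bar>Lam2 \<alpha> g p \<phi> - k\<^sup>2 * Lam g p (\<phi> - ground \<alpha>)\<bar> \<le> c * norm (\<phi> - ground \<alpha>) \<and>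
      \<bar>virial2 \<alpha> \<phi> - q0 \<alpha> * (2 * ((\<phi> - ground \<alpha>)$4 - (\<phi> - ground \<alpha>)$1)
        + (\<alpha> + 2)\<^sup>2 * (\<phi> - ground \<alpha>)$1)\<bar> \<le> c * norm (\<phi> - ground \<alpha>) \<and>
      \<bar>(\<alpha> + 2) * ((\<phi>$1)\<^sup>2 - sq \<phi> * att \<alpha> \<phi>) - (\<alpha> + 2)\<^sup>2 * q0 \<alpha> * (\<phi> - ground \<alpha>)$1\<bar> \<le> c * norm (\<phi> - ground \<alpha>) \<and>
      \<bar>Lam1 \<alpha> g p \<phi>\<bar> \<le> M1 * norm (\<phi> - ground \<alpha>) \<and> \<bar>virial1 \<phi>\<bar> \<le> M2 * norm (\<phi> - ground \<alpha>) \<and>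
      \<bar>Lam g p (\<phi> - ground \<alpha>)\<bar> \<le> M3 * norm (\<phi> - ground \<alpha>)"
    using ev1 ev2 ev3 ev4 by eventually_elim (intro conjI; assumption)
  then obtain \<rho>' where \<rho>': "\<rho>' > 0" and all: "\<And>\<phi>. dist \<phi> (ground \<alpha>) < \<rho>' \<Longrightarrow> \<phi> \<in> phase_space \<and>
      H2 \<alpha> (\<phi> - ground \<alpha>) + (Lam g p (\<phi> - ground \<alpha>))\<^sup>2 < R \<and>
      \<bar>Lam2 \<alpha> g p \<phi> - k\<^sup>2 * Lam g p (\<phi> - ground \<alpha>)\<bar> \<le> c * norm (\<phi> - ground \<alpha>) \<and>
      \<bar>virial2 \<alpha> \<phi> - q0 \<alpha> * (2 * ((\<phi> - ground \<alpha>)$4 - (\<phi> - ground \<alpha>)$1)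
        + (\<alpha> + 2)\<^sup>2 * (\<phi> - ground \<alpha>)$1)\<bar> \<le> c * norm (\<phi> - ground \<alpha>) \<and>
      \<bar>(\<alpha> + 2) * ((\<phi>$1)\<^sup>2 - sq \<phi> * att \<alpha> \<phi>) - (\<alpha> + 2)\<^sup>2 * q0 \<alpha> * (\<phi> - ground \<alpha>)$1\<bar> \<le> c * norm (\<phi> - ground \<alpha>) \<and>
      \<bar>Lam1 \<alpha> g p \<phi>\<bar> \<le> M1 * norm (\<phi> - ground \<alpha>) \<and> \<bar>virial1 \<phi>\<bar> \<le> M2 * norm (\<phi> - ground \<alpha>) \<and>
      \<bar>Lam g p (\<phi> - ground \<alpha>)\<bar> \<le> M3 * norm (\<phi> - ground \<alpha>)"
    unfolding eventually_nhds_metric by blast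
  show ?thesis
  proof (rule that[of "\<rho>' / 2" M])
    show "0 < \<rho>' / 2" "0 < M" using \<rho>' M by auto
    fix \<phi> assume "norm (\<phi> - ground \<alpha>) \<le> \<rho>' / 2"
    then have a: "dist \<phi> (ground \<alpha>) < \<rho>'" using \<rho>' by (simp add: dist_norm)
    note all = all[OF a]
    show ps: "\<phi> \<in> phase_space" using all by (elim conjE)
    show "\<bar>Lam2 \<alpha> g p \<phi> - k\<^sup>2 * Lam g p (\<phi> - ground \<alpha>)\<bar> \<le> c * norm (\<phi> - ground \<alpha>)"
      using all by (elim conjE)
    show "\<bar>virial2 \<alpha> \<phi> - q0 \<alpha> * (2 * ((\<phi> - ground \<alpha>)$4 - (\<phi> - ground \<alpha>)$1)
        + (\<alpha> + 2)\<^sup>2 * (\<phi> - ground \<alpha>)$1)\<bar> \<le> c * norm (\<phi> - ground \<alpha>)"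
      using all by (elim conjE)
    show "\<bar>W \<alpha> \<phi> - (\<alpha> + 2)\<^sup>2 * q0 \<alpha> * (\<phi> - ground \<alpha>)$1\<bar> \<le> c * norm (\<phi> - ground \<alpha>)"
      unfolding W_eq'[OF ps] using all by (elim conjE)
    show "H2 \<alpha> (\<phi> - ground \<alpha>) + (Lam g p (\<phi> - ground \<alpha>))\<^sup>2 \<le> R"
      using all by (elim conjE) (rule less_imp_le)
    show "\<bar>Lam1 \<alpha> g p \<phi>\<bar> \<le> M * norm (\<phi> - ground \<alpha>)"
      using all by (elim conjE) (rule le[OF _ M(2)])
    show "\<bar>virial1 \<phi>\<bar> \<le> M * norm (\<phi> - ground \<alpha>)"
      using all by (elim conjE) (rule le[OF _ M(3)])
    show "\<bar>Lam g p (\<phi> - ground \<alpha>)\<bar> \<le> M * norm (\<phi> - ground \<alpha>)"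
      using all by (elim conjE) (rule le[OF _ M(4)])
  qed
qed

text \<open>Here e stands for E - E_star. The hypotheses give 9/10 H2 \<le> \<epsilon>^2 +
  \<Lambda>^2/10; the thresholds work because 10/9 (1/3 + 1/10) < 1/2 and 10/9 (1/49 + 1/10) < 1/7.
  The first threshold holds at the exit, the second once |\<Lambda>| is at least 7
  \<epsilon>.\<close>

lemma unstable_coordinate_dominates:
  fixes X :: "real^4"
  assumes \<alpha>: "2 \<le> \<alpha>" "\<alpha> + 2 \<le> g" "0 < p" "p * (\<alpha> + 2) \<le> 2 / 5"
    and e: "e < \<epsilon>\<^sup>2" "\<bar>e - H2 \<alpha> X\<bar> \<le> (H2 \<alpha> X + (Lam g p X)\<^sup>2) / 10"
  shows "3 * \<epsilon>\<^sup>2 \<le> (Lam g p X)\<^sup>2 \<Longrightarrow> H2 \<alpha> X \<le> (Lam g p X)\<^sup>2 / 2"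
    "3 * \<epsilon>\<^sup>2 \<le> (Lam g p X)\<^sup>2 \<Longrightarrow> norm X \<le> 6 * \<bar>Lam g p X\<bar>"
    "49 * \<epsilon>\<^sup>2 \<le> (Lam g p X)\<^sup>2 \<Longrightarrow> H2 \<alpha> X \<le> (Lam g p X)\<^sup>2 / 7"
proof -
  have H: "9 / 10 * H2 \<alpha> X \<le> \<epsilon>\<^sup>2 + (Lam g p X)\<^sup>2 / 10" using e by argo
  have L: "0 \<le> (Lam g p X)\<^sup>2" by simp
  { assume 3: "3 * \<epsilon>\<^sup>2 \<le> (Lam g p X)\<^sup>2"
    show 1: "H2 \<alpha> X \<le> (Lam g p X)\<^sup>2 / 2" using H 3 L by argo
    have "(norm X)\<^sup>2 \<le> 20 * (H2 \<alpha> X + (Lam g p X)\<^sup>2)"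
      by (rule unstable_coordinate_quadratic_bound) (use assms in auto)
    then have "(norm X)\<^sup>2 \<le> 36 * (Lam g p X)\<^sup>2" using 1 L by argo
    then have "(norm X)\<^sup>2 \<le> (6 * \<bar>Lam g p X\<bar>)\<^sup>2" by (simp add: power_mult_distrib)
    then show "norm X \<le> 6 * \<bar>Lam g p X\<bar>" by (rule power2_le_imp_le) simp }
  { assume 49: "49 * \<epsilon>\<^sup>2 \<le> (Lam g p X)\<^sup>2"
    show "H2 \<alpha> X \<le> (Lam g p X)\<^sup>2 / 7" using H 49 L by argo }
qed

text \<open>The disc given by s1 is fixed before \<epsilon>. This order of quantifiers matters
  because \<open>collapse\<close> requires \<epsilon> to be small compared with the gap between s1
  and q0^2.\<close>

lemma ejection:
  assumes \<alpha>: "2 \<le> \<alpha>" and k: "0 < k" and g: "\<alpha> + 2 \<le> g" "g \<le> 28 / 25 * (\<alpha> + 2)"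
    and p: "0 < p" "p * (\<alpha> + 2) \<le> 2 / 5"
    and rel: "(1 - 2 * p) * (\<alpha> + 2)\<^sup>2 = k\<^sup>2" "2 * (1 - 2 * p) - p * (\<alpha> + 2) = k\<^sup>2 * p"
    and R: "0 < R"
    and adm: "\<And>\<phi>. \<phi> \<in> phase_space \<Longrightarrow> H2 \<alpha> (\<phi> - ground \<alpha>) + (Lam g p (\<phi> - ground \<alpha>))\<^sup>2 \<le> R \<Longrightarrow>
      \<bar>energy \<alpha> \<phi> - E_star \<alpha> - H2 \<alpha> (\<phi> - ground \<alpha>)\<bar>
        \<le> (H2 \<alpha> (\<phi> - ground \<alpha>) + (Lam g p (\<phi> - ground \<alpha>))\<^sup>2) / 10"
  obtains s1 \<epsilon>0 where "s1 < (q0 \<alpha>)\<^sup>2" "0 < \<epsilon>0"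
    "\<And>\<epsilon> \<phi> a T. 0 < \<epsilon> \<Longrightarrow> \<epsilon> < \<epsilon>0 \<Longrightarrow> trajectory \<alpha> \<phi> a T \<Longrightarrow> energy \<alpha> (\<phi> a) < E_star \<alpha> + \<epsilon>\<^sup>2 \<Longrightarrow>
      H2 \<alpha> (\<phi> a - ground \<alpha>) + (Lam g p (\<phi> a - ground \<alpha>))\<^sup>2 \<le> 5 * \<epsilon>\<^sup>2 \<Longrightarrow>
      3 * \<epsilon>\<^sup>2 < (Lam g p (\<phi> a - ground \<alpha>))\<^sup>2 \<Longrightarrow>
      0 \<le> Lam g p (\<phi> a - ground \<alpha>) * Lam1 \<alpha> g p (\<phi> a) \<Longrightarrow> W \<alpha> (\<phi> a) < 0 \<Longrightarrow>
      \<exists>t\<ge>a. ereal t < T \<and> sq (\<phi> t) \<le> s1 \<and> virial1 (\<phi> t) < 0"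
proof -
  define q where "q = q0 \<alpha>"
  define \<beta> where "\<beta> = \<alpha> + 2"
  have q: "0 < q" using q0[of \<alpha>] \<alpha> by (simp add: q_def)
  have \<beta>: "4 \<le> \<beta>" using \<alpha> by (simp add: \<beta>_def)
  \<comment> \<open>Since the displacement will satisfy |X| \<le> 6 |\<Lambda>|, the Taylor errors c
    |X| are at most k^2 |\<Lambda>|/2 in the acceleration of \<Lambda> and q |\<Lambda>|/10 in
    \<open>virial2\<close> and \<open>W\<close>.\<close>
  define c where "c = min (k\<^sup>2 / 12) (q / 60)"
  have c: "0 < c" "12 * c \<le> k\<^sup>2" "60 * c \<le> q" using k q by (auto simp: c_def)
  obtain \<rho> M where \<rho>: "0 < \<rho>" and M: "0 < M" and nbh:
    "\<And>\<phi>. norm (\<phi> - ground \<alpha>) \<le> \<rho> \<Longrightarrow> \<phi> \<in> phase_space"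
    "\<And>\<phi>. norm (\<phi> - ground \<alpha>) \<le> \<rho> \<Longrightarrow> H2 \<alpha> (\<phi> - ground \<alpha>) + (Lam g p (\<phi> - ground \<alpha>))\<^sup>2 \<le> R"
    "\<And>\<phi>. norm (\<phi> - ground \<alpha>) \<le> \<rho> \<Longrightarrow> \<bar>Lam2 \<alpha> g p \<phi> - k\<^sup>2 * Lam g p (\<phi> - ground \<alpha>)\<bar> \<le> c * norm (\<phi> - ground \<alpha>)"
    "\<And>\<phi>. norm (\<phi> - ground \<alpha>) \<le> \<rho> \<Longrightarrow> \<bar>virial2 \<alpha> \<phi> - q * (2 * ((\<phi> - ground \<alpha>)$4 - (\<phi> - ground \<alpha>)$1)
      + \<beta>\<^sup>2 * (\<phi> - ground \<alpha>)$1)\<bar> \<le> c * norm (\<phi> - ground \<alpha>)"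
    "\<And>\<phi>. norm (\<phi> - ground \<alpha>) \<le> \<rho> \<Longrightarrow> \<bar>W \<alpha> \<phi> - \<beta>\<^sup>2 * q * (\<phi> - ground \<alpha>)$1\<bar> \<le> c * norm (\<phi> - ground \<alpha>)"
    "\<And>\<phi>. norm (\<phi> - ground \<alpha>) \<le> \<rho> \<Longrightarrow> \<bar>Lam1 \<alpha> g p \<phi>\<bar> \<le> M * norm (\<phi> - ground \<alpha>)"
    "\<And>\<phi>. norm (\<phi> - ground \<alpha>) \<le> \<rho> \<Longrightarrow> \<bar>virial1 \<phi>\<bar> \<le> M * norm (\<phi> - ground \<alpha>)"
    "\<And>\<phi>. norm (\<phi> - ground \<alpha>) \<le> \<rho> \<Longrightarrow> \<bar>Lam g p (\<phi> - ground \<alpha>)\<bar> \<le> M * norm (\<phi> - ground \<alpha>)"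
    using ground_neighbourhood[OF \<alpha> rel c(1) R, where g = g, folded q_def \<beta>_def] by blast
  \<comment> \<open>The first bound gives 6 \<delta>1 < \<rho>, so |X| \<le> 6 |\<Lambda>| keeps the
    orbit in the neighbourhood. The second makes the quadratic part of r^2, at most 36 \<delta>1^2,
    no larger than half of the linear gain 2 q \<delta>1/(3 \<beta>); \<open>s1\<close> records the
    other half.\<close>
  define \<delta>1 where "\<delta>1 = min (\<rho> / 12) (q / (108 * \<beta>))"
  have \<delta>1: "0 < \<delta>1" "6 * \<delta>1 < \<rho>" "108 * \<beta> * \<delta>1 \<le> q"
  proof -
    show "0 < \<delta>1" "6 * \<delta>1 < \<rho>" using \<rho> q \<beta> by (auto simp: \<delta>1_def)
    have "108 * \<beta> * \<delta>1 \<le> 108 * \<beta> * (q / (108 * \<beta>))"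
      using \<beta> by (intro mult_left_mono) (auto simp: \<delta>1_def)
    then show "108 * \<beta> * \<delta>1 \<le> q" using \<beta> by simp
  qed
  define s1 where "s1 = q\<^sup>2 - q * \<delta>1 / (3 * \<beta>)"
  \<comment> \<open>With |\<open>Lam1\<close>| \<le> 6 M |\<Lambda>|, this m makes m
    |\<open>Lam1\<close>| at most q |\<Lambda>|/6, the guaranteed decay rate of the virial.\<close>
  define m where "m = q / (36 * M)"
  have m: "0 < m" "6 * M * m = q / 6" using q M by (auto simp: m_def)
  \<comment> \<open>At the start |X| \<le> 10 \<epsilon>, hence |\<Lambda>| \<le> 10 M \<epsilon>;
    so (10 M + 7) \<epsilon> bounds the value \<open>L0\<close> below. The three bounds put the
    start inside the neighbourhood, keep \<open>L0\<close> under \<open>\<delta>1\<close>, and make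
    (6 M + m) \<open>L0\<close> smaller than m \<open>\<delta>1\<close>.\<close>
  define \<epsilon>0 where "\<epsilon>0 = min (\<rho> / 20) (min (\<delta>1 / (10 * M + 7)) (m * \<delta>1 / ((6 * M + m) * (10 * M + 7))))"
  have \<epsilon>0: "0 < \<epsilon>0" using \<rho> \<delta>1 M m by (simp add: \<epsilon>0_def)
  show thesis
  proof (rule that)
    show "s1 < (q0 \<alpha>)\<^sup>2" using q \<delta>1 \<beta> by (simp add: s1_def q_def)
    show "0 < \<epsilon>0" by (fact \<epsilon>0)
    fix \<epsilon> :: real and \<phi> a T
    assume \<epsilon>: "0 < \<epsilon>" "\<epsilon> < \<epsilon>0" and traj: "trajectory \<alpha> \<phi> a T"
      and E: "energy \<alpha> (\<phi> a) < E_star \<alpha> + \<epsilon>\<^sup>2"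
      and Na: "H2 \<alpha> (\<phi> a - ground \<alpha>) + (Lam g p (\<phi> a - ground \<alpha>))\<^sup>2 \<le> 5 * \<epsilon>\<^sup>2"
      and La: "3 * \<epsilon>\<^sup>2 < (Lam g p (\<phi> a - ground \<alpha>))\<^sup>2"
      and L1a: "0 \<le> Lam g p (\<phi> a - ground \<alpha>) * Lam1 \<alpha> g p (\<phi> a)" and Wa: "W \<alpha> (\<phi> a) < 0"
    have \<epsilon>': "20 * \<epsilon> < \<rho>" "(10 * M + 7) * \<epsilon> < \<delta>1" "(6 * M + m) * ((10 * M + 7) * \<epsilon>) < m * \<delta>1"
    proof -
      have "\<epsilon> < \<rho> / 20" "\<epsilon> < \<delta>1 / (10 * M + 7)" "\<epsilon> < m * \<delta>1 / ((6 * M + m) * (10 * M + 7))"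
        using \<epsilon> by (auto simp: \<epsilon>0_def)
      moreover have "0 < 10 * M + 7" "0 < (6 * M + m) * (10 * M + 7)" using M m by auto
      ultimately show "20 * \<epsilon> < \<rho>" "(10 * M + 7) * \<epsilon> < \<delta>1" "(6 * M + m) * ((10 * M + 7) * \<epsilon>) < m * \<delta>1"
        by (simp_all add: pos_less_divide_eq mult.commute mult.left_commute)
    qed
    define X where "X t = \<phi> t - ground \<alpha>" for t
    define l where "l t = - Lam g p (X t)" for t
    define ls where "ls = sqrt 3 * \<epsilon>"
    have aT: "ereal a < T" and tr: "\<And>t. a \<le> t \<Longrightarrow> ereal t < T \<Longrightarrow> \<phi> t \<in> phase_space"
      "\<And>t. a \<le> t \<Longrightarrow> ereal t < T \<Longrightarrow> energy \<alpha> (\<phi> t) = energy \<alpha> (\<phi> a)"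
      "\<And>t. a \<le> t \<Longrightarrow> ereal t < T \<Longrightarrow> (\<phi> has_vector_derivative J *v egrad \<alpha> (\<phi> t)) (at t)"
      and inext: "\<And>K t1. T < \<infinity> \<Longrightarrow> compact K \<Longrightarrow> K \<subseteq> phase_space \<Longrightarrow> a \<le> t1 \<Longrightarrow> ereal t1 < T \<Longrightarrow>
        \<exists>t\<ge>t1. ereal t < T \<and> \<phi> t \<notin> K"
      using traj unfolding trajectory_def by blast+
    have ltT: "ereal s < T" if "s \<le> t" "ereal t < T" for s t using that by (meson ereal_less_eq(3) le_less_trans)
    have ls: "0 < ls" "ls\<^sup>2 = 3 * \<epsilon>\<^sup>2" using \<epsilon> by (auto simp: ls_def power_mult_distrib)
    have l2: "(Lam g p (X t))\<^sup>2 = (l t)\<^sup>2" "\<bar>Lam g p (X t)\<bar> = \<bar>l t\<bar>" "Lam g p (- X t) = l t" "H2 \<alpha> (- X t) = H2 \<alpha> (X t)" for t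
      by (simp_all add: l_def Lam_def H2_def algebra_simps power2_eq_square)
    have dom: "H2 \<alpha> (X t) \<le> (l t)\<^sup>2 / 2" "norm (X t) \<le> 6 * \<bar>l t\<bar>"
      "49 * \<epsilon>\<^sup>2 \<le> (l t)\<^sup>2 \<Longrightarrow> H2 \<alpha> (X t) \<le> (l t)\<^sup>2 / 7"
      if "a \<le> t" "ereal t < T" "norm (X t) \<le> \<rho>" "3 * \<epsilon>\<^sup>2 \<le> (l t)\<^sup>2" for t
    proof -
      have "energy \<alpha> (\<phi> t) - E_star \<alpha> < \<epsilon>\<^sup>2" using E tr that by simp
      moreover have "\<bar>energy \<alpha> (\<phi> t) - E_star \<alpha> - H2 \<alpha> (X t)\<bar> \<le> (H2 \<alpha> (X t) + (Lam g p (X t))\<^sup>2) / 10"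
        unfolding X_def using that nbh(2)[of "\<phi> t"] by (intro adm tr) (auto simp: X_def)
      ultimately show "H2 \<alpha> (X t) \<le> (l t)\<^sup>2 / 2" "norm (X t) \<le> 6 * \<bar>l t\<bar>"
        "49 * \<epsilon>\<^sup>2 \<le> (l t)\<^sup>2 \<Longrightarrow> H2 \<alpha> (X t) \<le> (l t)\<^sup>2 / 7"
        using unstable_coordinate_dominates[OF \<alpha> g(1) p, of "energy \<alpha> (\<phi> t) - E_star \<alpha>" \<epsilon> "X t"] that
        by (simp_all add: l2)
    qed
    have Xa: "norm (X a) \<le> 10 * \<epsilon>"
    proof -
      have "(norm (X a))\<^sup>2 \<le> 20 * (H2 \<alpha> (X a) + (Lam g p (X a))\<^sup>2)"
        by (rule unstable_coordinate_quadratic_bound) (use assms in auto)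
      then have "(norm (X a))\<^sup>2 \<le> (10 * \<epsilon>)\<^sup>2" using Na by (simp add: X_def power_mult_distrib)
      then show ?thesis by (rule power2_le_imp_le) (use \<epsilon> in simp)
    qed
    then have Xa': "norm (X a) < \<rho>" using \<epsilon>' \<epsilon> by simp
    have la2: "3 * \<epsilon>\<^sup>2 < (l a)\<^sup>2" using La l2(1)[of a] by (simp add: X_def)
    \<comment> \<open>If \<Lambda> > 0, the cone bounds the linear part of \<open>W\<close> below by
      4/3 q \<Lambda>, while the error is at most q \<Lambda>/10. So W < 0 forces \<Lambda> < 0, and
      \<open>l\<close> is |\<Lambda>|.\<close>
    have "0 < l a"
    proof (rule ccontr)
      assume "\<not> 0 < l a"
      moreover have "l a \<noteq> 0" using la2 by auto
      ultimately have neg: "l a < 0" by simp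
      have "Lam g p (X a) \<le> 3 * (\<alpha> + 2) * X a $ 1"
        by (rule unstable_cone(1)[OF \<alpha> g p]) (use neg dom(1)[of a] Xa' la2 aT in \<open>auto simp: l2(1)\<close>, simp add: l_def)
      then have "- l a \<le> 3 * \<beta> * X a $ 1" by (simp add: l_def \<beta>_def)
      then have "\<beta> * q * (- l a) \<le> \<beta> * q * (3 * \<beta> * X a $ 1)" using \<beta> q by (intro mult_left_mono) auto
      moreover have "4 * q * (- l a) \<le> \<beta> * q * (- l a)" using \<beta> q neg by (intro mult_right_mono) auto
      moreover have "\<beta> * q * (3 * \<beta> * X a $ 1) = 3 * (\<beta>\<^sup>2 * q * X a $ 1)" by (simp add: power2_eq_square)
      ultimately have "4 * q * (- l a) \<le> 3 * (\<beta>\<^sup>2 * q * X a $ 1)" by linarith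
      moreover have "\<bar>W \<alpha> (\<phi> a) - \<beta>\<^sup>2 * q * X a $ 1\<bar> \<le> c * norm (X a)"
        using nbh(5)[of "\<phi> a"] Xa' by (simp add: X_def)
      moreover have "c * norm (X a) \<le> q / 60 * (6 * (- l a))"
        using dom(2)[of a] Xa' la2 aT neg c by (intro mult_mono) auto
      moreover have "0 < q * (- l a)" using q neg by (intro mult_pos_pos) auto
      ultimately show False using Wa by (simp add: algebra_simps)
    qed
    with la2 ls have la: "ls < l a" by (intro power_less_imp_less_base[of ls 2 "l a"]) auto
    have L1a': "Lam1 \<alpha> g p (\<phi> a) \<le> 0"
      using L1a \<open>0 < l a\<close> by (simp add: l_def X_def zero_le_mult_iff)
    have dl: "(l has_real_derivative - Lam1 \<alpha> g p (\<phi> t)) (at t)"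
      "((\<lambda>t. - Lam1 \<alpha> g p (\<phi> t)) has_real_derivative - Lam2 \<alpha> g p (\<phi> t)) (at t)"
      "((\<lambda>t. virial1 (\<phi> t)) has_real_derivative virial2 \<alpha> (\<phi> t)) (at t)"
      if "a \<le> t" "ereal t < T" for t
      unfolding l_def[abs_def] X_def
      using derivatives_along[OF tr(1)[OF that] tr(3)[OF that]] by (auto intro: DERIV_minus)
    have contl: "continuous_on {r..t} l" "continuous_on {r..t} (\<lambda>t. - Lam1 \<alpha> g p (\<phi> t))"
      "continuous_on {r..t} (\<lambda>t. norm (X t))" if "a \<le> r" "ereal t < T" for r t
    proof -
      have T: "a \<le> x" "ereal x < T" if "x \<in> {r..t}" for x
        using that \<open>a \<le> r\<close> ltT[of x t] \<open>ereal t < T\<close> by auto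
      show "continuous_on {r..t} l"
        by (intro continuous_at_imp_continuous_on ballI DERIV_isCont[OF dl(1)[OF T]])
      show "continuous_on {r..t} (\<lambda>t. - Lam1 \<alpha> g p (\<phi> t))"
        by (intro continuous_at_imp_continuous_on ballI DERIV_isCont[OF dl(2)[OF T]])
      have "continuous_on {r..t} \<phi>"
        by (intro continuous_at_imp_continuous_on ballI has_vector_derivative_continuous[OF tr(3)[OF T]])
      then show "continuous_on {r..t} (\<lambda>t. norm (X t))" unfolding X_def by (intro continuous_intros)
    qed
    have accel: "k\<^sup>2 / 2 * l s \<le> - Lam2 \<alpha> g p (\<phi> s)"
      if "a \<le> s" "ereal s < T" "ls \<le> l s" "norm (X s) \<le> \<rho>" for s
    proof -
      have "3 * \<epsilon>\<^sup>2 \<le> (l s)\<^sup>2" using that ls power_mono[of ls "l s" 2] by simp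
      moreover have ls0: "0 < l s" using that(3) ls by simp
      ultimately have "norm (X s) \<le> 6 * l s" using dom(2)[OF that(1,2,4)] by (simp only: abs_of_pos)
      then have "c * norm (X s) \<le> k\<^sup>2 / 12 * (6 * l s)" using c ls0 by (intro mult_mono) auto
      moreover have "\<bar>Lam2 \<alpha> g p (\<phi> s) + k\<^sup>2 * l s\<bar> \<le> c * norm (X s)"
        using nbh(3)[of "\<phi> s"] that by (simp add: X_def l_def)
      ultimately show ?thesis by (simp add: field_simps)
    qed
    \<comment> \<open>The bounds are assumed strictly before t and improved at t itself: l'' \<ge> 0
      and l' \<ge> 0 at the start make l nondecreasing, and its dominance bounds X. This is the form
      that the first-failure argument below consumes.\<close>
    have step: "norm (X t) \<le> 6 * l t" "l a \<le> l t" "\<And>r s. a \<le> r \<Longrightarrow> r \<le> s \<Longrightarrow> s \<le> t \<Longrightarrow> l r \<le> l s"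
      if t: "a \<le> t" "ereal t < T" and bar: "\<And>s. a \<le> s \<Longrightarrow> s < t \<Longrightarrow> ls < l s \<and> norm (X s) < \<rho>" for t
    proof -
      have sT: "ereal s < T" if "s \<le> t" for s using ltT that t by blast
      have Xt: "norm (X t) \<le> \<rho>"
      proof (rule ccontr)
        assume "\<not> norm (X t) \<le> \<rho>"
        then have "\<rho> \<le> norm (X t)" "\<rho> \<noteq> norm (X t)" by auto
        from first_crossing[OF contl(3)[OF order_refl t(2)] t(1) Xa' this(1)]
        obtain t' where "a < t'" "t' \<le> t" "norm (X t') = \<rho>" by metis
        then show False using bar[of t'] \<open>\<rho> \<noteq> norm (X t)\<close> by (cases "t' = t") auto
      qed
      have vel: "0 \<le> - Lam1 \<alpha> g p (\<phi> s)" if "a \<le> s" "s \<le> t" for s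
      proof -
        have "- Lam1 \<alpha> g p (\<phi> a) \<le> - Lam1 \<alpha> g p (\<phi> s)"
        proof (rule DERIV_nonneg_imp_increasing_open[OF that(1)])
          fix x assume x: "a < x" "x < s"
          then have "a \<le> x" "ereal x < T" "ls < l x" "norm (X x) < \<rho>" using that bar[of x] sT by auto
          moreover from this have "0 \<le> k\<^sup>2 / 2 * l x" using ls by simp
          ultimately show "\<exists>y. ((\<lambda>s. - Lam1 \<alpha> g p (\<phi> s)) has_real_derivative y) (at x) \<and> 0 \<le> y"
            using dl(2)[of x] accel[of x] by (intro exI[of _ "- Lam2 \<alpha> g p (\<phi> x)"]) auto
        qed (use contl(2)[of a s] sT that in auto)
        then show ?thesis using L1a' by simp
      qed
      show mono: "l r \<le> l s" if "a \<le> r" "r \<le> s" "s \<le> t" for r s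
      proof (rule DERIV_nonneg_imp_nondecreasing[OF that(2)])
        fix x assume "r \<le> x" "x \<le> s"
        then have "a \<le> x" "x \<le> t" using that by auto
        then show "\<exists>y. (l has_real_derivative y) (at x) \<and> 0 \<le> y"
          using dl(1)[of x] vel[of x] sT[of x] by blast
      qed
      show lt: "l a \<le> l t" using mono[of a t] t by simp
      then have "3 * \<epsilon>\<^sup>2 \<le> (l t)\<^sup>2" using la ls power_mono[of ls "l t" 2] by simp
      moreover have "0 < l t" using lt la ls by simp
      ultimately show "norm (X t) \<le> 6 * l t" using dom(2)[OF t Xt] by (simp only: abs_of_pos)
    qed
    \<comment> \<open>Bootstrap: \<open>f\<close> is negative as long as both bounds hold. At its
      first zero \<open>step\<close> gives l \<ge> l a > ls and |X| \<le> 6 \<delta>1 < \<rho>, so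
      neither bound can fail.\<close>
    have barrier: "ls < l t \<and> norm (X t) < \<rho>"
      if t: "a \<le> t" "ereal t < T" and low: "\<And>s. a \<le> s \<Longrightarrow> s \<le> t \<Longrightarrow> l s \<le> \<delta>1" for t
    proof (rule ccontr)
      define f where "f s = max (ls - l s) (norm (X s) - \<rho>)" for s
      assume "\<not> ?thesis"
      then have "0 \<le> f t" by (auto simp: f_def)
      moreover have "f a < 0" using la Xa' by (simp add: f_def)
      moreover have "continuous_on {a..t} f"
        unfolding f_def
        by (intro continuous_on_max continuous_on_diff continuous_on_const contl[OF order_refl t(2)])
      ultimately obtain t' where t': "a < t'" "t' \<le> t" "f t' = 0" "\<And>s. a \<le> s \<Longrightarrow> s < t' \<Longrightarrow> f s < 0"
        using first_crossing[of a t f 0] t(1) by metis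
      have bar: "ls < l s \<and> norm (X s) < \<rho>" if "a \<le> s" "s < t'" for s
        using t'(4)[OF that] by (auto simp: f_def)
      have t'T: "a \<le> t'" "ereal t' < T" using t' ltT t(2) by auto
      have "norm (X t') \<le> 6 * l t'" "l a \<le> l t'" using step(1,2)[OF t'T bar] by simp_all
      moreover have "l t' \<le> \<delta>1" using low t' by simp
      ultimately have "f t' < 0" using la \<delta>1(2) by (simp add: f_def)
      then show False using t' by simp
    qed
    have l_a: "l a \<le> 10 * M * \<epsilon>"
    proof -
      have "l a \<le> M * norm (X a)" using nbh(8)[of "\<phi> a"] Xa' by (simp add: X_def l_def)
      also have "\<dots> \<le> M * (10 * \<epsilon>)" using Xa M by (intro mult_left_mono) auto
      finally show ?thesis by simp
    qed
    then have la\<delta>: "l a < \<delta>1" using \<epsilon>'(2) \<epsilon> by (simp add: algebra_simps)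
    \<comment> \<open>Otherwise the bounds hold for all times. For finite T the orbit would remain
      in a compact ball of the phase space; for infinite T the acceleration bound forces l to grow
      at least quadratically.\<close>
    have "\<exists>t\<ge>a. ereal t < T \<and> \<delta>1 \<le> l t"
    proof (rule ccontr)
      assume "\<not> ?thesis"
      then have low: "l t < \<delta>1" if "a \<le> t" "ereal t < T" for t using that by force
      have bar: "ls < l t \<and> norm (X t) < \<rho>" if "a \<le> t" "ereal t < T" for t
        using that low ltT by (intro barrier) (auto intro: less_imp_le)
      show False
      proof (cases "T < \<infinity>")
        case True
        have "cball (ground \<alpha>) \<rho> \<subseteq> phase_space"
          using nbh(1) by (auto simp: dist_norm norm_minus_commute)
        then obtain t where "a \<le> t" "ereal t < T" "\<phi> t \<notin> cball (ground \<alpha>) \<rho>"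
          using inext[OF True compact_cball _ order_refl aT] by blast
        then show False using bar[of t] by (simp add: X_def dist_norm norm_minus_commute)
      next
        case False
        then have T: "ereal t < T" for t by (cases T) auto
        define b where "b = k\<^sup>2 / 2 * l a"
        have b: "0 < b" using k la ls by (simp add: b_def)
        have vel: "b * (t - a) \<le> - Lam1 \<alpha> g p (\<phi> t)" if "a \<le> t" for t
        proof -
          have "- Lam1 \<alpha> g p (\<phi> a) - b * (a - a) \<le> - Lam1 \<alpha> g p (\<phi> t) - b * (t - a)"
          proof (rule DERIV_nonneg_imp_nondecreasing[OF that])
            fix x assume x: "a \<le> x" "x \<le> t"
            have "l a \<le> l x" by (rule step(2)[OF x(1) T]) (use bar T in blast)
            then have "b \<le> k\<^sup>2 / 2 * l x" unfolding b_def by (intro mult_left_mono) auto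
            also have "\<dots> \<le> - Lam2 \<alpha> g p (\<phi> x)" using accel[OF x(1) T] bar[OF x(1) T] by simp
            finally have "0 \<le> - Lam2 \<alpha> g p (\<phi> x) - b" by simp
            moreover have "((\<lambda>t. b * (t - a)) has_real_derivative b) (at x)"
              by (auto intro!: derivative_eq_intros)
            from DERIV_diff[OF dl(2)[OF x(1) T] this]
            have "((\<lambda>t. - Lam1 \<alpha> g p (\<phi> t) - b * (t - a)) has_real_derivative - Lam2 \<alpha> g p (\<phi> x) - b) (at x)" .
            ultimately show "\<exists>y. ((\<lambda>t. - Lam1 \<alpha> g p (\<phi> t) - b * (t - a)) has_real_derivative y) (at x) \<and> 0 \<le> y"
              by blast
          qed
          then show ?thesis using L1a' by simp
        qed
        have pos: "l a + b / 2 * (t - a)\<^sup>2 \<le> l t" if "a \<le> t" for t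
        proof -
          have "l a - b / 2 * (a - a)\<^sup>2 \<le> l t - b / 2 * (t - a)\<^sup>2"
          proof (rule DERIV_nonneg_imp_nondecreasing[OF that])
            fix x assume x: "a \<le> x" "x \<le> t"
            have "((\<lambda>t. l t - b / 2 * (t - a)\<^sup>2) has_real_derivative - Lam1 \<alpha> g p (\<phi> x) - b * (x - a)) (at x)"
              using dl(1)[OF x(1) T] by (auto intro!: derivative_eq_intros)
            then show "\<exists>y. ((\<lambda>t. l t - b / 2 * (t - a)\<^sup>2) has_real_derivative y) (at x) \<and> 0 \<le> y"
              using vel[OF x(1)] by force
          qed
          then show ?thesis by simp
        qed
        define t where "t = a + sqrt (2 * \<delta>1 / b)"
        have "b / 2 * (t - a)\<^sup>2 = \<delta>1" using b \<delta>1 by (simp add: t_def)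
        moreover have "a \<le> t" using b \<delta>1 by (simp add: t_def)
        ultimately show False using pos[of t] low[of t] T la ls by force
      qed
    qed
    then obtain t2 where t2: "a \<le> t2" "ereal t2 < T" "\<delta>1 \<le> l t2" by blast
    from first_crossing[OF contl(1)[OF order_refl t2(2)] t2(1) la\<delta> t2(3)]
    obtain t1 where t1: "a < t1" "t1 \<le> t2" "l t1 = \<delta>1" "\<And>s. a \<le> s \<Longrightarrow> s < t1 \<Longrightarrow> l s < \<delta>1" by metis
    have t1T: "ereal t1 < T" using ltT t1 t2 by blast
    have sT: "ereal s < T" if "s \<le> t1" for s using ltT that t1T by blast
    have low: "l s \<le> \<delta>1" if "a \<le> s" "s \<le> t1" for s
      using t1(3) t1(4)[of s] that by (cases "s = t1") auto
    have bar: "ls < l s \<and> norm (X s) < \<rho>" if "a \<le> s" "s \<le> t1" for s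
      using that low sT by (intro barrier) auto
    have Xl: "norm (X s) \<le> 6 * l s" "3 * \<epsilon>\<^sup>2 \<le> (l s)\<^sup>2" if "a \<le> s" "s \<le> t1" for s
    proof -
      show "norm (X s) \<le> 6 * l s" by (rule step(1)[OF that(1) sT[OF that(2)]]) (use that bar in auto)
      show "3 * \<epsilon>\<^sup>2 \<le> (l s)\<^sup>2" using bar[OF that] ls power_mono[of ls "l s" 2] by simp
    qed
    have mono: "l r \<le> l s" if "a \<le> r" "r \<le> s" "s \<le> t1" for r s
      by (rule step(3)[OF _ t1T _ that]) (use bar t1 in auto)
    \<comment> \<open>The virial is controlled from l \<ge> 7 \<epsilon> on; the maximum with
      \<open>l a\<close> places the level in the range where the intermediate value theorem
      applies.\<close>
    define L0 where "L0 = max (l a) (7 * \<epsilon>)"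
    have L0: "l a \<le> L0" "L0 \<le> (10 * M + 7) * \<epsilon>" "7 * \<epsilon> \<le> L0" "0 < L0"
      using l_a \<epsilon> M la ls by (auto simp: L0_def algebra_simps)
    have "\<exists>x\<ge>a. x \<le> t1 \<and> l x = L0"
      using L0 t1 \<epsilon>'(2) contl(1)[OF order_refl t1T] by (intro IVT') auto
    then obtain t0 where t0: "a \<le> t0" "t0 \<le> t1" "l t0 = L0" by blast
    \<comment> \<open>Monotonicity of virial plus m l replaces an estimate of the elapsed time:
      while l rises from \<open>L0\<close> to \<open>\<delta>1\<close>, the virial falls by at least
      m (\<open>\<delta>1\<close> - \<open>L0\<close>), and it starts at no more than 6 M
      \<open>L0\<close>.\<close>
    have "virial1 (\<phi> t1) + m * l t1 \<le> virial1 (\<phi> t0) + m * l t0"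
    proof (rule DERIV_nonpos_imp_nonincreasing[OF t0(2)])
      fix s assume s: "t0 \<le> s" "s \<le> t1"
      then have as: "a \<le> s" and sT': "ereal s < T" using t0 sT by auto
      have Xs: "norm (X s) \<le> \<rho>" using bar[OF as s(2)] by simp
      have ls7: "7 * \<epsilon> \<le> l s" using mono[OF t0(1) s] t0 L0 by simp
      then have "49 * \<epsilon>\<^sup>2 \<le> (l s)\<^sup>2" using power_mono[of "7 * \<epsilon>" "l s" 2] \<epsilon> by (simp add: power_mult_distrib)
      then have "H2 \<alpha> (- X s) \<le> (Lam g p (- X s))\<^sup>2 / 7"
        using dom(3)[OF as sT' Xs Xl(2)[OF as s(2)]] by (simp add: l2)
      moreover have lpos: "0 < l s" using ls7 \<epsilon> by simp
      ultimately have "Lam g p (- X s) \<le> 3 * (2 * ((- X s)$4 - (- X s)$1) + (\<alpha> + 2)\<^sup>2 * (- X s)$1)"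
        by (intro unstable_cone(2)[OF \<alpha> g p]) (auto simp: l2)
      then have cone: "l s \<le> - 3 * (2 * (X s$4 - X s$1) + \<beta>\<^sup>2 * X s$1)" by (simp add: l2 \<beta>_def algebra_simps)
      have "q * (2 * (X s$4 - X s$1) + \<beta>\<^sup>2 * X s$1) \<le> q * (- l s / 3)"
        using cone q by (intro mult_left_mono) auto
      moreover have "c * norm (X s) \<le> q / 60 * (6 * l s)"
        using Xl(1)[OF as s(2)] c by (intro mult_mono) auto
      moreover have "\<bar>virial2 \<alpha> (\<phi> s) - q * (2 * (X s$4 - X s$1) + \<beta>\<^sup>2 * X s$1)\<bar> \<le> c * norm (X s)"
        using nbh(4)[of "\<phi> s"] Xs by (simp add: X_def)
      ultimately have v2: "virial2 \<alpha> (\<phi> s) \<le> - (q * l s / 6)"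
        using mult_pos_pos[OF q lpos] by (simp add: field_simps)
      have "\<bar>Lam1 \<alpha> g p (\<phi> s)\<bar> \<le> M * norm (X s)" using nbh(6)[of "\<phi> s"] Xs by (simp add: X_def)
      also have "\<dots> \<le> M * (6 * l s)" using Xl(1)[OF as s(2)] M by (intro mult_left_mono) auto
      finally have "m * (- Lam1 \<alpha> g p (\<phi> s)) \<le> m * (M * (6 * l s))" using m by (intro mult_left_mono) auto
      also have "\<dots> = (6 * M * m) * l s" by simp
      finally have "virial2 \<alpha> (\<phi> s) + m * (- Lam1 \<alpha> g p (\<phi> s)) \<le> 0" using v2 m(2) by simp
      moreover have "((\<lambda>s. virial1 (\<phi> s) + m * l s) has_real_derivative virial2 \<alpha> (\<phi> s) + m * (- Lam1 \<alpha> g p (\<phi> s))) (at s)"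
        using dl(1,3)[OF as sT'] by (auto intro!: derivative_eq_intros)
      ultimately show "\<exists>y. ((\<lambda>s. virial1 (\<phi> s) + m * l s) has_real_derivative y) (at s) \<and> y \<le> 0" by blast
    qed
    moreover have "virial1 (\<phi> t0) \<le> 6 * M * L0"
    proof -
      have "virial1 (\<phi> t0) \<le> M * norm (X t0)" using nbh(7)[of "\<phi> t0"] bar[OF t0(1,2)] by (simp add: X_def)
      also have "\<dots> \<le> M * (6 * L0)" using Xl(1)[OF t0(1,2)] t0 M by (intro mult_left_mono) auto
      finally show ?thesis by simp
    qed
    moreover have "(6 * M + m) * L0 \<le> (6 * M + m) * ((10 * M + 7) * \<epsilon>)"
      using L0 M m by (intro mult_left_mono) auto
    ultimately have "virial1 (\<phi> t1) < 0" using \<epsilon>'(3) t0 t1 by (simp add: algebra_simps)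
    moreover have "sq (\<phi> t1) \<le> s1"
    proof -
      have t1': "a \<le> t1" using t1 by simp
      have Xs: "norm (X t1) \<le> \<rho>" using bar[OF t1'] by simp
      have "H2 \<alpha> (- X t1) \<le> (Lam g p (- X t1))\<^sup>2 / 2"
        using dom(1)[OF t1' t1T Xs Xl(2)[OF t1']] by (simp add: l2)
      then have "Lam g p (- X t1) \<le> 3 * (\<alpha> + 2) * (- X t1)$1"
        using t1 \<delta>1 by (intro unstable_cone(1)[OF \<alpha> g p]) (auto simp: l2)
      then have x: "\<delta>1 / (3 * \<beta>) \<le> - X t1$1" using \<beta> t1 by (simp add: l2 \<beta>_def field_simps)
      have "(X t1$1)\<^sup>2 + (X t1$2)\<^sup>2 \<le> (norm (X t1))\<^sup>2"
        unfolding power2_norm_eq_inner inner_real4 by (simp add: power2_eq_square)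
      also have "\<dots> \<le> (6 * \<delta>1)\<^sup>2" using Xl(1)[OF t1'] t1 by (intro power_mono) auto
      also have "\<dots> = 36 * \<delta>1 * \<delta>1" by (simp add: power2_eq_square)
      also have "\<dots> \<le> q / (3 * \<beta>) * \<delta>1"
        using \<delta>1 \<beta> by (intro mult_right_mono) (auto simp: field_simps)
      finally have "(X t1$1)\<^sup>2 + (X t1$2)\<^sup>2 \<le> q * \<delta>1 / (3 * \<beta>)" by simp
      moreover have "sq (\<phi> t1) = q\<^sup>2 + 2 * q * X t1$1 + ((X t1$1)\<^sup>2 + (X t1$2)\<^sup>2)"
        by (simp add: sq_def X_def q_def power2_eq_square algebra_simps)
      moreover have "2 * q * X t1$1 \<le> 2 * q * (- (\<delta>1 / (3 * \<beta>)))" using x q by (intro mult_left_mono) auto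
      ultimately show ?thesis by (simp add: s1_def)
    qed
    ultimately show "\<exists>t\<ge>a. ereal t < T \<and> sq (\<phi> t) \<le> s1 \<and> virial1 (\<phi> t) < 0"
      using t1 t1T by (intro exI[of _ t1]) auto
  qed
qed

section \<open>Collision\<close>

text \<open>The smallness condition absorbs the \<epsilon> terms of \<open>virial_inequality\<close>
  throughout the disc of squared radius s1, so r^2 is concave there. A negative slope then persists
  and brings r^2 to zero at a bounded time, which rules out an infinite T.\<close>

lemma collapse:
  assumes \<alpha>: "2 \<le> \<alpha>" and traj: "trajectory \<alpha> \<phi> a T"
    and E: "energy \<alpha> (\<phi> a) < E_star \<alpha> + \<epsilon>\<^sup>2" and \<epsilon>: "0 \<le> \<epsilon>"
    and s1: "sq (\<phi> a) \<le> s1" "s1 < (q0 \<alpha>)\<^sup>2" and v: "virial1 (\<phi> a) < 0"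
    and small: "2 * \<epsilon>\<^sup>2 + 4 * q0 \<alpha> * \<epsilon> \<le> 4 * ((q0 \<alpha>)\<^sup>2 - s1)"
  shows "T < \<infinity>" "((\<lambda>t. sq (\<phi> t)) \<longlongrightarrow> 0) (at_left (real_of_ereal T))"
proof -
  have \<alpha>0: "0 < \<alpha>" using \<alpha> by simp
  note q = q0[OF \<alpha>0] and ground = ground_values[OF \<alpha>0]
  have aT: "ereal a < T" and tr: "\<And>t. a \<le> t \<Longrightarrow> ereal t < T \<Longrightarrow> \<phi> t \<in> phase_space"
    "\<And>t. a \<le> t \<Longrightarrow> ereal t < T \<Longrightarrow> energy \<alpha> (\<phi> t) = energy \<alpha> (\<phi> a)"
    "\<And>t. a \<le> t \<Longrightarrow> ereal t < T \<Longrightarrow> (\<phi> has_vector_derivative J *v egrad \<alpha> (\<phi> t)) (at t)"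
    and inext: "\<And>K t1. T < \<infinity> \<Longrightarrow> compact K \<Longrightarrow> K \<subseteq> phase_space \<Longrightarrow> a \<le> t1 \<Longrightarrow> ereal t1 < T \<Longrightarrow>
      \<exists>t\<ge>t1. ereal t < T \<and> \<phi> t \<notin> K"
    using traj unfolding trajectory_def by blast+
  have ltT: "ereal s < T" if "s \<le> t" "ereal t < T" for s t using that by (meson ereal_less_eq(3) le_less_trans)
  note deriv = derivatives_along[OF tr(1) tr(3)]
  have pos: "0 < sq (\<phi> t)" if "a \<le> t" "ereal t < T" for t
    using tr(1)[OF that] by (simp add: phase_space_iff)
  have concave: "virial2 \<alpha> (\<phi> t) \<le> 0" if t: "a \<le> t" "ereal t < T" and sq: "sq (\<phi> t) \<le> s1" for t
  proof -
    let ?x = "\<phi> t$1" and ?y = "\<phi> t$2" and ?u = "\<phi> t$3 + \<phi> t$2" and ?v = "\<phi> t$4 - \<phi> t$1"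
    have "?u\<^sup>2 + ?v\<^sup>2 + 2 * (?x * ?v - ?y * ?u) + (\<alpha> + 2) * (?x\<^sup>2 - \<alpha> * sq (\<phi> t) powr (- \<alpha> / 2))
        \<le> - 4 * ((q0 \<alpha>)\<^sup>2 - sq (\<phi> t)) + 2 * \<epsilon>\<^sup>2 + 4 * sqrt ((q0 \<alpha>)\<^sup>2) * \<epsilon>"
    proof (rule virial_inequality[OF \<alpha> pos[OF t] _ refl q(2) _ \<epsilon>])
      show "sq (\<phi> t) < (q0 \<alpha>)\<^sup>2" using sq s1 by simp
      show "sq (\<phi> t) = ?x\<^sup>2 + ?y\<^sup>2" by (simp add: sq_def)
      have "energy \<alpha> (\<phi> t) \<le> E_star \<alpha> + \<epsilon>\<^sup>2" using E tr(2)[OF t] by simp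
      then show "(?u\<^sup>2 + ?v\<^sup>2) / 2 - (\<alpha> + 2) / 2 * ?x\<^sup>2 - (\<alpha> + 2) * sq (\<phi> t) powr (- \<alpha> / 2)
          \<le> - (\<alpha> + 2)\<^sup>2 / 2 * ((q0 \<alpha>)\<^sup>2 / \<alpha>) + \<epsilon>\<^sup>2"
        unfolding energy_eq ground(5) by simp
    qed
    also have "\<dots> \<le> 0" using small sq q(1) by simp
    finally show ?thesis by (simp add: virial2_def sq_mult_att[OF tr(1)[OF t]])
  qed
  have decr: "sq (\<phi> t) \<le> sq (\<phi> r)" if "a \<le> r" "r \<le> t" "ereal t < T"
    and "\<And>s. r < s \<Longrightarrow> s < t \<Longrightarrow> virial1 (\<phi> s) \<le> 0" for r t
  proof -
    have "- sq (\<phi> r) \<le> - sq (\<phi> t)"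
    proof (rule DERIV_nonneg_imp_increasing_open[OF that(2)])
      fix x assume x: "r < x" "x < t"
      then have "a \<le> x" "ereal x < T" using that ltT[of x t] by auto
      then show "\<exists>y. ((\<lambda>t. - sq (\<phi> t)) has_real_derivative y) (at x) \<and> 0 \<le> y"
        using DERIV_minus[OF deriv(1)[of x]] that(4)[OF x] by force
    next
      have "isCont (\<lambda>t. - sq (\<phi> t)) x" if "x \<in> {r..t}" for x
        by (rule DERIV_isCont[OF DERIV_minus[OF deriv(1)]]) (use that \<open>a \<le> r\<close> ltT[OF _ \<open>ereal t < T\<close>] in auto)
      then show "continuous_on {r..t} (\<lambda>t. - sq (\<phi> t))" by (intro continuous_at_imp_continuous_on ballI)
    qed
    then show ?thesis by simp
  qed
  \<comment> \<open>Staying in the disc and having a negative slope depend on each other. Here the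
    slope is assumed nonpositive before t, which keeps the orbit in the disc and yields the strict
    initial value as a bound; the first crossing in \<open>neg\<close> then closes the
    circle.\<close>
  have v_decr: "virial1 (\<phi> t) \<le> virial1 (\<phi> a)" if t: "a \<le> t" "ereal t < T"
    and neg: "\<And>s. a \<le> s \<Longrightarrow> s < t \<Longrightarrow> virial1 (\<phi> s) \<le> 0" for t
  proof (rule DERIV_nonpos_imp_nonincreasing[OF t(1)])
    fix x assume x: "a \<le> x" "x \<le> t"
    then have xT: "ereal x < T" using ltT t by blast
    have "sq (\<phi> x) \<le> sq (\<phi> a)" by (rule decr[OF order_refl x(1) xT]) (use x neg in force)
    then have "virial2 \<alpha> (\<phi> x) \<le> 0" using s1 by (intro concave[OF x(1) xT]) simp
    then show "\<exists>y. ((\<lambda>t. virial1 (\<phi> t)) has_real_derivative y) (at x) \<and> y \<le> 0"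
      using deriv(2)[OF x(1) xT x(1) xT] by blast
  qed
  have neg: "virial1 (\<phi> t) < 0" if t: "a \<le> t" "ereal t < T" for t
  proof (rule ccontr)
    assume "\<not> ?thesis"
    then have "0 \<le> virial1 (\<phi> t)" by simp
    moreover have "continuous_on {a..t} (\<lambda>t. virial1 (\<phi> t))"
    proof -
      have "isCont (\<lambda>t. virial1 (\<phi> t)) x" if "x \<in> {a..t}" for x
        by (rule DERIV_isCont[OF deriv(2)]) (use that ltT[OF _ \<open>ereal t < T\<close>] in auto)
      then show ?thesis by (intro continuous_at_imp_continuous_on ballI)
    qed
    ultimately obtain t' where t': "a < t'" "t' \<le> t" "virial1 (\<phi> t') = 0"
      "\<And>s. a \<le> s \<Longrightarrow> s < t' \<Longrightarrow> virial1 (\<phi> s) < 0"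
      using first_crossing[of a t "\<lambda>t. virial1 (\<phi> t)" 0] t(1) v by metis
    have "virial1 (\<phi> t') \<le> virial1 (\<phi> a)"
      using t' ltT[OF t'(2) t(2)] by (intro v_decr) (auto intro: less_imp_le)
    then show False using t' v by simp
  qed
  have v_le: "virial1 (\<phi> t) \<le> virial1 (\<phi> a)" if "a \<le> t" "ereal t < T" for t
    by (rule v_decr[OF that]) (use neg ltT[OF less_imp_le that(2)] in \<open>force intro: less_imp_le\<close>)
  have mono: "sq (\<phi> t) \<le> sq (\<phi> r)" if "a \<le> r" "r \<le> t" "ereal t < T" for r t
    by (rule decr[OF that]) (use neg ltT[OF less_imp_le that(3)] that in \<open>force intro: less_imp_le\<close>)
  show fin: "T < \<infinity>"
  proof (rule ccontr)
    assume "\<not> T < \<infinity>"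
    then have T: "ereal t < T" for t by (cases T) auto
    define d where "d = - 2 * virial1 (\<phi> a)"
    have d: "0 < d" using v by (simp add: d_def)
    \<comment> \<open>The time at which the linear upper bound for r^2 reaches zero.\<close>
    define t where "t = a + sq (\<phi> a) / d"
    have t: "a \<le> t" using d pos[of a] T by (simp add: t_def)
    have "sq (\<phi> t) + d * (t - a) \<le> sq (\<phi> a) + d * (a - a)"
    proof (rule DERIV_nonpos_imp_nonincreasing[OF t])
      fix x assume x: "a \<le> x" "x \<le> t"
      have "((\<lambda>t. d * (t - a)) has_real_derivative d) (at x)" by (auto intro!: derivative_eq_intros)
      from DERIV_add[OF deriv(1)[OF x(1) T x(1) T] this]
      show "\<exists>y. ((\<lambda>t. sq (\<phi> t) + d * (t - a)) has_real_derivative y) (at x) \<and> y \<le> 0"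
        using v_le[OF x(1) T] by (force simp: d_def)
    qed
    then have "sq (\<phi> t) \<le> 0" using d by (simp add: t_def)
    then show False using pos[OF t T] by simp
  qed
  obtain r where r: "T = ereal r" using fin aT by (cases T) auto
  show "((\<lambda>t. sq (\<phi> t)) \<longlongrightarrow> 0) (at_left (real_of_ereal T))"
  proof (rule order_tendstoI)
    fix y :: real assume "y < 0"
    have "\<forall>\<^sub>F t in at_left r. a < t \<and> t < r"
      using aT r by (auto simp: eventually_at_left_field)
    then show "\<forall>\<^sub>F t in at_left (real_of_ereal T). y < sq (\<phi> t)"
      unfolding r real_of_ereal.simps
      by eventually_elim (use pos r \<open>y < 0\<close> in \<open>smt (verit) less_ereal.simps(1)\<close>)
  next
    fix \<eta> :: real assume \<eta>: "0 < \<eta>"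
    have "\<exists>t\<ge>a. ereal t < T \<and> sq (\<phi> t) < \<eta>"
    proof (rule ccontr)
      assume "\<not> ?thesis"
      then have low: "\<eta> \<le> sq (\<phi> t)" if "a \<le> t" "ereal t < T" for t using that by force
      \<comment> \<open>\<open>B\<close> bounds the kinetic energy by conservation as long as r^2
        lies between \<eta> and s1. Hence the orbit would stay in the compact set \<open>K\<close>,
        contradicting that it leaves every such set.\<close>
      define B where "B = energy \<alpha> (\<phi> a) + (\<alpha> + 2) / 2 * s1 + (\<alpha> + 2) * \<eta> powr (- \<alpha> / 2)"
      define K where "K = {\<psi> :: real^4. \<eta> \<le> sq \<psi>} \<inter> cball 0 (sqrt (3 * s1 + 4 * B))"
      have "closed {\<psi>. \<eta> \<le> sq \<psi>}" by (intro closed_Collect_le continuous_intros)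
      then have "compact K" unfolding K_def by (intro closed_Int_compact compact_cball)
      moreover have "K \<subseteq> phase_space" using \<eta> by (auto simp: K_def phase_space_iff)
      ultimately obtain t where t: "a \<le> t" "ereal t < T" "\<phi> t \<notin> K"
        using inext[OF fin _ _ order_refl aT] by blast
      have sqt: "sq (\<phi> t) \<le> s1" using mono[of a t] t s1 by simp
      have U: "sq (\<phi> t) powr (- \<alpha> / 2) \<le> \<eta> powr (- \<alpha> / 2)"
        using low[OF t(1,2)] \<eta> \<alpha> by (intro powr_mono2') auto
      define x y u v where "x = \<phi> t$1" and "y = \<phi> t$2" and "u = \<phi> t$3 + \<phi> t$2" and "v = \<phi> t$4 - \<phi> t$1"
      have sq_xy: "sq (\<phi> t) = x\<^sup>2 + y\<^sup>2" by (simp add: sq_def x_def y_def)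
      have "(\<alpha> + 2) / 2 * x\<^sup>2 \<le> (\<alpha> + 2) / 2 * s1"
        using sqt \<alpha> zero_le_power2[of y] unfolding sq_xy by (intro mult_left_mono) (linarith, simp)
      moreover have "(\<alpha> + 2) * sq (\<phi> t) powr (- \<alpha> / 2) \<le> (\<alpha> + 2) * \<eta> powr (- \<alpha> / 2)"
        using U \<alpha> by (intro mult_left_mono) auto
      ultimately have "u\<^sup>2 + v\<^sup>2 \<le> 2 * B"
        using tr(2)[OF t(1,2)] unfolding B_def energy_eq[of \<alpha> "\<phi> t", folded x_def y_def u_def v_def] by argo
      moreover have "(norm (\<phi> t))\<^sup>2 \<le> 3 * sq (\<phi> t) + 2 * (u\<^sup>2 + v\<^sup>2)"
      proof -
        have "(u - y)\<^sup>2 + (v + x)\<^sup>2 \<le> 2 * (u\<^sup>2 + v\<^sup>2) + 2 * sq (\<phi> t)"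
          using zero_le_power2[of "u + y"] zero_le_power2[of "v - x"]
          unfolding sq_xy by (simp add: power2_eq_square algebra_simps)
        then have "sq (\<phi> t) + ((u - y)\<^sup>2 + (v + x)\<^sup>2) \<le> sq (\<phi> t) + (2 * (u\<^sup>2 + v\<^sup>2) + 2 * sq (\<phi> t))"
          by (rule add_left_mono)
        moreover have "(norm (\<phi> t))\<^sup>2 = sq (\<phi> t) + ((u - y)\<^sup>2 + (v + x)\<^sup>2)"
          unfolding power2_norm_eq_inner inner_real4 by (simp add: sq_def x_def y_def u_def v_def power2_eq_square)
        ultimately show ?thesis by simp
      qed
      ultimately have "(norm (\<phi> t))\<^sup>2 \<le> 3 * s1 + 4 * B" using sqt by simp
      then have "norm (\<phi> t) \<le> sqrt (3 * s1 + 4 * B)" by (rule real_le_rsqrt)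
      then show False using t low[OF t(1,2)] by (simp add: K_def)
    qed
    then obtain t0 where t0: "a \<le> t0" "t0 < r" "sq (\<phi> t0) < \<eta>" by (auto simp: r)
    have "\<forall>\<^sub>F t in at_left r. t0 < t \<and> t < r"
      using t0 by (auto simp: eventually_at_left_field)
    then show "\<forall>\<^sub>F t in at_left (real_of_ereal T). sq (\<phi> t) < \<eta>"
      unfolding r real_of_ereal.simps
    proof eventually_elim
      case (elim t)
      then show ?case using mono[OF t0(1), of t] t0 by (simp add: r)
    qed
  qed
qed

section \<open>Maximal solutions and the distance function\<close>

lemma lipschitz_on_gradient:
  fixes f :: "real^4 \<Rightarrow> real"
  assumes deriv: "\<And>x. x \<in> cball a r \<Longrightarrow> (f has_derivative (\<lambda>h. G x \<bullet> h)) (at x)"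
    and cont: "continuous_on (cball a r) G"
  shows "\<exists>B\<ge>0. \<forall>x\<in>cball a r. \<forall>y\<in>cball a r. \<bar>f x - f y\<bar> \<le> B * norm (x - y)"
proof -
  have "bounded (G ` cball a r)" using cont by (intro compact_imp_bounded compact_continuous_image) auto
  then obtain B where B: "0 < B" "\<And>x. x \<in> cball a r \<Longrightarrow> norm (G x) \<le> B" unfolding bounded_pos by blast
  have "norm (f x - f y) \<le> B * norm (x - y)" if "x \<in> cball a r" "y \<in> cball a r" for x y
  proof (rule differentiable_bound[OF convex_cball _ _ that])
    fix z assume z: "z \<in> cball a r"
    show "(f has_derivative (\<lambda>h. G z \<bullet> h)) (at z within cball a r)"
      using deriv[OF z] by (rule has_derivative_at_withinI)
    show "onorm (\<lambda>h. G z \<bullet> h) \<le> B"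
      by (intro onorm_le) (use Cauchy_Schwarz_ineq2[of "G z"] B(2)[OF z] in
        \<open>force intro: order_trans mult_right_mono\<close>)
  qed
  then show ?thesis using B(1) by (intro exI[of _ B]) auto
qed

lemma continuous_on_sq_powr: "S \<subseteq> phase_space \<Longrightarrow> continuous_on S (\<lambda>\<psi>. sq \<psi> powr p)"
  by (intro continuous_intros) (auto simp: phase_space_iff)

lemma continuous_on_att:
  assumes "S \<subseteq> phase_space"
  shows "continuous_on S (att \<alpha>)" "continuous_on S (att' \<alpha>)"
  unfolding att_def[abs_def] att'_def[abs_def]
  by (intro continuous_on_mult continuous_on_const continuous_on_sq_powr assms)+

lemma continuous_on_energy: "S \<subseteq> phase_space \<Longrightarrow> continuous_on S (energy \<alpha>)"
  by (intro continuous_at_imp_continuous_on ballI has_derivative_continuous[OF has_derivative_energy]) auto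

lemma continuous_on_vector_4:
  assumes "continuous_on S a" "continuous_on S b" "continuous_on S c" "continuous_on S d"
  shows "continuous_on S (\<lambda>x. vector [a x, b x, c x, d x] :: real^4)"
  unfolding vector_4_axis by (intro continuous_intros assms)

lemma continuous_on_field: "continuous_on phase_space (\<lambda>\<psi>. J *v egrad \<alpha> \<psi>)"
  unfolding J_mult egrad_def vector_4
  by (intro continuous_on_vector_4 continuous_intros continuous_on_att) auto

text \<open>The field is linear apart from the attraction terms in its last two entries; those have
  continuous gradients, and the mean value inequality on a ball applies.\<close>

lemma field_locally_lipschitz:
  assumes "\<psi> \<in> phase_space"
  shows "\<exists>r>0. \<exists>B. B-lipschitz_on (cball \<psi> r) (\<lambda>\<psi>. J *v egrad \<alpha> \<psi>)"
proof -
  obtain r where r: "0 < r" "cball \<psi> r \<subseteq> phase_space"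
    using assms open_phase_space open_contains_cball by blast
  let ?xy = "\<lambda>\<psi> :: real^4. vector [\<psi>$1, \<psi>$2, 0, 0] :: real^4"
  have "\<exists>B\<ge>0. \<forall>x\<in>cball \<psi> r. \<forall>y\<in>cball \<psi> r. \<bar>x$i * att \<alpha> x - y$i * att \<alpha> y\<bar> \<le> B * norm (x - y)" for i
  proof (rule lipschitz_on_gradient[where G = "\<lambda>\<psi>. att \<alpha> \<psi> *\<^sub>R axis i 1 + (\<psi>$i * att' \<alpha> \<psi>) *\<^sub>R ?xy \<psi>"])
    fix x assume "x \<in> cball \<psi> r"
    then have x: "x \<in> phase_space" using r by blast
    show "((\<lambda>\<psi>. \<psi>$i * att \<alpha> \<psi>) has_derivative
        (\<lambda>h. (att \<alpha> x *\<^sub>R axis i 1 + (x$i * att' \<alpha> x) *\<^sub>R ?xy x) \<bullet> h)) (at x)"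
      using x by (auto intro!: derivative_eq_intros simp: fun_eq_iff inner_add_left inner_axis' inner_real4[of "?xy x"])
  qed (intro continuous_intros continuous_on_att r continuous_on_vector_4)
  then obtain B1 B2 where B: "0 \<le> B1" "0 \<le> B2"
    "\<And>x y. x \<in> cball \<psi> r \<Longrightarrow> y \<in> cball \<psi> r \<Longrightarrow> \<bar>x$1 * att \<alpha> x - y$1 * att \<alpha> y\<bar> \<le> B1 * norm (x - y)"
    "\<And>x y. x \<in> cball \<psi> r \<Longrightarrow> y \<in> cball \<psi> r \<Longrightarrow> \<bar>x$2 * att \<alpha> x - y$2 * att \<alpha> y\<bar> \<le> B2 * norm (x - y)"
    by metis
  define L :: "real^4 \<Rightarrow> real^4" where "L z = vector [z$3 + z$2, z$4 - z$1, z$4 - z$1 + (\<alpha> + 2) * z$1, - (z$3 + z$2)]" for z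
  have "linear L" by (intro linearI) (simp_all add: L_def real4_eq_iff algebra_simps)
  then obtain BL where BL: "0 < BL" "\<And>z. norm (L z) \<le> BL * norm z" using linear_bounded_pos by blast
  define b where "b = \<bar>\<alpha> + 2\<bar>"
  have "(BL + b * B1 + b * B2)-lipschitz_on (cball \<psi> r) (\<lambda>\<psi>. J *v egrad \<alpha> \<psi>)"
  proof (rule lipschitz_onI)
    fix x y assume xy: "x \<in> cball \<psi> r" "y \<in> cball \<psi> r"
    define d1 d2 where "d1 = x$1 * att \<alpha> x - y$1 * att \<alpha> y" and "d2 = x$2 * att \<alpha> x - y$2 * att \<alpha> y"
    have "J *v egrad \<alpha> x - J *v egrad \<alpha> y = L (x - y) - ((\<alpha> + 2) * d1) *\<^sub>R axis 3 1 - ((\<alpha> + 2) * d2) *\<^sub>R axis 4 1"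
      by (simp add: J_mult egrad_def L_def d1_def d2_def real4_eq_iff axis_def algebra_simps)
    also have "norm \<dots> \<le> norm (L (x - y)) + b * \<bar>d1\<bar> + b * \<bar>d2\<bar>"
      by (intro order_trans[OF norm_triangle_ineq4] add_mono) (auto simp: b_def abs_mult)
    also have "\<dots> \<le> BL * norm (x - y) + b * (B1 * norm (x - y)) + b * (B2 * norm (x - y))"
      using B(3,4)[OF xy] BL(2) by (intro add_mono mult_left_mono) (auto simp: b_def d1_def d2_def)
    finally show "dist (J *v egrad \<alpha> x) (J *v egrad \<alpha> y) \<le> (BL + b * B1 + b * B2) * dist x y"
      by (simp add: dist_norm algebra_simps)
  qed (use BL B in \<open>simp add: b_def\<close>)
  then show ?thesis using r by blast
qed

lemma solution_energy_constant:
  assumes sol: "solution_on \<alpha> \<psi> T" and t: "0 \<le> t" "ereal t < T"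
  shows "energy \<alpha> (\<psi> t) = energy \<alpha> (\<psi> 0)"
proof -
  let ?S = "{s. 0 \<le> s \<and> ereal s < T}"
  have conv: "convex ?S"
    by (intro is_interval_convex_1[THEN iffD1]) (auto simp: is_interval_1 intro: le_less_trans[of "ereal _" "ereal _"])
  have "((\<lambda>t. energy \<alpha> (\<psi> t)) has_real_derivative 0) (at s within ?S)" if "s \<in> ?S" for s
  proof -
    have s: "\<psi> s \<in> phase_space" "(\<psi> has_vector_derivative J *v egrad \<alpha> (\<psi> s)) (at s within ?S)"
      using sol that grad_energy by (auto simp: solution_on_def)
    have "((\<lambda>t. energy \<alpha> (\<psi> t)) has_derivative (\<lambda>h. (h *\<^sub>R (J *v egrad \<alpha> (\<psi> s))) \<bullet> egrad \<alpha> (\<psi> s))) (at s within ?S)"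
      using has_derivative_compose[OF s(2)[unfolded has_vector_derivative_def] has_derivative_energy[OF s(1)]] .
    moreover have "(J *v egrad \<alpha> (\<psi> s)) \<bullet> egrad \<alpha> (\<psi> s) = 0"
      by (simp add: Omega_def[symmetric] Omega_eq)
    ultimately show ?thesis by (simp add: has_field_derivative_def lambda_zero[symmetric])
  qed
  from has_field_derivative_zero_constant[OF conv this] obtain c where c: "\<And>s. s \<in> ?S \<Longrightarrow> energy \<alpha> (\<psi> s) = c" by blast
  have "ereal 0 < T" using t by (meson ereal_less_eq(3) le_less_trans)
  then show ?thesis using c[of t] c[of 0] t by simp
qed

lemma solution_vector_derivative:
  assumes sol: "solution_on \<alpha> \<psi> T" and t: "0 < t" "ereal t < T"
  shows "(\<psi> has_vector_derivative J *v egrad \<alpha> (\<psi> t)) (at t)"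
proof -
  let ?S = "{s. 0 \<le> s \<and> ereal s < T}"
  obtain r where r: "t < r" "ereal r < T"
    using ereal_dense2[OF t(2)] by auto
  have "{0<..<r} \<subseteq> ?S"
    using r by (auto intro: less_trans[of "ereal _" "ereal _"])
  then have "t \<in> interior ?S" using t r by (intro interiorI[of "{0<..<r}"]) auto
  then have "at t within ?S = at t" by (rule at_within_interior)
  moreover have "(\<psi> has_vector_derivative J *v egrad \<alpha> (\<psi> t)) (at t within ?S)"
  proof -
    have "\<psi> t \<in> phase_space \<and> (\<psi> has_vector_derivative J *v grad (energy \<alpha>) (\<psi> t)) (at t within ?S)"
      using sol t by (simp add: solution_on_def)
    then show ?thesis using grad_energy by metis
  qed
  ultimately show ?thesis by simp
qed

text \<open>The start is at a positive time because a solution has only a one-sided derivative at 0.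
  An orbit that stays in a compact subset up to a finite T could be continued, against
  maximality.\<close>

lemma maximal_solution_trajectory:
  assumes max: "maximal_solution \<alpha> \<psi> T" and a: "0 < a" "ereal a < T"
  shows "trajectory \<alpha> \<psi> a T"
proof -
  have sol: "solution_on \<alpha> \<psi> T" using max by (simp add: maximal_solution_def)
  have "\<exists>t\<ge>t1. ereal t < T \<and> \<psi> t \<notin> K"
    if T: "T < \<infinity>" and K: "compact K" "K \<subseteq> phase_space" and t1: "a \<le> t1" "ereal t1 < T" for K t1
  proof (rule ccontr)
    assume "\<not> ?thesis"
    then have inK: "\<psi> t \<in> K" if "t1 \<le> t" "ereal t < T" for t using that by blast
    obtain r where r: "T = ereal r" using T a by (cases T) auto
    have S: "{s. 0 \<le> s \<and> ereal s < ereal u} = {0..<u}" for u by auto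
    have sol': "\<psi> t \<in> phase_space \<and> (\<psi> has_vector_derivative J *v egrad \<alpha> (\<psi> t)) (at t within {0..<r})"
      if "0 \<le> t" "t < r" for t
      using sol that grad_energy unfolding solution_on_def r S by auto
    have "\<exists>T'>r. \<exists>w. (\<forall>t. 0 \<le> t \<and> t < r \<longrightarrow> w t = \<psi> t) \<and> (\<forall>t. 0 \<le> t \<and> t < T' \<longrightarrow> w t \<in> phase_space \<and>
        (w has_vector_derivative J *v egrad \<alpha> (w t)) (at t within {0..<T'}))"
      by (rule autonomous_continuation[OF open_phase_space continuous_on_field field_locally_lipschitz, where K = K])
        (use sol' K inK t1 a r in auto)
    then obtain T' w where T': "r < T'" and w: "\<And>t. 0 \<le> t \<Longrightarrow> t < r \<Longrightarrow> w t = \<psi> t"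
      "\<And>t. 0 \<le> t \<Longrightarrow> t < T' \<Longrightarrow> w t \<in> phase_space \<and> (w has_vector_derivative J *v egrad \<alpha> (w t)) (at t within {0..<T'})"
      by blast
    have "solution_on \<alpha> w (ereal T')"
      unfolding solution_on_def S using w(2) T' a t1 r grad_energy by auto
    then have "\<exists>\<phi> T'. T < T' \<and> solution_on \<alpha> \<phi> T' \<and> (\<forall>t. 0 \<le> t \<and> ereal t < T \<longrightarrow> \<phi> t = \<psi> t)"
      using T' w(1) r by (intro exI[of _ w] exI[of _ "ereal T'"]) auto
    then show False using max by (simp add: maximal_solution_def)
  qed
  moreover have "\<psi> t \<in> phase_space" if "a \<le> t" "ereal t < T" for t
    using sol that a by (auto simp: solution_on_def)
  moreover have "energy \<alpha> (\<psi> t) = energy \<alpha> (\<psi> a)" if "a \<le> t" "ereal t < T" for t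
    using solution_energy_constant[OF sol, of t] solution_energy_constant[OF sol, of a] that a by simp
  moreover have "(\<psi> has_vector_derivative J *v egrad \<alpha> (\<psi> t)) (at t)" if "a \<le> t" "ereal t < T" for t
    using solution_vector_derivative[OF sol, of t] that a by simp
  ultimately show ?thesis unfolding trajectory_def using a by blast
qed

lemma reflection_invariance:
  "sq (- \<psi>) = sq \<psi>" "- \<psi> \<in> phase_space \<longleftrightarrow> \<psi> \<in> phase_space" "energy \<alpha> (- \<psi>) = energy \<alpha> \<psi>"
  "J *v egrad \<alpha> (- \<psi>) = - (J *v egrad \<alpha> \<psi>)"
proof -
  show sq: "sq (- \<psi>) = sq \<psi>" by (simp add: sq_def)
  then show "- \<psi> \<in> phase_space \<longleftrightarrow> \<psi> \<in> phase_space" by (simp add: phase_space_iff)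
  show "energy \<alpha> (- \<psi>) = energy \<alpha> \<psi>"
    by (simp add: energy_eq sq power2_eq_square algebra_simps)
  have "att \<alpha> (- \<psi>) = att \<alpha> \<psi>" by (simp add: att_def sq)
  then show "J *v egrad \<alpha> (- \<psi>) = - (J *v egrad \<alpha> \<psi>)"
    by (simp add: J_mult egrad_def real4_eq_iff algebra_simps)
qed

lemma trajectory_uminus:
  assumes "trajectory \<alpha> \<psi> a T"
  shows "trajectory \<alpha> (\<lambda>t. - \<psi> t) a T"
proof -
  have aT: "ereal a < T" and tr: "\<And>t. a \<le> t \<Longrightarrow> ereal t < T \<Longrightarrow> \<psi> t \<in> phase_space"
    "\<And>t. a \<le> t \<Longrightarrow> ereal t < T \<Longrightarrow> energy \<alpha> (\<psi> t) = energy \<alpha> (\<psi> a)"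
    "\<And>t. a \<le> t \<Longrightarrow> ereal t < T \<Longrightarrow> (\<psi> has_vector_derivative J *v egrad \<alpha> (\<psi> t)) (at t)"
    and inext: "\<And>K t1. T < \<infinity> \<Longrightarrow> compact K \<Longrightarrow> K \<subseteq> phase_space \<Longrightarrow> a \<le> t1 \<Longrightarrow> ereal t1 < T \<Longrightarrow>
      \<exists>t\<ge>t1. ereal t < T \<and> \<psi> t \<notin> K"
    using assms unfolding trajectory_def by blast+
  show ?thesis
    unfolding trajectory_def
  proof (intro conjI allI impI)
    show "ereal a < T" by (fact aT)
    fix t assume t: "a \<le> t" "ereal t < T"
    show "- \<psi> t \<in> phase_space" "energy \<alpha> (- \<psi> t) = energy \<alpha> (- \<psi> a)"
      using tr[OF t] by (simp_all add: reflection_invariance)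
    show "((\<lambda>t. - \<psi> t) has_vector_derivative J *v egrad \<alpha> (- \<psi> t)) (at t)"
      unfolding reflection_invariance by (rule has_vector_derivative_minus[OF tr(3)[OF t]])
  next
    fix K t1 assume T: "T < \<infinity>" and K: "compact K" "K \<subseteq> phase_space" and t1: "a \<le> t1" "ereal t1 < T"
    have "compact (uminus ` K)" using K(1) by (rule compact_negations)
    moreover have "uminus ` K \<subseteq> phase_space" using K reflection_invariance(2) by auto
    ultimately obtain t where "t1 \<le> t" "ereal t < T" "\<psi> t \<notin> uminus ` K"
      using inext T t1 by blast
    then show "\<exists>t\<ge>t1. ereal t < T \<and> - \<psi> t \<notin> K" by (metis image_eqI minus_minus)
  qed
qed

section \<open>Exit times and the cut-off distance\<close>

lemma exit_time_crossing:
  assumes cont: "\<And>b. 0 \<le> b \<Longrightarrow> ereal b < T \<Longrightarrow> continuous_on {0..b} (\<lambda>t. d (\<psi> t))"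
    and start: "d (\<psi> 0) < \<rho>" and t2: "0 \<le> t2" "ereal t2 < T" "\<rho> \<le> d (\<psi> t2)"
  obtains \<tau> where "0 < \<tau>" "ereal \<tau> < T" "exit_time d \<rho> \<psi> T = ereal \<tau>" "d (\<psi> \<tau>) = \<rho>"
    "\<And>s. 0 \<le> s \<Longrightarrow> s < \<tau> \<Longrightarrow> d (\<psi> s) < \<rho>"
proof -
  obtain \<tau> where \<tau>: "0 < \<tau>" "\<tau> \<le> t2" "d (\<psi> \<tau>) = \<rho>" "\<And>s. 0 \<le> s \<Longrightarrow> s < \<tau> \<Longrightarrow> d (\<psi> s) < \<rho>"
    using first_crossing[OF cont[OF t2(1,2)] t2(1) start t2(3)] by metis
  have \<tau>T: "ereal \<tau> < T" using \<tau>(2) t2(2) by (meson ereal_less_eq(3) le_less_trans)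
  have "exit_time d \<rho> \<psi> T = ereal \<tau>"
    unfolding exit_time_def
  proof (rule antisym)
    show "Sup {t. 0 \<le> t \<and> t \<le> T \<and> (\<forall>s. 0 \<le> s \<and> ereal s < t \<longrightarrow> d (\<psi> s) < \<rho>)} \<le> ereal \<tau>"
    proof (rule Sup_least)
      fix t assume "t \<in> {t. 0 \<le> t \<and> t \<le> T \<and> (\<forall>s. 0 \<le> s \<and> ereal s < t \<longrightarrow> d (\<psi> s) < \<rho>)}"
      then have "0 \<le> \<tau> \<and> ereal \<tau> < t \<longrightarrow> d (\<psi> \<tau>) < \<rho>" by blast
      then have "\<not> ereal \<tau> < t" using \<tau>(1,3) by simp
      then show "t \<le> ereal \<tau>" by simp
    qed
    show "ereal \<tau> \<le> Sup {t. 0 \<le> t \<and> t \<le> T \<and> (\<forall>s. 0 \<le> s \<and> ereal s < t \<longrightarrow> d (\<psi> s) < \<rho>)}"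
      using \<tau> \<tau>T by (intro Sup_upper) (auto intro: less_imp_le)
  qed
  then show ?thesis using \<tau> \<tau>T by (intro that)
qed

lemma exit_time_eq_end:
  assumes "0 \<le> T" "\<And>t. 0 \<le> t \<Longrightarrow> ereal t < T \<Longrightarrow> d (\<psi> t) < \<rho>"
  shows "exit_time d \<rho> \<psi> T = T"
  unfolding exit_time_def
proof (rule antisym)
  show "T \<le> Sup {t. 0 \<le> t \<and> t \<le> T \<and> (\<forall>s. 0 \<le> s \<and> ereal s < t \<longrightarrow> d (\<psi> s) < \<rho>)}"
    using assms by (intro Sup_upper) auto
qed (rule Sup_least, simp)

text \<open>Wherever the cut-off is nonzero, N \<le> 4 \<delta> and |C| \<le> N^2/10, so the
  radicand is at least 9/10 N^2. For N \<le> 2 \<delta> the cut-off is 1 and the squared distance is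
  the energy excess plus \<Lambda>^2, since N^2 cancels against C.\<close>

lemma d_sigma_properties:
  assumes adm: "admissible_radius \<alpha> k \<omega> \<xi>p \<xi>m \<delta>" and cut: "smooth_cutoff cutoff"
    and N0: "\<And>X. 0 \<le> norm_E \<alpha> k \<omega> \<xi>p \<xi>m X" and \<sigma>: "\<sigma> \<in> {1, -1}" and \<psi>: "\<psi> \<in> phase_space"
  defines "N \<equiv> norm_E \<alpha> k \<omega> \<xi>p \<xi>m (displacement \<alpha> \<sigma> \<psi>)"
    and "D \<equiv> d_sigma \<alpha> k \<omega> \<xi>p \<xi>m \<delta> cutoff \<sigma> \<psi>"
  shows "0 \<le> D" "9 / 10 * N\<^sup>2 \<le> D\<^sup>2" "4 * \<delta> < N \<Longrightarrow> D = N"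
    "N \<le> 2 * \<delta> \<Longrightarrow> D\<^sup>2 = N\<^sup>2 + C_rem \<alpha> k \<omega> \<xi>p \<xi>m \<sigma> \<psi>"
proof -
  define C where "C = C_rem \<alpha> k \<omega> \<xi>p \<xi>m \<sigma> \<psi>"
  define c where "c = cutoff (N / (2 * \<delta>))"
  have \<delta>: "0 < \<delta>" using adm by (simp add: admissible_radius_def)
  have N: "0 \<le> N" using N0 by (simp add: N_def)
  have C: "\<bar>C\<bar> \<le> N\<^sup>2 / 10" if "N \<le> 4 * \<delta>"
    using adm \<sigma> \<psi> that unfolding admissible_radius_def N_def C_def by blast
  have c01: "0 \<le> c" "c \<le> 1" using cut unfolding smooth_cutoff_def c_def by (auto simp: image_subset_iff)
  have far: "c = 0" if "4 * \<delta> < N"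
  proof -
    have "2 \<le> \<bar>N / (2 * \<delta>)\<bar>" using that \<delta> N by (simp add: field_simps)
    then show ?thesis using cut unfolding smooth_cutoff_def c_def by blast
  qed
  have near: "c = 1" if "N \<le> 2 * \<delta>"
  proof -
    have "\<bar>N / (2 * \<delta>)\<bar> \<le> 1" using that \<delta> N by (simp add: field_simps)
    then show ?thesis using cut unfolding smooth_cutoff_def c_def by blast
  qed
  have D: "D = sqrt (N\<^sup>2 + c * C)" by (simp add: D_def d_sigma_def N_def C_def c_def Let_def)
  have low: "9 / 10 * N\<^sup>2 \<le> N\<^sup>2 + c * C"
  proof (cases "N \<le> 4 * \<delta>")
    case True
    have "\<bar>c * C\<bar> \<le> 1 * \<bar>C\<bar>" unfolding abs_mult using c01 by (intro mult_right_mono) auto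
    then show ?thesis using C[OF True] by linarith
  next
    case False
    then show ?thesis using far by simp
  qed
  then have nn: "0 \<le> N\<^sup>2 + c * C" using zero_le_power2[of N] by linarith
  show "0 \<le> D" using nn by (simp add: D)
  have D2: "D\<^sup>2 = N\<^sup>2 + c * C" using nn by (simp add: D)
  show "9 / 10 * N\<^sup>2 \<le> D\<^sup>2" using low D2 by simp
  show "4 * \<delta> < N \<Longrightarrow> D = N" using far N by (simp add: D)
  show "N \<le> 2 * \<delta> \<Longrightarrow> D\<^sup>2 = N\<^sup>2 + C_rem \<alpha> k \<omega> \<xi>p \<xi>m \<sigma> \<psi>" using D2 near by (simp add: C_def)
qed

theorem theorem3:
  fixes \<alpha> k \<omega> \<delta> :: real and \<xi>p \<xi>m :: "real^4" and cutoff :: "real \<Rightarrow> real"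
  assumes "2 \<le> \<alpha>"
    and "eigen_frame \<alpha> k \<omega> \<xi>p \<xi>m"
    and "admissible_radius \<alpha> k \<omega> \<xi>p \<xi>m \<delta>"
    and "smooth_cutoff cutoff"
  shows "\<exists>\<epsilon>>0. \<forall>(\<psi> :: real \<Rightarrow> real^4) T.
    maximal_solution \<alpha> \<psi> T \<and> energy \<alpha> (\<psi> 0) < E_star \<alpha> + \<epsilon>\<^sup>2 \<and>
    d_Q \<alpha> k \<omega> \<xi>p \<xi>m \<delta> cutoff (\<psi> 0) < 2 * \<epsilon> \<longrightarrow>
      (let t\<^sub>e = exit_time (d_Q \<alpha> k \<omega> \<xi>p \<xi>m \<delta> cutoff) (2 * \<epsilon>) \<psi> T in
        ((\<forall>t. 0 \<le> t \<and> ereal t < T \<longrightarrow> d_Q \<alpha> k \<omega> \<xi>p \<xi>m \<delta> cutoff (\<psi> t) < 2 * \<epsilon>) \<or> t\<^sub>e < T) \<and>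
        (t\<^sub>e < T \<and> W \<alpha> (\<psi> (real_of_ereal t\<^sub>e)) < 0 \<longrightarrow>
           T < \<infinity> \<and>
           ((\<lambda>t. (\<psi> t $ 1, \<psi> t $ 2)) \<longlongrightarrow> (0, 0)) (at_left (real_of_ereal T))))"
proof -
  note \<alpha> = assms(1)
  have \<alpha>0: "0 < \<alpha>" using \<alpha> by simp
  have k: "0 < k" using assms(2) by (simp add: eigen_frame_def)
  have \<delta>: "0 < \<delta>" using assms(3) by (simp add: admissible_radius_def)
  obtain g p where g: "\<alpha> + 2 \<le> g" "g \<le> 28 / 25 * (\<alpha> + 2)" and p: "0 < p" "p * (\<alpha> + 2) \<le> 2 / 5"
    and rel: "(1 - 2 * p) * (\<alpha> + 2)\<^sup>2 = k\<^sup>2" "2 * (1 - 2 * p) - p * (\<alpha> + 2) = k\<^sup>2 * p"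
    and N: "\<And>X. norm_E \<alpha> k \<omega> \<xi>p \<xi>m X = sqrt (H2 \<alpha> X + (Lam g p X)\<^sup>2)"
    and C: "\<And>\<sigma> \<psi>. C_rem \<alpha> k \<omega> \<xi>p \<xi>m \<sigma> \<psi> = energy \<alpha> \<psi> - E_star \<alpha> + (Lam g p (displacement \<alpha> \<sigma> \<psi>))\<^sup>2
      - (norm_E \<alpha> k \<omega> \<xi>p \<xi>m (displacement \<alpha> \<sigma> \<psi>))\<^sup>2"
    using eigen_frame_normal_form[OF assms(1,2)] by metis
  define NE where "NE = norm_E \<alpha> k \<omega> \<xi>p \<xi>m"
  define D where "D = d_sigma \<alpha> k \<omega> \<xi>p \<xi>m \<delta> cutoff"
  define d where "d = d_Q \<alpha> k \<omega> \<xi>p \<xi>m \<delta> cutoff"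
  have d: "d \<psi> = min (D 1 \<psi>) (D (-1) \<psi>)" for \<psi> by (simp add: d_def d_Q_def D_def)
  have pd: "0 \<le> H2 \<alpha> X + (Lam g p X)\<^sup>2" for X
    using order_trans[OF zero_le_power2 unstable_coordinate_quadratic_bound[OF \<alpha> g(1) p, of X]]
    unfolding zero_le_mult_iff by simp
  have NE: "0 \<le> NE X" "(NE X)\<^sup>2 = H2 \<alpha> X + (Lam g p X)\<^sup>2" for X
    using pd[of X] by (simp_all add: NE_def N)
  have Dprop: "0 \<le> D \<sigma> \<psi>" "9 / 10 * (NE (displacement \<alpha> \<sigma> \<psi>))\<^sup>2 \<le> (D \<sigma> \<psi>)\<^sup>2"
    "4 * \<delta> < NE (displacement \<alpha> \<sigma> \<psi>) \<Longrightarrow> D \<sigma> \<psi> = NE (displacement \<alpha> \<sigma> \<psi>)"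
    "NE (displacement \<alpha> \<sigma> \<psi>) \<le> 2 * \<delta> \<Longrightarrow> (D \<sigma> \<psi>)\<^sup>2 = energy \<alpha> \<psi> - E_star \<alpha> + (Lam g p (displacement \<alpha> \<sigma> \<psi>))\<^sup>2"
    if "\<sigma> \<in> {1, -1}" "\<psi> \<in> phase_space" for \<sigma> \<psi>
    using d_sigma_properties[OF assms(3,4) NE(1)[unfolded NE_def] that] by (simp_all add: NE_def D_def C)
  have adm: "\<bar>energy \<alpha> \<phi> - E_star \<alpha> - H2 \<alpha> (\<phi> - ground \<alpha>)\<bar>
      \<le> (H2 \<alpha> (\<phi> - ground \<alpha>) + (Lam g p (\<phi> - ground \<alpha>))\<^sup>2) / 10"
    if "\<phi> \<in> phase_space" "H2 \<alpha> (\<phi> - ground \<alpha>) + (Lam g p (\<phi> - ground \<alpha>))\<^sup>2 \<le> (4 * \<delta>)\<^sup>2" for \<phi>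
  proof -
    have X: "displacement \<alpha> 1 \<phi> = \<phi> - ground \<alpha>" by (simp add: displacement_def)
    have "NE (\<phi> - ground \<alpha>) \<le> 4 * \<delta>"
      using that(2) \<delta> unfolding NE(2)[symmetric] by (intro power2_le_imp_le[of "NE (\<phi> - ground \<alpha>)" "4 * \<delta>"]) auto
    then have "\<bar>C_rem \<alpha> k \<omega> \<xi>p \<xi>m 1 \<phi>\<bar> \<le> (NE (\<phi> - ground \<alpha>))\<^sup>2 / 10"
      using assms(3) that(1) unfolding admissible_radius_def NE_def X[symmetric] by blast
    then show ?thesis using NE(2)[of "\<phi> - ground \<alpha>"] by (simp add: C X NE_def)
  qed
  have "0 < (4 * \<delta>)\<^sup>2" using \<delta> by simp
  from ejection[OF \<alpha> k g p rel this adm] obtain s1 \<epsilon>0 where s1: "s1 < (q0 \<alpha>)\<^sup>2" and \<epsilon>0: "0 < \<epsilon>0" and eject: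
    "\<And>\<epsilon> \<phi> a T. 0 < \<epsilon> \<Longrightarrow> \<epsilon> < \<epsilon>0 \<Longrightarrow> trajectory \<alpha> \<phi> a T \<Longrightarrow> energy \<alpha> (\<phi> a) < E_star \<alpha> + \<epsilon>\<^sup>2 \<Longrightarrow>
      H2 \<alpha> (\<phi> a - ground \<alpha>) + (Lam g p (\<phi> a - ground \<alpha>))\<^sup>2 \<le> 5 * \<epsilon>\<^sup>2 \<Longrightarrow>
      3 * \<epsilon>\<^sup>2 < (Lam g p (\<phi> a - ground \<alpha>))\<^sup>2 \<Longrightarrow>
      0 \<le> Lam g p (\<phi> a - ground \<alpha>) * Lam1 \<alpha> g p (\<phi> a) \<Longrightarrow> W \<alpha> (\<phi> a) < 0 \<Longrightarrow>
      \<exists>t\<ge>a. ereal t < T \<and> sq (\<phi> t) \<le> s1 \<and> virial1 (\<phi> t) < 0"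
    by metis
  have q: "0 < q0 \<alpha>" using q0[OF \<alpha>0] by simp
  \<comment> \<open>The bound \<delta>/3 places the 2\<epsilon> ball where the cut-off is 1 and
    makes 2\<epsilon> smaller than the distance to the other ground state; the bound 1 gives
    \<epsilon>^2 \<le> \<epsilon>, so that the last bound implies the smallness condition of
    \<open>collapse\<close>.\<close>
  define \<epsilon> where "\<epsilon> = min (\<epsilon>0 / 2) (min (\<delta> / 3) (min 1 (4 * ((q0 \<alpha>)\<^sup>2 - s1) / (2 + 4 * q0 \<alpha>))))"
  have \<epsilon>: "0 < \<epsilon>" "\<epsilon> < \<epsilon>0" "3 * \<epsilon> \<le> \<delta>" "\<epsilon> \<le> 1"
    using \<epsilon>0 \<delta> s1 q by (auto simp: \<epsilon>_def)
  have small: "2 * \<epsilon>\<^sup>2 + 4 * q0 \<alpha> * \<epsilon> \<le> 4 * ((q0 \<alpha>)\<^sup>2 - s1)"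
  proof -
    have "\<epsilon> \<le> 4 * ((q0 \<alpha>)\<^sup>2 - s1) / (2 + 4 * q0 \<alpha>)" by (simp add: \<epsilon>_def)
    then have "\<epsilon> * (2 + 4 * q0 \<alpha>) \<le> 4 * ((q0 \<alpha>)\<^sup>2 - s1)" using q by (simp add: pos_le_divide_eq)
    moreover have "\<epsilon>\<^sup>2 \<le> \<epsilon>" using \<epsilon> by (simp add: power2_eq_square mult_left_le)
    ultimately show ?thesis by (simp add: algebra_simps)
  qed
  have contNE: "continuous_on S (\<lambda>\<psi>. NE (displacement \<alpha> \<sigma> \<psi>))" for S \<sigma>
    unfolding NE_def N displacement_def H2_def Lam_def by (intro continuous_intros) auto
  have contD: "continuous_on phase_space (D \<sigma>)" for \<sigma>
  proof -
    have "(deriv ^^ 0) cutoff differentiable_on UNIV" using assms(4) unfolding smooth_cutoff_def by blast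
    then have "continuous_on UNIV cutoff" by (simp add: differentiable_imp_continuous_on)
    then have 1: "continuous_on phase_space (\<lambda>\<psi>. cutoff (NE (displacement \<alpha> \<sigma> \<psi>) / (2 * \<delta>)))"
      by (rule continuous_on_compose2[OF _ continuous_on_divide[OF contNE continuous_on_const]]) (use \<delta> in auto)
    have "continuous_on phase_space (\<lambda>\<psi>. Lam g p (displacement \<alpha> \<sigma> \<psi>))"
      unfolding displacement_def Lam_def by (intro continuous_intros)
    then have 2: "continuous_on phase_space (C_rem \<alpha> k \<omega> \<xi>p \<xi>m \<sigma>)"
      unfolding C[abs_def] NE_def[symmetric]
      by (intro continuous_on_diff continuous_on_add continuous_on_power continuous_on_const continuous_on_energy contNE order_refl)
    have "D \<sigma> = (\<lambda>\<psi>. sqrt ((NE (displacement \<alpha> \<sigma> \<psi>))\<^sup>2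
        + cutoff (NE (displacement \<alpha> \<sigma> \<psi>) / (2 * \<delta>)) * C_rem \<alpha> k \<omega> \<xi>p \<xi>m \<sigma> \<psi>))"
      by (simp add: D_def d_sigma_def NE_def Let_def fun_eq_iff)
    then show ?thesis
      by (simp only:) (intro continuous_on_real_sqrt continuous_on_add continuous_on_power continuous_on_mult contNE 1 2)
  qed
  have contd: "continuous_on phase_space d"
    unfolding d[abs_def] by (intro continuous_on_min contD)
  show ?thesis
  proof (intro exI[of _ \<epsilon>] conjI allI impI)
    show "0 < \<epsilon>" by (fact \<epsilon>)
    fix \<psi> :: "real \<Rightarrow> real^4" and T
    assume "maximal_solution \<alpha> \<psi> T \<and> energy \<alpha> (\<psi> 0) < E_star \<alpha> + \<epsilon>\<^sup>2 \<and>
      d_Q \<alpha> k \<omega> \<xi>p \<xi>m \<delta> cutoff (\<psi> 0) < 2 * \<epsilon>"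
    then have max: "maximal_solution \<alpha> \<psi> T" and E: "energy \<alpha> (\<psi> 0) < E_star \<alpha> + \<epsilon>\<^sup>2"
      and d0: "d (\<psi> 0) < 2 * \<epsilon>" by (auto simp: d_def)
    have sol: "solution_on \<alpha> \<psi> T" using max by (simp add: maximal_solution_def)
    have T0: "0 < T" and ps: "\<And>t. 0 \<le> t \<Longrightarrow> ereal t < T \<Longrightarrow> \<psi> t \<in> phase_space"
      using sol by (auto simp: solution_on_def)
    have ltT: "ereal s < T" if "s \<le> t" "ereal t < T" for s t using that by (meson ereal_less_eq(3) le_less_trans)
    have contdt: "continuous_on {0..b} (\<lambda>t. d (\<psi> t))" if b: "0 \<le> b" "ereal b < T" for b
    proof (rule continuous_on_compose2[OF contd])
      show "continuous_on {0..b} \<psi>"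
        unfolding continuous_on_eq_continuous_within
      proof
        fix t assume t: "t \<in> {0..b}"
        then have "continuous (at t within {s. 0 \<le> s \<and> ereal s < T}) \<psi>"
          using sol ltT[of t b] b unfolding solution_on_def
          by (intro has_vector_derivative_continuous[where D = "J *v grad (energy \<alpha>) (\<psi> t)"]) auto
        then show "continuous (at t within {0..b}) \<psi>"
          by (rule continuous_within_subset) (use ltT b in auto)
      qed
      show "\<psi> ` {0..b} \<subseteq> phase_space" using ps ltT b by auto
    qed
    define te where "te = exit_time d (2 * \<epsilon>) \<psi> T"
    have "(\<forall>t. 0 \<le> t \<and> ereal t < T \<longrightarrow> d (\<psi> t) < 2 * \<epsilon>) \<or> te < T"
      using exit_time_crossing[OF contdt d0] unfolding te_def by (metis not_le)
    moreover have "T < \<infinity> \<and> ((\<lambda>t. (\<psi> t $ 1, \<psi> t $ 2)) \<longlongrightarrow> (0, 0)) (at_left (real_of_ereal T))"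
      if te: "te < T" and We: "W \<alpha> (\<psi> (real_of_ereal te)) < 0"
    proof -
      obtain t2 where "0 \<le> t2" "ereal t2 < T" "2 * \<epsilon> \<le> d (\<psi> t2)"
        using exit_time_eq_end[of T d \<psi> "2 * \<epsilon>"] T0 te unfolding te_def by (metis less_imp_le not_le order_less_irrefl)
      from exit_time_crossing[OF contdt d0 this] obtain \<tau> where \<tau>: "0 < \<tau>" "ereal \<tau> < T" "te = ereal \<tau>"
        "d (\<psi> \<tau>) = 2 * \<epsilon>" "\<And>s. 0 \<le> s \<Longrightarrow> s < \<tau> \<Longrightarrow> d (\<psi> s) < 2 * \<epsilon>"
        unfolding te_def by metis
      have psi\<tau>: "\<psi> \<tau> \<in> phase_space" using ps \<tau> by simp
      \<comment> \<open>\<sigma> selects the ground state attaining the minimum at the exit. The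
        reflected orbit \<open>\<phi>\<close> is then close to the positive one.\<close>
      obtain \<sigma> where \<sigma>: "\<sigma> \<in> {1, -1 :: real}" and D\<tau>: "D \<sigma> (\<psi> \<tau>) = 2 * \<epsilon>"
        using \<tau>(4) unfolding d min_def by (metis insertI1 insert_commute)
      have \<sigma>': "- \<sigma> \<in> {1, -1}" using \<sigma> by auto
      define X where "X t = displacement \<alpha> \<sigma> (\<psi> t)" for t
      define \<phi> where "\<phi> t = \<sigma> *\<^sub>R \<psi> t" for t
      have X: "X t = \<phi> t - ground \<alpha>" for t by (simp add: X_def \<phi>_def displacement_def)
      have traj: "trajectory \<alpha> \<phi> a T" if "0 < a" "ereal a < T" for a
        using maximal_solution_trajectory[OF max that] trajectory_uminus[OF maximal_solution_trajectory[OF max that]] \<sigma>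
        unfolding \<phi>_def by auto
      have inv: "sq (\<phi> t) = sq (\<psi> t)" "energy \<alpha> (\<phi> t) = energy \<alpha> (\<psi> t)"
        "\<phi> t \<in> phase_space \<longleftrightarrow> \<psi> t \<in> phase_space" for t
        using \<sigma> by (auto simp: \<phi>_def reflection_invariance)
      have E\<phi>: "energy \<alpha> (\<phi> t) < E_star \<alpha> + \<epsilon>\<^sup>2" if "0 \<le> t" "ereal t < T" for t
        using E solution_energy_constant[OF sol that] by (simp add: inv)
      \<comment> \<open>From 9/10 N^2 \<le> 4 \<epsilon>^2 one gets N^2 \<le> 40/9 \<epsilon>^2,
        rounded up to 5 \<epsilon>^2.\<close>
      have close: "(NE (displacement \<alpha> \<sigma> (\<psi> t)))\<^sup>2 \<le> 5 * \<epsilon>\<^sup>2" "NE (displacement \<alpha> \<sigma> (\<psi> t)) \<le> 2 * \<delta>"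
        if t: "0 \<le> t" "ereal t < T" and Dt: "D \<sigma> (\<psi> t) \<le> 2 * \<epsilon>" for t
      proof -
        note P = Dprop[OF \<sigma> ps[OF t]]
        have "(D \<sigma> (\<psi> t))\<^sup>2 \<le> (2 * \<epsilon>)\<^sup>2" using Dt P(1) by (intro power_mono) auto
        then have "(D \<sigma> (\<psi> t))\<^sup>2 \<le> 4 * \<epsilon>\<^sup>2" by (simp add: power_mult_distrib)
        moreover have "n \<le> 5 * e" if "9 / 10 * n \<le> m" "m \<le> 4 * e" "0 \<le> e" for n m e :: real
          using that by linarith
        ultimately show "(NE (displacement \<alpha> \<sigma> (\<psi> t)))\<^sup>2 \<le> 5 * \<epsilon>\<^sup>2"
          using P(2) zero_le_power2 by blast
        also have "5 * \<epsilon>\<^sup>2 \<le> (6 * \<epsilon>)\<^sup>2" using zero_le_power2[of \<epsilon>] by (simp add: power_mult_distrib)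
        also have "\<dots> \<le> (2 * \<delta>)\<^sup>2" using \<epsilon> by (intro power_mono) auto
        finally show "NE (displacement \<alpha> \<sigma> (\<psi> t)) \<le> 2 * \<delta>" by (rule power2_le_imp_le) (use \<delta> in simp)
      qed
      have Lt: "(Lam g p (X t))\<^sup>2 = (D \<sigma> (\<psi> t))\<^sup>2 - (energy \<alpha> (\<psi> 0) - E_star \<alpha>)"
        if t: "0 \<le> t" "ereal t < T" and Dt: "D \<sigma> (\<psi> t) \<le> 2 * \<epsilon>" for t
        using Dprop(4)[OF \<sigma> ps[OF t] close(2)[OF t Dt]] solution_energy_constant[OF sol t] by (simp add: X_def)
      have \<tau>0: "0 \<le> \<tau>" using \<tau> by simp
      have N\<tau>: "H2 \<alpha> (\<phi> \<tau> - ground \<alpha>) + (Lam g p (\<phi> \<tau> - ground \<alpha>))\<^sup>2 \<le> 5 * \<epsilon>\<^sup>2"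
        using close(1)[OF \<tau>0 \<tau>(2)] D\<tau> unfolding NE(2) X_def[symmetric] X by simp
      have L\<tau>: "3 * \<epsilon>\<^sup>2 < (Lam g p (\<phi> \<tau> - ground \<alpha>))\<^sup>2"
        using Lt[OF \<tau>0 \<tau>(2)] D\<tau> E unfolding X by (simp add: power_mult_distrib)
      \<comment> \<open>If \<Lambda>^2 had negative derivative at the exit, it would be larger just
        before. There the other ground state is still farther than 4 \<delta>, so d < 2 \<epsilon>
        must come from the sheet \<sigma>, and conservation of energy turns this into a smaller
        \<Lambda>^2, a contradiction.\<close>
      have vel: "0 \<le> Lam g p (\<phi> \<tau> - ground \<alpha>) * Lam1 \<alpha> g p (\<phi> \<tau>)"
      proof (rule ccontr)
        assume neg: "\<not> ?thesis"
        have tr\<tau>: "\<phi> \<tau> \<in> phase_space" "(\<phi> has_vector_derivative J *v egrad \<alpha> (\<phi> \<tau>)) (at \<tau>)"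
          using traj[OF \<tau>(1,2)] \<tau>(2) unfolding trajectory_def by blast+
        have "((\<lambda>t. (Lam g p (X t))\<^sup>2) has_real_derivative 2 * (Lam g p (X \<tau>) * Lam1 \<alpha> g p (\<phi> \<tau>))) (at \<tau>)"
          unfolding X by (rule DERIV_cong[OF DERIV_power[OF derivatives_along(3)[OF tr\<tau>]]]) simp
        moreover have "2 * (Lam g p (X \<tau>) * Lam1 \<alpha> g p (\<phi> \<tau>)) < 0"
          using neg[unfolded not_le] unfolding X by linarith
        ultimately obtain \<eta> where \<eta>: "0 < \<eta>" "\<And>h. 0 < h \<Longrightarrow> h < \<eta> \<Longrightarrow> (Lam g p (X \<tau>))\<^sup>2 < (Lam g p (X (\<tau> - h)))\<^sup>2"
          using DERIV_neg_dec_left by blast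
        have "isCont \<psi> \<tau>"
          using solution_vector_derivative[OF sol \<tau>(1,2)] by (rule has_vector_derivative_continuous)
        moreover have "isCont (\<lambda>\<psi>. NE (displacement \<alpha> (- \<sigma>) \<psi>)) (\<psi> \<tau>)"
          using contNE[of UNIV "- \<sigma>"] by (simp add: continuous_on_eq_continuous_at)
        ultimately have "isCont (\<lambda>t. NE (displacement \<alpha> (- \<sigma>) (\<psi> t))) \<tau>" by (rule isCont_o2)
        moreover have "4 * \<delta> < NE (displacement \<alpha> (- \<sigma>) (\<psi> \<tau>))"
        proof (rule ccontr)
          assume "\<not> ?thesis"
          moreover have "NE (displacement \<alpha> \<sigma> (\<psi> \<tau>)) \<le> 4 * \<delta>"
            using close(2)[OF \<tau>0 \<tau>(2)] D\<tau> \<delta> by simp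
          ultimately have "NE (displacement \<alpha> 1 (\<psi> \<tau>)) \<le> 4 * \<delta>" "NE (displacement \<alpha> (-1) (\<psi> \<tau>)) \<le> 4 * \<delta>"
            using \<sigma> by auto
          then show False using assms(3) unfolding admissible_radius_def NE_def by blast
        qed
        ultimately have "\<forall>\<^sub>F t in at_left \<tau>. 4 * \<delta> < NE (displacement \<alpha> (- \<sigma>) (\<psi> t))"
          unfolding isCont_def by (rule filter_leD[OF at_le[OF subset_UNIV] order_tendstoD(1)])
        moreover have "\<forall>\<^sub>F t in at_left \<tau>. max 0 (\<tau> - \<eta>) < t \<and> t < \<tau>"
          using \<tau>(1) \<eta>(1) unfolding eventually_at_left_field by (intro exI[of _ "max 0 (\<tau> - \<eta>)"]) auto
        ultimately have "\<forall>\<^sub>F t in at_left \<tau>. False"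
        proof eventually_elim
          case (elim t)
          then have t: "0 \<le> t" "t < \<tau>" "ereal t < T" using ltT[of t \<tau>] \<tau>(2) by auto
          have "D (- \<sigma>) (\<psi> t) = NE (displacement \<alpha> (- \<sigma>) (\<psi> t))"
            using Dprop(3)[OF \<sigma>' ps[OF t(1,3)]] elim by simp
          then have "2 * \<epsilon> < D (- \<sigma>) (\<psi> t)" using elim \<epsilon> by simp
          moreover have "min (D \<sigma> (\<psi> t)) (D (- \<sigma>) (\<psi> t)) < 2 * \<epsilon>"
            using \<tau>(5)[OF t(1,2)] \<sigma> unfolding d by (auto simp: min.commute)
          ultimately have Dt: "D \<sigma> (\<psi> t) < 2 * \<epsilon>" by simp
          have "(D \<sigma> (\<psi> t))\<^sup>2 < (2 * \<epsilon>)\<^sup>2"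
            using Dt Dprop(1)[OF \<sigma> ps[OF t(1,3)]] by (intro power_strict_mono) auto
          then have "(Lam g p (X t))\<^sup>2 < (Lam g p (X \<tau>))\<^sup>2"
            using Lt[OF t(1,3)] Dt Lt[OF \<tau>0 \<tau>(2)] D\<tau> by simp
          moreover have "(Lam g p (X \<tau>))\<^sup>2 < (Lam g p (X t))\<^sup>2" using \<eta>(2)[of "\<tau> - t"] elim by simp
          ultimately show False by simp
        qed
        then show False by simp
      qed
      have W\<tau>: "W \<alpha> (\<phi> \<tau>) < 0"
      proof -
        have "(\<phi> \<tau>$1)\<^sup>2 = (\<psi> \<tau>$1)\<^sup>2" using \<sigma> by (auto simp: \<phi>_def)
        then show ?thesis using We psi\<tau> by (simp add: \<tau>(3) W_eq inv)
      qed
      obtain t1 where t1: "\<tau> \<le> t1" "ereal t1 < T" "sq (\<phi> t1) \<le> s1" "virial1 (\<phi> t1) < 0"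
        using eject[OF \<epsilon>(1,2) traj[OF \<tau>(1,2)] E\<phi>[OF \<tau>0 \<tau>(2)] N\<tau> L\<tau> vel W\<tau>] by blast
      have "0 < t1" using \<tau>(1) t1(1) by simp
      note col = collapse[OF \<alpha> traj[OF this t1(2)] E\<phi>[OF less_imp_le[OF this] t1(2)] less_imp_le[OF \<epsilon>(1)] t1(3) s1 t1(4) small]
      have "((\<lambda>t. sqrt (sq (\<psi> t))) \<longlongrightarrow> sqrt 0) (at_left (real_of_ereal T))"
        using col(2) unfolding inv by (rule tendsto_real_sqrt)
      then have sqrt0: "((\<lambda>t. sqrt (sq (\<psi> t))) \<longlongrightarrow> 0) (at_left (real_of_ereal T))" by simp
      have "((\<lambda>t. \<psi> t $ 1) \<longlongrightarrow> 0) (at_left (real_of_ereal T))" "((\<lambda>t. \<psi> t $ 2) \<longlongrightarrow> 0) (at_left (real_of_ereal T))"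
        by (rule Lim_null_comparison[OF always_eventually sqrt0]; simp add: sq_def real_le_rsqrt)+
      then show ?thesis using col(1) by (intro conjI tendsto_Pair)
    qed
    ultimately show "let t\<^sub>e = exit_time (d_Q \<alpha> k \<omega> \<xi>p \<xi>m \<delta> cutoff) (2 * \<epsilon>) \<psi> T in
        ((\<forall>t. 0 \<le> t \<and> ereal t < T \<longrightarrow> d_Q \<alpha> k \<omega> \<xi>p \<xi>m \<delta> cutoff (\<psi> t) < 2 * \<epsilon>) \<or> t\<^sub>e < T) \<and>
        (t\<^sub>e < T \<and> W \<alpha> (\<psi> (real_of_ereal t\<^sub>e)) < 0 \<longrightarrow>
           T < \<infinity> \<and>
           ((\<lambda>t. (\<psi> t $ 1, \<psi> t $ 2)) \<longlongrightarrow> (0, 0)) (at_left (real_of_ereal T)))"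
      unfolding d_def te_def Let_def by blast
  qed
qed

end
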